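(* Let $p$ be a prime with $0<p\equiv 7\pmod{16}$ and let $\mathbb{K}=\mathbb{Q}(\sqrt[4]{p})$. Then the class number $h_{\mathbb{K}}$ of $\mathbb{K}$ satisfies $h_{\mathbb{K}}\equiv 2\pmod 4$; equivalently, the $2$-part of the ideal class group of $\mathbb{K}$ is isomorphic to $\mathbb{Z}/2\mathbb{Z}$.
   Context: $\sqrt[4]{p}$ denotes the real positive fourth root of $p$. *)

theory Defs
  imports Complex_Main "HOL-Computational_Algebra.Polynomial"
begin

text \<open>Number fields are realised as subfields of the reals (the field here is real).\<close>

definition is_subfield :: "real set \<Rightarrow> bool" where
  "is_subfield F \<longleftrightarrow> 0 \<in> F \<and> 1 \<in> F \<and>
     (\<forall>x\<in>F. \<forall>y\<in>F. x + y \<in> F \<and> x - y \<in> F \<and> x * y \<in> F) \<and>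
     (\<forall>x\<in>F. x \<noteq> 0 \<longrightarrow> inverse x \<in> F)"

definition gen_field :: "real \<Rightarrow> real set" where
  "gen_field r = \<Inter>{F. is_subfield F \<and> r \<in> F}"

definition alg_int :: "real \<Rightarrow> bool" where
  "alg_int x \<longleftrightarrow> (\<exists>q :: int poly. lead_coeff q = 1 \<and> poly (map_poly of_int q) x = 0)"

definition ring_of_integers :: "real set \<Rightarrow> real set" where
  "ring_of_integers K = {x \<in> K. alg_int x}"

definition is_ideal :: "real set \<Rightarrow> real set \<Rightarrow> bool" where
  "is_ideal R I \<longleftrightarrow> I \<subseteq> R \<and> 0 \<in> I \<and> (\<forall>x\<in>I. \<forall>y\<in>I. x + y \<in> I) \<and>
     (\<forall>a\<in>R. \<forall>x\<in>I. a * x \<in> I)"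

definition nonzero_ideals :: "real set \<Rightarrow> real set set" where
  "nonzero_ideals R = {I. is_ideal R I \<and> I \<noteq> {0}}"

definition ideal_equiv :: "real set \<Rightarrow> (real set \<times> real set) set" where
  "ideal_equiv R = {(I, J). I \<in> nonzero_ideals R \<and> J \<in> nonzero_ideals R \<and>
     (\<exists>\<alpha>\<in>R - {0}. \<exists>\<beta>\<in>R - {0}. (\<lambda>x. \<alpha> * x) ` I = (\<lambda>x. \<beta> * x) ` J)}"

definition ideal_classes :: "real set \<Rightarrow> real set set set" where
  "ideal_classes K = nonzero_ideals (ring_of_integers K) // ideal_equiv (ring_of_integers K)"

definition class_number :: "real set \<Rightarrow> nat" where
  "class_number K = card (ideal_classes K)"

end

theory Submission
  imports Defs "HOL-Number_Theory.Quadratic_Reciprocity" "HOL-Computational_Algebra.Nth_Powers"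
begin

text \<open>
  Write \<open>k = \<rat>(\<surd>p)\<close> and \<open>K = k(\<theta>)\<close> with \<open>\<theta>\<^sup>2 = \<surd>p\<close>. Since \<open>p\<close> is \<open>7\<close> modulo \<open>8\<close>, Pell's equation
  yields \<open>\<pi>\<close> in \<open>k\<close> of norm \<open>2\<close>, and the prime ideal \<open>Q\<close> of \<open>K\<close> above \<open>2\<close> satisfies \<open>Q\<^sup>2 = (\<pi>)\<close>. The
  class number is \<open>2\<close> modulo \<open>4\<close> because the class of \<open>Q\<close> is not a square and is the only
  ideal class of order two.

  If \<open>Q\<close> were equivalent to \<open>J\<^sup>2\<close>, then, as \<open>k\<close> has no ideal class of order two, a unit multiple of \<open>\<pi>\<close>
  would be a relative norm; reducing modulo \<open>\<surd>p\<close>, the rational part \<open>x\<close> of that multiple would be a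
  square modulo \<open>p\<close>. Here \<open>x\<^sup>2 - p y\<^sup>2 = 2\<close>, and quadratic reciprocity evaluates the Legendre symbol
  of \<open>x\<close> as \<open>-1\<close> if \<open>p\<close> is \<open>7\<close> modulo \<open>16\<close>.

  If \<open>I\<^sup>2 = (\<delta>)\<close>, then \<open>I\<close> times its conjugate is generated by some \<open>c\<close> in \<open>k\<close>. After multiplying \<open>\<delta>\<close> by
  a unit its norm becomes the square of such a generator, and Hilbert 90 replaces \<open>I\<close> by an
  equivalent ideal that is invariant under conjugation; such an ideal is principal or equivalent
  to \<open>Q\<close>. The unit adjustment needs a unit of \<open>K\<close> whose norm is not a square. It exists since
  otherwise the smallest unit \<open>\<eta> > 1\<close> of relative norm one would be a square, by the same
  argument applied to the ideal generated by \<open>1 + \<eta>\<close>.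
\<close>

section \<open>Ideals as sets of real numbers\<close>

text \<open>One argument on a quadratic extension \<open>B = A[r]\<close> serves twice: over
  \<open>\<int>\<close> with \<open>r = s\<close>, the root of \<open>p\<close>, and over the
  integers of \<open>k\<close> with \<open>r = \<theta>\<close>. The lower run shows that
  \<open>k\<close> has no ideal class of order two, an input of the upper one. In place of prime
  factorisation of ideals there are invertibility up to principal ideals and uniqueness of square
  roots of ideals.

  Signs are the obstacle. Conjugation of \<open>k\<close> turns \<open>A * A - s * (B * B)\<close>
  into a sum of nonnegative terms, so nonzero relative norms from \<open>K\<close> have positive
  conjugate, and the units of \<open>k\<close> that occur are positive. A positive unit of
  \<open>k\<close> is a square or half a square, by the classical descent on Pell's equation. The
  factor 2 is the only discrepancy left; hence the need for a unit of \<open>K\<close> whose norm is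
  half a square. The same positivity fixes the sign of \<open>x\<close> in the Legendre symbol
  argument, where it matters because -1 is not a square modulo \<open>p\<close>.

  Since \<open>card\<close> of an infinite set is 0, finiteness of the class group is part of the
  claim.\<close>

definition smul :: "real \<Rightarrow> real set \<Rightarrow> real set" where
  "smul c I = (\<lambda>x. c * x) ` I"

text \<open>Finite sums of products, one summand at a time. The sets are arbitrary, since
  \<open>iprod M B\<close> also serves as the extension of an ideal \<open>M\<close> of a subring to
  \<open>B\<close>.\<close>

inductive_set iprod :: "real set \<Rightarrow> real set \<Rightarrow> real set" for I J where
  zero: "0 \<in> iprod I J"
| step: "x \<in> I \<Longrightarrow> y \<in> J \<Longrightarrow> z \<in> iprod I J \<Longrightarrow> x * y + z \<in> iprod I J"

definition is_subring :: "real set \<Rightarrow> bool" where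
  "is_subring R \<longleftrightarrow> 0 \<in> R \<and> 1 \<in> R \<and> (\<forall>x\<in>R. \<forall>y\<in>R. x + y \<in> R \<and> x - y \<in> R \<and> x * y \<in> R)"

text \<open>Ideals without the containment in the ring: scaling by a field element may leave the
  ideals but not the modules.\<close>

definition is_module :: "real set \<Rightarrow> real set \<Rightarrow> bool" where
  "is_module R M \<longleftrightarrow> 0 \<in> M \<and> (\<forall>x\<in>M. \<forall>y\<in>M. x + y \<in> M) \<and> (\<forall>a\<in>R. \<forall>x\<in>M. a * x \<in> M)"

lemma is_ideal_iff: "is_ideal R I \<longleftrightarrow> I \<subseteq> R \<and> is_module R I"
  by (auto simp: is_ideal_def is_module_def)

lemma iprodI: "x \<in> I \<Longrightarrow> y \<in> J \<Longrightarrow> x * y \<in> iprod I J"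
  using iprod.step[OF _ _ iprod.zero] by fastforce

lemma iprod_add: "u \<in> iprod I J \<Longrightarrow> v \<in> iprod I J \<Longrightarrow> u + v \<in> iprod I J"
  by (induction rule: iprod.induct) (auto simp: add.assoc intro: iprod.step)

lemma iprod_least:
  assumes "0 \<in> M" "\<And>x y. x \<in> M \<Longrightarrow> y \<in> M \<Longrightarrow> x + y \<in> M" "\<And>x y. x \<in> I \<Longrightarrow> y \<in> J \<Longrightarrow> x * y \<in> M"
  shows "iprod I J \<subseteq> M"
proof
  fix x assume "x \<in> iprod I J"
  then show "x \<in> M" by induction (use assms in auto)
qed

lemma iprod_mono: "I \<subseteq> I' \<Longrightarrow> J \<subseteq> J' \<Longrightarrow> iprod I J \<subseteq> iprod I' J'"
  by (rule iprod_least) (auto intro: iprod.zero iprod_add iprodI)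

lemma iprod_commute: "iprod I J = iprod J I"
proof -
  have "iprod I J \<subseteq> iprod J I" for I J
  proof (rule iprod_least)
    show "x * y \<in> iprod J I" if "x \<in> I" "y \<in> J" for x y
      using iprodI[OF that(2,1)] by (simp add: mult.commute)
  qed (auto intro: iprod.zero iprod_add)
  then show ?thesis by blast
qed

lemma iprod_assoc: "iprod (iprod I J) L = iprod I (iprod J L)"
proof -
  have *: "iprod (iprod I J) L \<subseteq> iprod I (iprod J L)" for I J L
  proof (rule iprod_least)
    fix x y assume "x \<in> iprod I J" "y \<in> L"
    then show "x * y \<in> iprod I (iprod J L)"
    proof induction
      case (step a b z)
      have "(a * b + z) * y = a * (b * y) + z * y" by (simp add: algebra_simps)
      with step show ?case by (auto intro: iprod.step iprodI)
    qed (simp add: iprod.zero)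
  qed (auto intro: iprod.zero iprod_add)
  \<comment> \<open>The reverse inclusion is the first one read backwards through
    commutativity.\<close>
  have "iprod I (iprod J L) \<subseteq> iprod (iprod I J) L"
    using *[of L J I] by (simp add: iprod_commute[of _ I] iprod_commute[of L] iprod_commute[of _ "iprod I J"] iprod_commute[of J I])
  with * show ?thesis by blast
qed

lemma iprod_left_commute: "iprod I (iprod J L) = iprod J (iprod I L)"
  by (metis iprod_assoc iprod_commute)

lemmas iprod_ac = iprod_assoc iprod_commute iprod_left_commute

lemma smul_smul: "smul a (smul b I) = smul (a * b) I"
  by (auto simp: smul_def image_image mult.assoc)

lemma smul_1 [simp]: "smul 1 I = I"
  by (simp add: smul_def)

lemma smul_iff: "c \<noteq> 0 \<Longrightarrow> x \<in> smul c I \<longleftrightarrow> x / c \<in> I"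
  by (force simp: smul_def image_iff)

lemma smul_memI: "x \<in> I \<Longrightarrow> c * x \<in> smul c I"
  by (auto simp: smul_def)

lemma smul_mono: "I \<subseteq> J \<Longrightarrow> smul c I \<subseteq> smul c J"
  by (auto simp: smul_def)

lemma smul_subset_cancel: "c \<noteq> 0 \<Longrightarrow> smul c I \<subseteq> smul c J \<longleftrightarrow> I \<subseteq> J"
  by (auto simp: smul_def)

lemma smul_cancel: "c \<noteq> 0 \<Longrightarrow> smul c I = smul c J \<longleftrightarrow> I = J"
  using smul_subset_cancel by blast

lemma iprod_smul_left: "iprod (smul c I) J = smul c (iprod I J)"
proof
  show "iprod (smul c I) J \<subseteq> smul c (iprod I J)"
  proof (rule iprod_least)
    show "0 \<in> smul c (iprod I J)" using smul_memI[OF iprod.zero] by fastforce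
    show "x + y \<in> smul c (iprod I J)" if "x \<in> smul c (iprod I J)" "y \<in> smul c (iprod I J)" for x y
      using that by (auto simp: smul_def image_iff) (metis iprod_add distrib_left)
    show "x * y \<in> smul c (iprod I J)" if "x \<in> smul c I" "y \<in> J" for x y
      using that by (auto simp: smul_def image_iff mult.assoc intro: iprodI)
  qed
  show "smul c (iprod I J) \<subseteq> iprod (smul c I) J"
  proof
    fix x assume "x \<in> smul c (iprod I J)"
    then obtain y where x: "x = c * y" and y: "y \<in> iprod I J" by (auto simp: smul_def)
    from y have "c * y \<in> iprod (smul c I) J"
      by induction (auto simp: distrib_left mult.assoc[symmetric] intro: iprod.zero iprod.step smul_memI)
    then show "x \<in> iprod (smul c I) J" by (simp add: x)
  qed
qed

lemma iprod_smul_right: "iprod I (smul c J) = smul c (iprod I J)"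
  by (metis iprod_commute iprod_smul_left)

lemma smul_module: "is_module R M \<Longrightarrow> is_module R (smul c M)"
  unfolding is_module_def smul_def
proof (intro conjI ballI)
  assume M: "0 \<in> M \<and> (\<forall>x\<in>M. \<forall>y\<in>M. x + y \<in> M) \<and> (\<forall>a\<in>R. \<forall>x\<in>M. a * x \<in> M)"
  show "0 \<in> (\<lambda>x. c * x) ` M" using M by force
  show "x + y \<in> (\<lambda>x. c * x) ` M" if "x \<in> (\<lambda>x. c * x) ` M" "y \<in> (\<lambda>x. c * x) ` M" for x y
    using that M by (auto simp: distrib_left[symmetric])
  show "a * x \<in> (\<lambda>x. c * x) ` M" if "a \<in> R" "x \<in> (\<lambda>x. c * x) ` M" for a x
    using that M by (auto simp: mult.left_commute[of a])
qed

lemma iprod_module: "is_module R I \<Longrightarrow> is_module R (iprod I J)"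
  unfolding is_module_def
proof (intro conjI ballI)
  fix a x assume R: "0 \<in> I \<and> (\<forall>x\<in>I. \<forall>y\<in>I. x + y \<in> I) \<and> (\<forall>a\<in>R. \<forall>x\<in>I. a * x \<in> I)" "a \<in> R"
    and x: "x \<in> iprod I J"
  from x show "a * x \<in> iprod I J"
    by induction (use R in \<open>auto simp: distrib_left mult.assoc[symmetric] intro: iprod.zero iprod.step\<close>)
qed (auto intro: iprod.zero iprod_add)

lemma iprod_module_right: "is_module R J \<Longrightarrow> is_module R (iprod I J)"
  by (metis iprod_commute iprod_module)

lemma subring_module: "is_subring R \<Longrightarrow> is_module R R"
  by (auto simp: is_subring_def is_module_def)

lemma iprod_ring_left: "is_subring R \<Longrightarrow> is_module R M \<Longrightarrow> iprod R M = M"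
proof
  assume R: "is_subring R" "is_module R M"
  show "iprod R M \<subseteq> M" by (rule iprod_least) (use R in \<open>auto simp: is_module_def\<close>)
  show "M \<subseteq> iprod R M"
    using iprodI[of 1 R _ M] R by (auto simp: is_subring_def)
qed

lemma iprod_ring_right: "is_subring R \<Longrightarrow> is_module R M \<Longrightarrow> iprod M R = M"
  by (metis iprod_commute iprod_ring_left)

lemma module_minus: "is_subring R \<Longrightarrow> is_module R M \<Longrightarrow> x \<in> M \<Longrightarrow> - x \<in> M"
proof -
  assume R: "is_subring R" and M: "is_module R M" "x \<in> M"
  have "0 - 1 \<in> R" using R unfolding is_subring_def by blast
  then have "(0 - 1) * x \<in> M" using M by (auto simp only: is_module_def)
  then show ?thesis by simp
qed

lemma module_diff: "is_subring R \<Longrightarrow> is_module R M \<Longrightarrow> x \<in> M \<Longrightarrow> y \<in> M \<Longrightarrow> x - y \<in> M"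
  using module_minus[of R M y] unfolding is_module_def by (metis add_uminus_conv_diff)

lemma module_nonzero: "is_module R M \<Longrightarrow> M \<noteq> {0} \<Longrightarrow> \<exists>x\<in>M. x \<noteq> 0"
  by (auto simp: is_module_def)

lemma iprod_ideal: "is_subring R \<Longrightarrow> is_ideal R I \<Longrightarrow> is_ideal R J \<Longrightarrow> is_ideal R (iprod I J)"
  unfolding is_ideal_iff using iprod_module iprod_mono[of I R J R]
  by (metis iprod_ring_left subring_module)

lemma iprod_nonzero: "is_module R I \<Longrightarrow> is_module R J \<Longrightarrow> I \<noteq> {0} \<Longrightarrow> J \<noteq> {0} \<Longrightarrow> iprod I J \<noteq> {0}"
proof -
  assume I: "is_module R I" "I \<noteq> {0}" and J: "is_module R J" "J \<noteq> {0}"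
  obtain x y where "x \<in> I" "x \<noteq> 0" "y \<in> J" "y \<noteq> 0"
    using module_nonzero I J by meson
  then have "x * y \<in> iprod I J" "x * y \<noteq> 0" by (auto intro: iprodI)
  then show ?thesis by blast
qed

lemma smul_nonzero: "c \<noteq> 0 \<Longrightarrow> I \<noteq> {0} \<Longrightarrow> smul c I \<noteq> {0}"
  using smul_cancel[of c I "{0}"] by (simp add: smul_def)

lemma ideal_smul: "is_subring R \<Longrightarrow> c \<in> R \<Longrightarrow> is_ideal R I \<Longrightarrow> is_ideal R (smul c I)"
  unfolding is_ideal_iff using smul_module by (auto simp: smul_def is_subring_def)

lemma subring_ideal: "is_subring R \<Longrightarrow> is_ideal R R"
  by (simp add: is_ideal_iff subring_module)

lemma iprod_principal: "is_subring R \<Longrightarrow> iprod (smul a R) (smul b R) = smul (a * b) R"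
  by (simp add: iprod_smul_left iprod_smul_right smul_smul iprod_ring_left subring_module mult.commute)

lemma subring_nonzero: "is_subring R \<Longrightarrow> R \<noteq> {0}"
  by (auto simp: is_subring_def)

lemma smul_ring_iff: "is_subring R \<Longrightarrow> c \<in> smul c R"
  using smul_memI[of 1 R c] by (auto simp: is_subring_def)

lemma smul_eq_unit:
  assumes R: "is_subring R" and "smul a R = smul b R" "b \<noteq> 0"
  shows "\<exists>v\<in>R. \<exists>v'\<in>R. v * v' = 1 \<and> a = v * b"
proof -
  have "a \<in> smul b R" "b \<in> smul a R" using smul_ring_iff[OF R] assms by blast+
  then obtain v v' where v: "v \<in> R" "v' \<in> R" "a = b * v" "b = a * v'"
    unfolding smul_def by blast
  then have "b * (v * v') = b * 1" by (metis mult.assoc mult.right_neutral)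
  then have "v * v' = 1" using assms(3) by simp
  with v show ?thesis by (metis mult.commute)
qed

lemma smul_unit:
  assumes R: "is_subring R" and M: "is_module R M" and v: "v \<in> R" "v' \<in> R" "v * v' = 1"
  shows "smul v M = M"
proof -
  have 1: "smul v M \<subseteq> M" "smul v' M \<subseteq> M" using M v by (auto simp: smul_def is_module_def)
  then have "smul v (smul v' M) \<subseteq> smul v M" using smul_mono by blast
  then show ?thesis using 1 v by (simp add: smul_smul)
qed

section \<open>Domains with invertible ideals\<close>

locale frac_dom =
  fixes A F :: "real set"
  assumes subfield: "is_subfield F" and subring: "is_subring A" and A_F: "A \<subseteq> F"
    and frac: "x \<in> F \<Longrightarrow> \<exists>a\<in>A. a \<noteq> 0 \<and> a * x \<in> A"
    and sq_closed: "x \<in> F \<Longrightarrow> x * x \<in> A \<Longrightarrow> x \<in> A"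

text \<open>Ideals are invertible up to a principal ideal; \<open>I'\<close> is an integral multiple
  of the inverse. Of integral closedness only \<open>sq_closed\<close> is demanded, enough to
  extract square roots of ideals.\<close>

locale ded = frac_dom +
  assumes inv: "is_ideal A I \<Longrightarrow> I \<noteq> {0} \<Longrightarrow>
    \<exists>I' m. is_ideal A I' \<and> I' \<noteq> {0} \<and> m \<in> A \<and> m \<noteq> 0 \<and> iprod I I' = smul m A"

context frac_dom
begin

lemma A_0: "0 \<in> A" and A_1: "1 \<in> A"
  and A_add: "x \<in> A \<Longrightarrow> y \<in> A \<Longrightarrow> x + y \<in> A"
  and A_diff: "x \<in> A \<Longrightarrow> y \<in> A \<Longrightarrow> x - y \<in> A"
  and A_mult: "x \<in> A \<Longrightarrow> y \<in> A \<Longrightarrow> x * y \<in> A"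
  using subring by (auto simp: is_subring_def)

lemma A_minus: "x \<in> A \<Longrightarrow> - x \<in> A"
  using A_diff[OF A_0] by simp

lemma F_0: "0 \<in> F" and F_1: "1 \<in> F"
  and F_add: "x \<in> F \<Longrightarrow> y \<in> F \<Longrightarrow> x + y \<in> F"
  and F_diff: "x \<in> F \<Longrightarrow> y \<in> F \<Longrightarrow> x - y \<in> F"
  and F_mult: "x \<in> F \<Longrightarrow> y \<in> F \<Longrightarrow> x * y \<in> F"
  using subfield by (auto simp: is_subfield_def)

lemma F_minus: "x \<in> F \<Longrightarrow> - x \<in> F"
  using F_diff[OF F_0] by simp

lemma F_inverse: "x \<in> F \<Longrightarrow> inverse x \<in> F"
  using subfield F_0 by (cases "x = 0") (auto simp: is_subfield_def)

lemma F_divide: "x \<in> F \<Longrightarrow> y \<in> F \<Longrightarrow> x / y \<in> F"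
  by (simp add: divide_inverse F_mult F_inverse)

end

context ded
begin

text \<open>If \<open>J J' = (m)\<close>, every \<open>z\<close> in \<open>I J'\<close> has
  \<open>z * z\<close> in \<open>I^2 J'^2 = J^2 J'^2 = (m^2)\<close>, so \<open>z / m\<close> lies
  in \<open>A\<close> by \<open>sq_closed\<close>. Thus \<open>I J'\<close> is contained in
  \<open>(m)\<close>, and multiplying by \<open>J\<close> cancels \<open>J'\<close>.\<close>

lemma square_root_unique:
  assumes I: "is_ideal A I" "I \<noteq> {0}" and J: "is_ideal A J" "J \<noteq> {0}"
    and eq: "iprod I I = iprod J J"
  shows "I = J"
proof -
  have "I \<subseteq> J" if I: "is_ideal A I" and J: "is_ideal A J" "J \<noteq> {0}" and eq: "iprod I I = iprod J J" for I J
  proof -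
    obtain J' m where J': "is_ideal A J'" "m \<in> A" "m \<noteq> 0" "iprod J J' = smul m A"
      using inv[OF J] by blast
    have "iprod I J' \<subseteq> smul m A"
    proof
      fix z assume z: "z \<in> iprod I J'"
      have "iprod I J' \<subseteq> A"
        using iprod_ideal[OF subring I J'(1)] by (simp add: is_ideal_def)
      then have zA: "z \<in> A" using z by blast
      have "z * z \<in> iprod (iprod I J') (iprod I J')" by (rule iprodI[OF z z])
      also have "\<dots> = iprod (iprod I I) (iprod J' J')"
        by (simp add: iprod_ac)
      also have "\<dots> = iprod (iprod J J') (iprod J J')"
        unfolding eq by (simp add: iprod_ac)
      also have "\<dots> = smul (m * m) A"
        unfolding J' by (rule iprod_principal[OF subring])
      finally have "(z / m) * (z / m) \<in> A" using J' by (simp add: smul_iff)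
      moreover have "z / m \<in> F" using zA J' A_F by (auto intro: F_divide)
      ultimately show "z \<in> smul m A" using sq_closed J' by (simp add: smul_iff)
    qed
    then have "iprod (iprod I J') J \<subseteq> iprod (smul m A) J" by (rule iprod_mono) simp
    moreover have "iprod (iprod I J') J = smul m I"
      using J' I by (metis iprod_assoc iprod_commute iprod_smul_left iprod_ring_left subring is_ideal_iff)
    moreover have "iprod (smul m A) J = smul m J"
      using J by (simp add: iprod_smul_left iprod_ring_left subring is_ideal_iff)
    ultimately show "I \<subseteq> J" using J' by (simp add: smul_subset_cancel)
  qed
  then show ?thesis using assms by blast
qed

end

section \<open>Quadratic extensions of Dedekind domains\<close>

text \<open>With \<open>B = A[r]\<close> and \<open>E = F(r)\<close>, where \<open>r\<^sup>2 = d\<close>. The conjugation \<open>cj\<close> is meaningful on \<open>E\<close> only.\<close>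

locale quad0 = ded A F for A F :: "real set" +
  fixes d r :: real
  assumes r_sq: "r * r = d" and d_A: "d \<in> A" and r_F: "r \<notin> F"
begin

definition E :: "real set" where "E = {x + y * r | x y. x \<in> F \<and> y \<in> F}"
definition B :: "real set" where "B = {x + y * r | x y. x \<in> A \<and> y \<in> A}"
definition cj :: "real \<Rightarrow> real" where
  "cj z = (THE w. \<exists>x\<in>F. \<exists>y\<in>F. z = x + y * r \<and> w = x - y * r)"

lemma rep_unique:
  assumes "x \<in> F" "y \<in> F" "x' \<in> F" "y' \<in> F" "x + y * r = x' + y' * r"
  shows "x = x'" "y = y'"
proof -
  show y: "y = y'"
  proof (rule ccontr)
    assume "y \<noteq> y'"
    then have "r = (x' - x) / (y - y')" using assms(5) by (simp add: field_simps)
    then show False using r_F assms by (metis F_diff F_divide)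
  qed
  show "x = x'" using assms(5) y by simp
qed

lemma E_I: "x \<in> F \<Longrightarrow> y \<in> F \<Longrightarrow> x + y * r \<in> E"
  by (auto simp: E_def)

lemma B_I: "x \<in> A \<Longrightarrow> y \<in> A \<Longrightarrow> x + y * r \<in> B"
  by (auto simp: B_def)

lemma E_E: "z \<in> E \<Longrightarrow> (\<And>x y. x \<in> F \<Longrightarrow> y \<in> F \<Longrightarrow> z = x + y * r \<Longrightarrow> P) \<Longrightarrow> P"
  by (auto simp: E_def)

lemma B_E: "z \<in> B \<Longrightarrow> (\<And>x y. x \<in> A \<Longrightarrow> y \<in> A \<Longrightarrow> z = x + y * r \<Longrightarrow> P) \<Longrightarrow> P"
  by (auto simp: B_def)

lemma cj_rep: "x \<in> F \<Longrightarrow> y \<in> F \<Longrightarrow> cj (x + y * r) = x - y * r"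
proof -
  assume *: "x \<in> F" "y \<in> F"
  have "w = x - y * r" if "\<exists>x'\<in>F. \<exists>y'\<in>F. x + y * r = x' + y' * r \<and> w = x' - y' * r" for w
    using that rep_unique[OF *] by metis
  then show ?thesis unfolding cj_def using * by (intro the_equality) blast+
qed

lemma d_F: "d \<in> F" using d_A A_F by blast

lemma F_E: "x \<in> F \<Longrightarrow> x \<in> E" using E_I[of x 0] F_0 by simp
lemma A_B: "x \<in> A \<Longrightarrow> x \<in> B" using B_I[of x 0] A_0 by simp
lemma r_E: "r \<in> E" using E_I[of 0 1] F_0 F_1 by simp
lemma r_B: "r \<in> B" using B_I[of 0 1] A_0 A_1 by simp

lemma B_E_subset: "B \<subseteq> E" using A_F by (auto simp: B_def E_def)

lemma B_in_E: "z \<in> B \<Longrightarrow> z \<in> E" using B_E_subset by blast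

lemma cj_F: "x \<in> F \<Longrightarrow> cj x = x" using cj_rep[of x 0] F_0 by simp

lemma cj_r: "cj r = - r" using cj_rep[of 0 1] F_0 F_1 by simp

lemma r_nz: "r \<noteq> 0" using r_F F_0 by blast

lemma d_nz: "d \<noteq> 0" using r_nz r_sq by auto

lemma E_add: "z \<in> E \<Longrightarrow> w \<in> E \<Longrightarrow> z + w \<in> E"
  and cj_add: "z \<in> E \<Longrightarrow> w \<in> E \<Longrightarrow> cj (z + w) = cj z + cj w"
proof -
  assume "z \<in> E" "w \<in> E"
  then obtain x y u v where *: "x \<in> F" "y \<in> F" "u \<in> F" "v \<in> F" "z = x + y * r" "w = u + v * r"
    by (auto simp: E_def)
  then have eq: "z + w = (x + u) + (y + v) * r" by (simp add: algebra_simps)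
  show "z + w \<in> E" unfolding eq using * by (intro E_I F_add)
  show "cj (z + w) = cj z + cj w"
    unfolding eq using * by (simp add: cj_rep F_add) (simp add: algebra_simps)
qed

lemma E_mult: "z \<in> E \<Longrightarrow> w \<in> E \<Longrightarrow> z * w \<in> E"
  and cj_mult: "z \<in> E \<Longrightarrow> w \<in> E \<Longrightarrow> cj (z * w) = cj z * cj w"
proof -
  assume "z \<in> E" "w \<in> E"
  then obtain x y u v where *: "x \<in> F" "y \<in> F" "u \<in> F" "v \<in> F" "z = x + y * r" "w = u + v * r"
    by (auto simp: E_def)
  have eq: "z * w = (x * u + y * v * d) + (x * v + y * u) * r"
    using * by (simp add: r_sq[symmetric] algebra_simps)
  have m: "x * u + y * v * d \<in> F" "x * v + y * u \<in> F" using * by (auto intro!: F_add F_mult d_F)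
  show "z * w \<in> E" unfolding eq using m by (rule E_I)
  show "cj (z * w) = cj z * cj w"
    unfolding eq using * m by (simp add: cj_rep) (simp add: r_sq[symmetric] algebra_simps)
qed

lemma cj_E: "z \<in> E \<Longrightarrow> cj z \<in> E"
  by (elim E_E) (use cj_rep E_I F_minus in \<open>metis mult_minus_left add_uminus_conv_diff\<close>)

lemma cj_cj: "z \<in> E \<Longrightarrow> cj (cj z) = z"
proof (elim E_E)
  fix x y assume *: "x \<in> F" "y \<in> F" "z = x + y * r"
  have "cj (x + (- y) * r) = x - (- y) * r" by (rule cj_rep) (use * F_minus in auto)
  then show ?thesis using * by (simp add: cj_rep)
qed

lemma cj_B: "z \<in> B \<Longrightarrow> cj z \<in> B"
proof (elim B_E)
  fix x y assume *: "x \<in> A" "y \<in> A" "z = x + y * r"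
  then have "x \<in> F" "y \<in> F" using A_F by blast+
  then have "cj z = x + (- y) * r" using * by (simp add: cj_rep)
  then show ?thesis using * A_minus B_I by metis
qed

lemma cj_0 [simp]: "cj 0 = 0" and cj_1 [simp]: "cj 1 = 1"
  by (auto simp: cj_F F_0 F_1)

lemma E_minus: "z \<in> E \<Longrightarrow> - z \<in> E"
  using E_mult[of "-1" z] F_E[of "-1"] F_minus[OF F_1] by simp

lemma cj_minus: "z \<in> E \<Longrightarrow> cj (- z) = - cj z"
  using cj_mult[of "-1" z] F_E[of "-1"] F_minus[OF F_1] by (simp add: cj_F)

lemma E_diff: "z \<in> E \<Longrightarrow> w \<in> E \<Longrightarrow> z - w \<in> E"
  using E_add[of z "- w"] E_minus by simp

lemma cj_diff: "z \<in> E \<Longrightarrow> w \<in> E \<Longrightarrow> cj (z - w) = cj z - cj w"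
  using cj_add[of z "- w"] E_minus cj_minus by simp

lemma norm_F: "z \<in> E \<Longrightarrow> z * cj z \<in> F"
proof (elim E_E)
  fix x y assume *: "x \<in> F" "y \<in> F" "z = x + y * r"
  then have cj: "cj z = x - y * r" by (simp add: cj_rep)
  have eq: "z * cj z = x * x - y * y * d" unfolding cj unfolding * by (simp add: r_sq[symmetric] algebra_simps)
  show ?thesis unfolding eq using * by (intro F_diff F_mult d_F)
qed

lemma trace_F: "z \<in> E \<Longrightarrow> z + cj z \<in> F"
proof (elim E_E)
  fix x y assume *: "x \<in> F" "y \<in> F" "z = x + y * r"
  then have "z + cj z = x + x" by (simp add: cj_rep)
  then show ?thesis using * F_add by metis
qed

lemma cj_nz: "z \<in> E \<Longrightarrow> z \<noteq> 0 \<Longrightarrow> cj z \<noteq> 0"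
  by (metis cj_0 cj_cj)

lemma E_inverse: "z \<in> E \<Longrightarrow> inverse z \<in> E"
proof (cases "z = 0")
  case False
  assume z: "z \<in> E"
  then have eq: "inverse z = inverse (z * cj z) * cj z" using cj_nz False by (simp add: field_simps)
  show ?thesis unfolding eq by (rule E_mult[OF F_E[OF F_inverse[OF norm_F[OF z]]] cj_E[OF z]])
qed (simp add: F_E F_0)

lemma E_divide: "z \<in> E \<Longrightarrow> w \<in> E \<Longrightarrow> z / w \<in> E"
  by (simp add: divide_inverse E_mult E_inverse)

lemma cj_inverse: "z \<in> E \<Longrightarrow> cj (inverse z) = inverse (cj z)"
proof (cases "z = 0")
  case False
  assume z: "z \<in> E"
  have "cj z * cj (inverse z) = 1" using cj_mult[OF z E_inverse[OF z]] False by simp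
  then show ?thesis by (simp add: inverse_unique)
qed simp

lemma cj_divide: "z \<in> E \<Longrightarrow> w \<in> E \<Longrightarrow> cj (z / w) = cj z / cj w"
  by (simp add: divide_inverse cj_mult E_inverse cj_inverse)

lemma E_subfield: "is_subfield E"
  unfolding is_subfield_def using E_add E_diff E_mult E_inverse F_E F_0 F_1 by auto

lemma B_subring: "is_subring B"
  unfolding is_subring_def
proof (intro conjI ballI)
  fix z w assume "z \<in> B" "w \<in> B"
  then obtain x y u v where *: "x \<in> A" "y \<in> A" "u \<in> A" "v \<in> A" "z = x + y * r" "w = u + v * r"
    by (auto simp: B_def)
  have eq: "z + w = (x + u) + (y + v) * r" "z - w = (x - u) + (y - v) * r"
    "z * w = (x * u + y * v * d) + (x * v + y * u) * r"
    using * by (simp_all add: r_sq[symmetric] algebra_simps)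
  show "z + w \<in> B" "z - w \<in> B" "z * w \<in> B"
    unfolding eq using * by (intro B_I A_add A_diff A_mult d_A; simp)+
qed (use A_B A_0 A_1 in auto)

lemma B_Int_F: "z \<in> B \<Longrightarrow> z \<in> F \<Longrightarrow> z \<in> A"
proof (elim B_E)
  fix x y assume *: "z \<in> F" "x \<in> A" "y \<in> A" "z = x + y * r"
  have "x = z"
  proof (rule rep_unique(1))
    show "x + y * r = z + 0 * r" using * by simp
  qed (use * A_F F_0 in blast)+
  then show ?thesis using * by metis
qed

lemma norm_A: "z \<in> B \<Longrightarrow> z * cj z \<in> A"
  using B_Int_F norm_F B_in_E cj_B B_subring by (auto simp: is_subring_def)

lemma trace_A: "z \<in> B \<Longrightarrow> z + cj z \<in> A"
  using B_Int_F trace_F B_in_E cj_B B_subring by (auto simp: is_subring_def)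

lemma E_frac: "z \<in> E \<Longrightarrow> \<exists>a\<in>A. a \<noteq> 0 \<and> a * z \<in> B"
proof (elim E_E)
  fix x y assume *: "x \<in> F" "y \<in> F" "z = x + y * r"
  obtain a b where ab: "a \<in> A" "a \<noteq> 0" "a * x \<in> A" "b \<in> A" "b \<noteq> 0" "b * y \<in> A"
    using frac * by meson
  have "(a * b) * z = b * (a * x) + a * (b * y) * r" using * by (simp add: algebra_simps)
  then have "(a * b) * z \<in> B" using ab by (auto intro!: B_I A_mult)
  then show ?thesis using ab A_mult by (metis mult_eq_0_iff)
qed

lemma cj_iprod:
  assumes "I \<subseteq> E" "J \<subseteq> E"
  shows "cj ` iprod I J = iprod (cj ` I) (cj ` J)"
proof -
  have sub: "iprod I J \<subseteq> E" if "I \<subseteq> E" "J \<subseteq> E" for I J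
    by (rule iprod_least) (use that E_mult E_add F_E F_0 in auto)
  have *: "cj ` iprod I J \<subseteq> iprod (cj ` I) (cj ` J)" if IJ: "I \<subseteq> E" "J \<subseteq> E" for I J
  proof
    fix z assume "z \<in> cj ` iprod I J"
    then obtain w where w: "w \<in> iprod I J" and z: "z = cj w" by blast
    from w have "w \<in> E \<and> cj w \<in> iprod (cj ` I) (cj ` J)"
    proof induction
      case (step x y z)
      then have "x \<in> E" "y \<in> E" "z \<in> E" using IJ by auto
      then show ?case using step by (auto simp: cj_add cj_mult E_add E_mult intro!: iprod.step)
    qed (auto simp: F_E F_0 iprod.zero)
    then show "z \<in> iprod (cj ` I) (cj ` J)" using z by simp
  qed
  have cc: "cj ` cj ` X = X" if "X \<subseteq> E" for X
    using that cj_cj by (force simp: image_iff)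
  have E': "cj ` I \<subseteq> E" "cj ` J \<subseteq> E" using assms cj_E by auto
  have "cj ` iprod (cj ` I) (cj ` J) \<subseteq> iprod I J"
    using *[OF E'] by (simp add: cc assms)
  then have "cj ` cj ` iprod (cj ` I) (cj ` J) \<subseteq> cj ` iprod I J" by blast
  then show ?thesis using *[OF assms] cc[OF sub[OF E']] by auto
qed

lemma cj_smul: "c \<in> E \<Longrightarrow> I \<subseteq> E \<Longrightarrow> cj ` smul c I = smul (cj c) (cj ` I)"
  by (force simp: smul_def image_image cj_mult)

lemma cj_B_image: "cj ` B = B"
  using cj_B cj_cj B_in_E by (force simp: image_iff)

lemma cj_ideal: "is_ideal B I \<Longrightarrow> is_ideal B (cj ` I)"
  unfolding is_ideal_iff
proof (intro conjI, goal_cases)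
  case 1
  then show ?case using cj_B by auto
next
  case 2
  then have IE: "\<And>x. x \<in> I \<Longrightarrow> x \<in> E" using B_in_E by blast
  show ?case unfolding is_module_def
  proof (intro conjI ballI)
    show "0 \<in> cj ` I" using 2 by (force simp: is_module_def)
    fix x y assume "x \<in> cj ` I" "y \<in> cj ` I"
    then show "x + y \<in> cj ` I"
      using 2 by (auto simp: is_module_def image_iff IE) (metis IE cj_add)
  next
    fix a x assume a: "a \<in> B" and "x \<in> cj ` I"
    then obtain w where w: "w \<in> I" "x = cj w" by auto
    then have "a * x = cj (cj a * w)" using a by (simp add: cj_mult cj_E B_in_E IE cj_cj)
    moreover have "cj a * w \<in> I" using 2 w a cj_B by (auto simp: is_module_def)
    ultimately show "a * x \<in> cj ` I" by blast
  qed
qed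

lemma cj_nonzero: "is_ideal B I \<Longrightarrow> I \<noteq> {0} \<Longrightarrow> cj ` I \<noteq> {0}"
proof -
  assume I: "is_ideal B I" "I \<noteq> {0}"
  then obtain x where x: "x \<in> I" "x \<noteq> 0" using module_nonzero by (metis is_ideal_iff)
  then have "cj x \<noteq> 0" using I B_in_E by (intro cj_nz) (auto simp: is_ideal_def)
  with x show ?thesis by blast
qed

lemma iprod_B:
  assumes "is_module A M"
  shows "iprod M B = {x + y * r | x y. x \<in> M \<and> y \<in> M}"
proof
  show "iprod M B \<subseteq> {x + y * r | x y. x \<in> M \<and> y \<in> M}"
  proof (rule iprod_least)
    show "0 \<in> {x + y * r | x y. x \<in> M \<and> y \<in> M}" using assms by (force simp: is_module_def)
  next
    fix z w assume "z \<in> {x + y * r | x y. x \<in> M \<and> y \<in> M}" "w \<in> {x + y * r | x y. x \<in> M \<and> y \<in> M}"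
    then obtain x y u v where *: "x \<in> M" "y \<in> M" "u \<in> M" "v \<in> M" "z = x + y * r" "w = u + v * r" by auto
    then have "z + w = (x + u) + (y + v) * r" by (simp add: algebra_simps)
    then show "z + w \<in> {x + y * r | x y. x \<in> M \<and> y \<in> M}" using * assms unfolding is_module_def by blast
  next
    fix m b assume m: "m \<in> M" and "b \<in> B"
    then obtain x y where *: "x \<in> A" "y \<in> A" "b = x + y * r" by (auto simp: B_def)
    then have "m * b = x * m + (y * m) * r" by (simp add: algebra_simps)
    then show "m * b \<in> {x + y * r | x y. x \<in> M \<and> y \<in> M}" using * m assms unfolding is_module_def by blast
  qed
  show "{x + y * r | x y. x \<in> M \<and> y \<in> M} \<subseteq> iprod M B"
    using iprodI[of _ M 1 B] iprodI[of _ M r B] A_B A_1 r_B by (auto intro!: iprod_add)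
qed

lemma iprod_B_Int_F:
  assumes "is_module A M" "M \<subseteq> F"
  shows "iprod M B \<inter> F = M"
proof -
  have *: "x = x + y * r" if "x \<in> M" "y \<in> M" "x + y * r \<in> F" for x y
  proof (rule rep_unique(1))
    show "x + y * r = (x + y * r) + 0 * r" by simp
  qed (use that assms F_0 in blast)+
  have "iprod M B \<inter> F \<subseteq> M" unfolding iprod_B[OF assms(1)] using * by fastforce
  moreover have "M \<subseteq> iprod M B \<inter> F" using iprodI[of _ M 1 B] A_B A_1 assms by fastforce
  ultimately show ?thesis by blast
qed

text \<open>Extension to \<open>B\<close> is undone by intersecting with \<open>F\<close>; in this
  way equations between extended ideals are brought down to \<open>A\<close>.\<close>

lemma iprod_B_inject:
  assumes "is_module A M" "M \<subseteq> F" "is_module A N" "N \<subseteq> F" "iprod M B = iprod N B"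
  shows "M = N"
  using iprod_B_Int_F assms by metis

lemma iprod_B_ideal: "is_ideal A M \<Longrightarrow> is_ideal B (iprod M B)"
  unfolding is_ideal_iff using iprod_module_right[OF subring_module[OF B_subring], of M] iprod_mono[of M B B B]
  by (metis A_B B_subring iprod_ring_left order_refl subring_module subset_iff)

lemma iprod_B_nonzero: "is_ideal A M \<Longrightarrow> M \<noteq> {0} \<Longrightarrow> iprod M B \<noteq> {0}"
proof -
  assume M: "is_ideal A M" "M \<noteq> {0}"
  then obtain x where x: "x \<in> M" "x \<noteq> 0" using module_nonzero by (metis is_ideal_iff)
  then have "x \<in> iprod M B" using iprodI[of x M 1 B] A_B[OF A_1] by simp
  with x show ?thesis by blast
qed

lemma iprod_B_B: "iprod (iprod M B) (iprod N B) = iprod (iprod M N) B"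
proof -
  have "iprod (iprod M B) (iprod N B) = iprod (iprod M N) (iprod B B)" by (simp add: iprod_ac)
  then show ?thesis by (simp add: iprod_ring_left B_subring subring_module)
qed

lemma iprod_smul_A_B: "iprod (smul c A) B = smul c B"
proof -
  have "iprod A B = B"
    using iprod_B[OF subring_module[OF subring]] by (simp add: B_def)
  then show ?thesis by (simp add: iprod_smul_left)
qed

end

text \<open>Integral closedness of \<open>B\<close> is demanded for monic quadratic equations only,
  the form in which \<open>norm_ideal\<close> meets it.\<close>

locale quad = quad0 +
  assumes int_closed: "z \<in> E \<Longrightarrow> x \<in> B \<Longrightarrow> y \<in> B \<Longrightarrow> z * z = x * z + y \<Longrightarrow> z \<in> B"
begin

text \<open>If \<open>J J' = (m)\<close>, then for \<open>u = z * cj w\<close> with \<open>z, w \<in> I\<close> and \<open>e \<in> J'\<close> the element \<open>e u / m\<close>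
  satisfies a monic quadratic equation over \<open>A\<close>, because the trace of \<open>u\<close> lies in \<open>J\<close> and its norm
  in \<open>J\<^sup>2\<close>. Hence \<open>J' u \<subseteq> m B\<close>, that is \<open>u \<in> J B\<close>.\<close>

lemma norm_ideal:
  assumes I: "is_ideal B I" "I \<noteq> {0}"
  shows "\<exists>J. is_ideal A J \<and> J \<noteq> {0} \<and> iprod I (cj ` I) = iprod J B"
proof -
  have IB: "\<And>x. x \<in> I \<Longrightarrow> x \<in> B" and IE: "\<And>x. x \<in> I \<Longrightarrow> x \<in> E"
    and I_add: "\<And>x y. x \<in> I \<Longrightarrow> y \<in> I \<Longrightarrow> x + y \<in> I"
    using I B_in_E by (auto simp: is_ideal_def)
  define N where "N = (\<lambda>z. z * cj z) ` I"
  define J where "J = iprod A N"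
  have modJ: "is_module A J" unfolding J_def by (rule iprod_module[OF subring_module[OF subring]])
  have NJ: "z * cj z \<in> J" if "z \<in> I" for z
    using iprodI[OF A_1, of "z * cj z" N] that by (auto simp: J_def N_def)
  have JA: "J \<subseteq> A" unfolding J_def
    by (rule iprod_least) (auto simp: N_def A_0 intro!: A_add A_mult norm_A IB)
  have idJ: "is_ideal A J" using modJ JA by (simp add: is_ideal_iff)
  obtain z0 where z0: "z0 \<in> I" "z0 \<noteq> 0"
    using module_nonzero I by (metis is_ideal_iff)
  have "z0 * cj z0 \<noteq> 0" using z0 cj_nz IE by simp
  then have J0: "J \<noteq> {0}" using NJ[OF z0(1)] by blast
  obtain J' m where J': "is_ideal A J'" "m \<in> A" "m \<noteq> 0" "iprod J J' = smul m A"
    using inv[OF idJ J0] by blast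
  have mF: "m \<in> F" using J' A_F by blast
  have "iprod I (cj ` I) = iprod J B"
  proof
    show "iprod J B \<subseteq> iprod I (cj ` I)"
    proof -
      have modI: "is_module B (iprod I (cj ` I))" using I by (intro iprod_module) (simp add: is_ideal_iff)
      have "J \<subseteq> iprod I (cj ` I)"
        unfolding J_def
      proof (rule iprod_least)
        show "a * n \<in> iprod I (cj ` I)" if "a \<in> A" "n \<in> N" for a n
        proof -
          obtain z where "z \<in> I" "n = z * cj z" using \<open>n \<in> N\<close> by (auto simp: N_def)
          then have "n \<in> iprod I (cj ` I)" by (simp add: iprodI)
          then show ?thesis using modI A_B[OF \<open>a \<in> A\<close>] unfolding is_module_def by blast
        qed
      qed (auto intro: iprod.zero iprod_add)
      then have "iprod J B \<subseteq> iprod (iprod I (cj ` I)) B" by (rule iprod_mono) simp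
      then show ?thesis using modI by (simp add: iprod_ring_right B_subring)
    qed
  next
    show "iprod I (cj ` I) \<subseteq> iprod J B"
    proof (rule iprod_least)
      fix z w' assume z: "z \<in> I" and "w' \<in> cj ` I"
      then obtain w where w: "w \<in> I" "w' = cj w" by auto
      define u where "u = z * cj w"
      have uE: "u \<in> E" using z w IE cj_E E_mult by (simp add: u_def)
      have cju: "cj u = cj z * w" unfolding u_def cj_mult[OF IE[OF z] cj_E[OF IE[OF w(1)]]] using w IE by (simp add: cj_cj)
      have t: "u + cj u \<in> J"
      proof -
        \<comment> \<open>Polarisation: \<open>J\<close> is generated by norms only, and the trace
          of \<open>z * cj w\<close> is a combination of three of them.\<close>
        have "u + cj u = (z + w) * cj (z + w) - z * cj z - w * cj w"
          unfolding cju using z w IE by (simp add: u_def cj_add algebra_simps)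
        also have "\<dots> \<in> J" using z w by (intro module_diff[OF subring modJ] NJ I_add)
        finally show ?thesis .
      qed
      have n: "u * cj u = (z * cj z) * (w * cj w)" unfolding cju by (simp add: u_def)
      have divA: "e * j / m \<in> A" if "e \<in> J'" "j \<in> J" for e j
        using iprodI[OF that(2,1)] J' by (simp add: smul_iff mult.commute)
      have eu: "e * u \<in> smul m B" if e: "e \<in> J'" for e
      proof -
        define v where "v = e * u / m"
        have eF: "e \<in> F" using e J' A_F by (auto simp: is_ideal_def)
        have vE: "v \<in> E" unfolding v_def by (rule E_divide[OF E_mult[OF F_E[OF eF] uE] F_E[OF mF]])
        have "v * v = (e * (u + cj u) / m) * v + - ((e * (z * cj z) / m) * (e * (w * cj w) / m))"
        proof -
          have "u * u = (u + cj u) * u - (z * cj z) * (w * cj w)"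
            unfolding n[symmetric] by (simp add: algebra_simps)
          then have "(e/m)*(e/m)*(u * u) = (e/m)*(e/m)*((u + cj u) * u - (z * cj z) * (w * cj w))" by simp
          then show ?thesis by (simp add: v_def divide_simps J' algebra_simps)
        qed
        moreover have "e * (u + cj u) / m \<in> B" using divA[OF e t] A_B by blast
        moreover have "- ((e * (z * cj z) / m) * (e * (w * cj w) / m)) \<in> B"
          using divA[OF e NJ[OF z]] divA[OF e NJ[OF w(1)]] by (intro A_B A_minus A_mult)
        ultimately have "v \<in> B" using int_closed[OF vE] by blast
        then show ?thesis using J' by (simp add: smul_iff v_def)
      qed
      \<comment> \<open>Summed over products from \<open>J\<close> and \<open>J'\<close> and applied
        to \<open>y = m\<close>, which lies in \<open>iprod J J'\<close>, this yields
        \<open>u\<close> in \<open>J B\<close>.\<close>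
      have "y * u \<in> smul m (iprod J B)" if "y \<in> iprod J J'" for y
        using that
      proof induction
        case zero
        show ?case using smul_memI[OF iprod.zero, of m] by simp
      next
        case (step j e y)
        obtain b where b: "b \<in> B" "e * u = m * b" using eu[OF step(2)] by (auto simp: smul_def)
        obtain c where c: "c \<in> iprod J B" "y * u = m * c" using step by (auto simp: smul_def)
        have "(j * e + y) * u = m * (j * b + c)"
          using b c by (simp add: algebra_simps)
        then show ?case using step b c by (auto intro!: smul_memI iprod.step)
      qed
      then have "m * u \<in> smul m (iprod J B)" unfolding J' using smul_ring_iff[OF subring] by blast
      then show "z * w' \<in> iprod J B" using J' w by (simp add: smul_iff u_def)
    qed (auto intro: iprod.zero iprod_add)
  qed
  then show ?thesis using idJ J0 by blast
qed

text \<open>An inverse of \<open>I\<close> up to principal ideals is its conjugate times the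
  extension of such an inverse of the norm ideal \<open>J\<close>: the product is
  \<open>J J' B = (m)\<close>.\<close>

lemma ded_B: "ded B E"
proof
  show "is_subfield E" by (rule E_subfield)
  show "is_subring B" by (rule B_subring)
  show "B \<subseteq> E" by (rule B_E_subset)
  show "\<exists>a\<in>B. a \<noteq> 0 \<and> a * x \<in> B" if "x \<in> E" for x using E_frac[OF that] A_B by blast
  show "x \<in> B" if "x \<in> E" "x * x \<in> B" for x
    using int_closed[of x 0 "x * x"] that A_B A_0 by simp
  fix I assume I: "is_ideal B I" "I \<noteq> {0}"
  obtain J where J: "is_ideal A J" "J \<noteq> {0}" "iprod I (cj ` I) = iprod J B"
    using norm_ideal[OF I] by blast
  obtain J' m where J': "is_ideal A J'" "J' \<noteq> {0}" "m \<in> A" "m \<noteq> 0" "iprod J J' = smul m A"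
    using inv[OF J(1,2)] by blast
  have "iprod I (iprod (cj ` I) (iprod J' B)) = smul m B"
    by (simp add: iprod_assoc[symmetric, of I] J iprod_B_B J' iprod_smul_A_B)
  moreover have "is_ideal B (iprod (cj ` I) (iprod J' B))"
    using I J' by (intro iprod_ideal[OF B_subring] cj_ideal iprod_B_ideal)
  moreover have "iprod (cj ` I) (iprod J' B) \<noteq> {0}"
    using cj_ideal[OF I(1)] iprod_B_ideal[OF J'(1)] unfolding is_ideal_iff
    by (intro iprod_nonzero[OF _ _ cj_nonzero[OF I] iprod_B_nonzero[OF J'(1,2)]]; blast)
  ultimately show "\<exists>I' m. is_ideal B I' \<and> I' \<noteq> {0} \<and> m \<in> B \<and> m \<noteq> 0 \<and> iprod I I' = smul m B"
    using J' A_B by blast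
qed

end

sublocale quad \<subseteq> BE: ded B E
  by (rule ded_B)

section \<open>Ideal classes invariant under conjugation\<close>

text \<open>The ramification data. Ideals invariant under conjugation that do not come from
  \<open>A\<close> can only arise from \<open>d\<close> and 2, so the ideals of \<open>A\<close>
  containing these are listed. \<open>Fs\<close> is \<open>{1, 2}\<close> over \<open>\<int>\<close>
  and \<open>{1, \<pi>, 2}\<close> over the integers of \<open>k\<close>.\<close>

locale quad_genus = quad A F d r for A F d r +
  fixes Fs :: "real set"
  assumes div_d: "is_ideal A M \<Longrightarrow> d \<in> M \<Longrightarrow> M = smul d A \<or> M = A"
    and div_2: "is_ideal A M \<Longrightarrow> 2 \<in> M \<Longrightarrow> \<exists>f\<in>Fs. M = smul f A"
    and no_2_torsion: "is_ideal A M \<Longrightarrow> M \<noteq> {0} \<Longrightarrow> x \<in> F \<Longrightarrow> iprod M M = smul x A \<Longrightarrow> \<exists>c\<in>A. M = smul c A"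
begin

text \<open>The hypotheses squeeze \<open>(c)\<close> between \<open>2 M^2\<close> and
  \<open>M^2\<close>. The quotient ideal \<open>(c) M^(-2)\<close> therefore contains 2 and is
  \<open>(f)\<close>; then \<open>M^2\<close> is principal, so \<open>M\<close> is
  \<open>(x)\<close> by \<open>no_2_torsion\<close>, and \<open>c\<close> agrees with
  \<open>x * x * f\<close> up to a unit.\<close>

lemma half_genus:
  assumes M: "is_ideal A M" "M \<noteq> {0}" and c: "c \<in> F" "c \<noteq> 0"
    and cM: "c \<in> iprod M M" and M2: "\<And>x y. x \<in> M \<Longrightarrow> y \<in> M \<Longrightarrow> 2 * (x * y) \<in> smul c A"
  shows "\<exists>x\<in>A. \<exists>f\<in>Fs. \<exists>v\<in>A. \<exists>v'\<in>A. v * v' = 1 \<and> x \<noteq> 0 \<and> c = v * (x * x) * f"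
proof -
  define M2 where "M2 = iprod M M"
  have M2id: "is_ideal A M2" unfolding M2_def by (rule iprod_ideal[OF subring M(1) M(1)])
  have M2nz: "M2 \<noteq> {0}" unfolding M2_def
    using M by (intro iprod_nonzero) (auto simp: is_ideal_iff)
  have modcA: "is_module A (smul c A)" by (rule smul_module[OF subring_module[OF subring]])
  \<comment> \<open>\<open>Q\<close> is \<open>(c) M^(-2)\<close>, written as a colon to stay clear
    of fractional ideals.\<close>
  define Q where "Q = {e \<in> F. \<forall>y\<in>M2. e * y \<in> smul c A}"
  have QA: "Q \<subseteq> A"
  proof
    fix e assume "e \<in> Q"
    then have "e * c \<in> smul c A" using cM by (auto simp: Q_def M2_def)
    then show "e \<in> A" using c by (simp add: smul_iff)
  qed
  have Qmod: "is_module A Q"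
    unfolding is_module_def
  proof (intro conjI ballI)
    show "0 \<in> Q" using modcA by (auto simp: Q_def F_0 is_module_def)
    show "x + y \<in> Q" if "x \<in> Q" "y \<in> Q" for x y
      using that modcA by (auto simp: Q_def F_add is_module_def distrib_right)
    show "a * x \<in> Q" if "a \<in> A" "x \<in> Q" for a x
      using that modcA A_F by (auto simp: Q_def is_module_def mult.assoc intro!: F_mult)
  qed
  have Qid: "is_ideal A Q" using QA Qmod by (simp add: is_ideal_iff)
  have "2 \<in> Q"
  proof -
    have "1 + 1 \<in> F" by (intro F_add F_1)
    moreover have "2 * y \<in> smul c A" if "y \<in> M2" for y
      using that unfolding M2_def
    proof induction
      case zero
      then show ?case using modcA by (simp add: is_module_def)
    next
      case (step x y z)
      then show ?case using modcA M2 by (simp add: is_module_def distrib_left)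
    qed
    ultimately show ?thesis by (simp add: Q_def)
  qed
  then obtain f where f: "f \<in> Fs" "Q = smul f A" using div_2[OF Qid] by blast
  obtain N m where N: "is_ideal A N" "m \<in> A" "m \<noteq> 0" "iprod M2 N = smul m A"
    using inv[OF M2id M2nz] by blast
  have mF: "m \<in> F" using N A_F by blast
  \<comment> \<open>\<open>N\<close> is \<open>m M^(-2)\<close>. Multiplying this inclusion by
    \<open>M2\<close> and cancelling \<open>m\<close> shows that \<open>(c)\<close> is contained in
    \<open>M2 Q\<close>; the converse inclusion is the definition of \<open>Q\<close>.\<close>
  have "smul c N \<subseteq> smul m Q"
  proof
    fix z assume "z \<in> smul c N"
    then obtain n where n: "n \<in> N" "z = c * n" by (auto simp: smul_def)
    have nF: "n \<in> F" using n N A_F by (auto simp: is_ideal_def)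
    have "c * n / m \<in> Q"
      unfolding Q_def
    proof (intro CollectI conjI ballI)
      show "c * n / m \<in> F" using c nF mF by (intro F_divide F_mult)
      fix y assume "y \<in> M2"
      then have "y * n \<in> smul m A" using iprodI[OF _ n(1)] N by blast
      then have "(y * n) / m \<in> A" using N by (simp add: smul_iff)
      then have "c * ((y * n) / m) \<in> smul c A" by (rule smul_memI)
      then show "c * n / m * y \<in> smul c A" by (simp add: mult_ac)
    qed
    then show "z \<in> smul m Q" using n N by (simp add: smul_iff)
  qed
  then have "iprod M2 (smul c N) \<subseteq> iprod M2 (smul m Q)" by (rule iprod_mono[OF order_refl])
  then have "smul m (smul c A) \<subseteq> smul m (iprod M2 Q)"
    by (simp add: iprod_smul_right N smul_smul mult.commute)
  then have 1: "smul c A \<subseteq> iprod M2 Q" using N by (simp add: smul_subset_cancel)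
  have 2: "iprod M2 Q \<subseteq> smul c A"
    by (rule iprod_least) (use modcA in \<open>auto simp: Q_def is_module_def mult.commute\<close>)
  have "iprod M2 Q = smul f M2"
    using f M2id by (simp add: iprod_smul_right iprod_ring_right subring is_ideal_iff)
  with 1 2 have eq: "smul f M2 = smul c A" by blast
  have f0: "f \<noteq> 0"
  proof
    assume "f = 0"
    then have "smul c A \<subseteq> {0}" using eq by (auto simp: smul_def)
    then show False using smul_ring_iff[OF subring, of c] c by blast
  qed
  have fF: "f \<in> F" using f QA A_F smul_ring_iff[OF subring, of f] by blast
  have "M2 = smul (c / f) A"
  proof -
    have "smul (1/f) (smul f M2) = smul (1/f) (smul c A)" using eq by simp
    then show ?thesis using f0 by (simp add: smul_smul)
  qed
  then obtain x where x: "x \<in> A" "M = smul x A"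
    using no_2_torsion[OF M F_divide[OF c(1) fF]] by (auto simp: M2_def)
  have x0: "x \<noteq> 0" using x M A_0 by (auto simp: smul_def)
  have "smul c A = smul (x * x * f) A"
    using eq x by (simp add: M2_def iprod_principal subring smul_smul mult_ac)
  then obtain v v' where "v \<in> A" "v' \<in> A" "v * v' = 1" "c = v * (x * x * f)"
    using smul_eq_unit[OF subring] x0 f0 by (metis mult_eq_0_iff)
  then show ?thesis using x x0 f by (metis mult.assoc)
qed

text \<open>Let \<open>X\<close> and \<open>Y\<close> be the ideals of all \<open>x\<close>, respectively all \<open>y\<close>, with \<open>x + y r \<in> L\<close>. Then
  \<open>d Y \<subseteq> X \<subseteq> Y\<close>, so \<open>X = Y\<close> or \<open>X = d Y\<close>, and up to this factor \<open>t\<close> lies between \<open>2 Y\<^sup>2\<close> and \<open>Y\<^sup>2\<close>.\<close>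

lemma genus:
  assumes L: "is_ideal B L" "L \<noteq> {0}" and t: "t \<in> F" "t \<noteq> 0"
    and LL: "iprod L L = smul t B" and LcL: "iprod L (cj ` L) = smul t B"
  shows "\<exists>x\<in>A. \<exists>g\<in>{1, d}. \<exists>f\<in>Fs. \<exists>v\<in>A. \<exists>v'\<in>A. v * v' = 1 \<and> x \<noteq> 0 \<and> t = v * (x * x) * g * f"
proof -
  have LB: "\<And>z. z \<in> L \<Longrightarrow> z \<in> B" and Ladd: "\<And>z w. z \<in> L \<Longrightarrow> w \<in> L \<Longrightarrow> z + w \<in> L"
    and Lmul: "\<And>b z. b \<in> B \<Longrightarrow> z \<in> L \<Longrightarrow> b * z \<in> L" and L0: "0 \<in> L"
    using L by (auto simp: is_ideal_def)
  define X where "X = {x \<in> A. \<exists>y\<in>A. x + y * r \<in> L}"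
  define Y where "Y = {y \<in> A. \<exists>x\<in>A. x + y * r \<in> L}"
  have Xid: "is_ideal A X" unfolding is_ideal_def
  proof (intro conjI ballI)
    show "0 \<in> X" using L0 A_0 by (force simp: X_def)
  next
    fix x y assume "x \<in> X" "y \<in> X"
    then obtain u v where *: "x \<in> A" "y \<in> A" "u \<in> A" "v \<in> A" "x + u * r \<in> L" "y + v * r \<in> L" by (auto simp: X_def)
    then have "(x + y) + (u + v) * r \<in> L" using Ladd[OF *(5,6)] by (simp add: algebra_simps)
    then show "x + y \<in> X" using * A_add by (auto simp: X_def)
  next
    fix a x assume "a \<in> A" "x \<in> X"
    then obtain u where *: "a \<in> A" "x \<in> A" "u \<in> A" "x + u * r \<in> L" by (auto simp: X_def)
    then have "a * x + (a * u) * r \<in> L" using Lmul[OF A_B *(4)] by (simp add: algebra_simps)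
    then show "a * x \<in> X" using * A_mult by (auto simp: X_def)
  qed (auto simp: X_def)
  have Yid: "is_ideal A Y" unfolding is_ideal_def
  proof (intro conjI ballI)
    show "0 \<in> Y" using L0 A_0 by (force simp: Y_def)
  next
    fix x y assume "x \<in> Y" "y \<in> Y"
    then obtain u v where *: "x \<in> A" "y \<in> A" "u \<in> A" "v \<in> A" "u + x * r \<in> L" "v + y * r \<in> L" by (auto simp: Y_def)
    then have "(u + v) + (x + y) * r \<in> L" using Ladd[OF *(5,6)] by (simp add: algebra_simps)
    then show "x + y \<in> Y" using * A_add by (auto simp: Y_def)
  next
    fix a x assume "a \<in> A" "x \<in> Y"
    then obtain u where *: "a \<in> A" "x \<in> A" "u \<in> A" "u + x * r \<in> L" by (auto simp: Y_def)
    then have "a * u + (a * x) * r \<in> L" using Lmul[OF A_B *(4)] by (simp add: algebra_simps)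
    then show "a * x \<in> Y" using * A_mult by (auto simp: Y_def)
  qed (auto simp: Y_def)
  \<comment> \<open>Multiplication by \<open>r\<close> sends the coordinates \<open>(x, y)\<close>
    to \<open>(d y, x)\<close>; this relates \<open>X\<close> and \<open>Y\<close>.\<close>
  have swap: "d * y + x * r \<in> L" if "x \<in> A" "y \<in> A" "x + y * r \<in> L" for x y
    using Lmul[OF r_B that(3)] by (simp add: r_sq[symmetric] algebra_simps)
  have XY: "X \<subseteq> Y" using swap d_A A_mult unfolding X_def Y_def by blast
  have dYX: "d * y \<in> X" if "y \<in> Y" for y using that swap d_A A_mult unfolding X_def Y_def by blast
  have tA: "t \<in> A"
  proof -
    have "t \<in> iprod L L" using LL smul_ring_iff[OF B_subring] by simp
    then have "t \<in> B" using iprod_ideal[OF B_subring L(1) L(1)] by (auto simp: is_ideal_def)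
    then show ?thesis using t B_Int_F by blast
  qed
  have coords: "a \<in> smul t A \<and> b \<in> smul t A" if "a \<in> A" "b \<in> A" "a + b * r \<in> smul t B" for a b
  proof -
    have "(a + b * r) / t \<in> B" using that t by (simp add: smul_iff)
    then obtain a' b' where ab: "a' \<in> A" "b' \<in> A" "(a + b * r) / t = a' + b' * r" by (rule B_E)
    then have "a + b * r = a' * t + (b' * t) * r" using t by (simp add: field_simps)
    then have "a = a' * t" "b = b' * t"
      using rep_unique[of a b "a' * t" "b' * t"] that ab A_F tA A_mult by blast+
    then show ?thesis using ab t by (simp add: smul_iff)
  qed
  have tmod: "is_module B (smul t B)" by (rule smul_module[OF subring_module[OF B_subring]])
  have tadd: "z + w \<in> smul t B" and tsub: "z - w \<in> smul t B" if "z \<in> smul t B" "w \<in> smul t B" for z w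
    using that tmod module_diff[OF B_subring tmod] by (auto simp: is_module_def)
  \<comment> \<open>Both \<open>L^2\<close> and \<open>L (cj L)\<close> are \<open>(t)\<close>, so a
    product of two elements and the same product with one factor conjugated are multiples of
    \<open>t\<close>. Their sum and difference isolate \<open>x * x'\<close> and
    \<open>d * (y * y')\<close> at the cost of a factor 2.\<close>
  have prods: "2 * (x * x') \<in> smul t A" "2 * (d * (y * y')) \<in> smul t A"
    if "x \<in> A" "y \<in> A" "x + y * r \<in> L" "x' \<in> A" "y' \<in> A" "x' + y' * r \<in> L" for x y x' y'
  proof -
    have 1: "(x + y * r) * (x' + y' * r) \<in> smul t B" using iprodI[OF that(3,6)] LL by simp
    have "x' - y' * r \<in> cj ` L" using that cj_rep[of x' y'] A_F by (force simp: image_iff)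
    then have 2: "(x + y * r) * (x' - y' * r) \<in> smul t B" using iprodI[OF that(3)] LcL by blast
    have "(x * x' + x * x') + (x' * y + x' * y) * r \<in> smul t B"
      using tadd[OF 1 2] by (simp add: algebra_simps)
    moreover have "x * x' + x * x' \<in> A" "x' * y + x' * y \<in> A"
      using that by - ((intro A_add A_mult; assumption)+)
    ultimately have "x * x' + x * x' \<in> smul t A" using coords by blast
    then show "2 * (x * x') \<in> smul t A" by (simp only: mult_2)
    have "(d * (y * y') + d * (y * y')) + (x * y' + x * y') * r \<in> smul t B"
      using tsub[OF 1 2] by (simp add: algebra_simps r_sq[symmetric])
    moreover have "d * (y * y') + d * (y * y') \<in> A" "x * y' + x * y' \<in> A"
      using that d_A by - ((intro A_add A_mult; assumption)+)
    ultimately have "d * (y * y') + d * (y * y') \<in> smul t A" using coords by blast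
    then show "2 * (d * (y * y')) \<in> smul t A" by (simp only: mult_2)
  qed
  \<comment> \<open>The first coordinate of an element of \<open>L^2\<close> lies in
    \<open>X^2 + d Y^2\<close>; since \<open>t\<close> has no second coordinate, it is itself such a
    sum \<open>a + d b\<close>.\<close>
  have tin: "\<exists>a\<in>iprod X X. \<exists>b\<in>iprod Y Y. \<exists>e\<in>A. w = (a + d * b) + e * r" if "w \<in> iprod L L" for w
    using that
  proof induction
    case zero
    show ?case using iprod.zero A_0 by force
  next
    case (step z z' w)
    obtain x y where z: "x \<in> A" "y \<in> A" "z = x + y * r" using LB[OF step(1)] by (rule B_E)
    obtain x' y' where z': "x' \<in> A" "y' \<in> A" "z' = x' + y' * r" using LB[OF step(2)] by (rule B_E)
    have X: "x \<in> X" "x' \<in> X" "y \<in> Y" "y' \<in> Y" using step z z' by (auto simp: X_def Y_def)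
    obtain a b e where w: "a \<in> iprod X X" "b \<in> iprod Y Y" "e \<in> A" "w = (a + d * b) + e * r" using step by blast
    have "z * z' + w = ((x * x' + a) + d * (y * y' + b)) + ((x * y' + y * x') + e) * r"
      using z z' w by (simp add: algebra_simps r_sq[symmetric])
    moreover have "x * x' + a \<in> iprod X X" "y * y' + b \<in> iprod Y Y" using X w by (auto intro: iprod.step)
    moreover have "x * y' + y * x' + e \<in> A" using z z' w by (auto intro!: A_add A_mult)
    ultimately show ?case by blast
  qed
  have "t \<in> iprod L L" using LL smul_ring_iff[OF B_subring] by simp
  then obtain a b e where ab: "a \<in> iprod X X" "b \<in> iprod Y Y" "e \<in> A" "t = (a + d * b) + e * r"
    using tin by blast
  have XXA: "iprod X X \<subseteq> A" "iprod Y Y \<subseteq> A"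
    using iprod_ideal[OF subring Xid Xid] iprod_ideal[OF subring Yid Yid] by (auto simp: is_ideal_def)
  have tab: "t = a + d * b"
  proof -
    have "a + d * b \<in> A" using ab XXA d_A by (auto intro!: A_add A_mult)
    then show ?thesis using rep_unique(1)[of t 0 "a + d * b" e] ab t F_0 A_F by auto
  qed
  have Y0: "Y \<noteq> {0}"
  proof
    assume Y: "Y = {0}"
    then have "X = {0}" using XY Xid by (auto simp: is_ideal_def)
    moreover have "iprod {0} {0} \<subseteq> {0}" by (rule iprod_least) auto
    ultimately have "iprod X X \<subseteq> {0}" "iprod Y Y \<subseteq> {0}" using Y by simp_all
    then have "a = 0" "b = 0" using ab by blast+
    then show False using tab t by simp
  qed
  have YYmod: "is_module A (iprod Y Y)" using Yid by (intro iprod_module) (simp add: is_ideal_iff)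
  \<comment> \<open>The quotient \<open>X Y^(-1)\<close>, again as a colon; \<open>div_d\<close>
    applies to it.\<close>
  define Q where "Q = {e \<in> F. \<forall>y\<in>Y. e * y \<in> X}"
  obtain Y' m where Y': "is_ideal A Y'" "m \<in> A" "m \<noteq> 0" "iprod Y Y' = smul m A"
    using inv[OF Yid Y0] by blast
  have mF: "m \<in> F" using Y' A_F by blast
  have Qid: "is_ideal A Q" unfolding is_ideal_iff
  proof
    show "Q \<subseteq> A"
    proof
      fix e assume e: "e \<in> Q"
      have "e * z \<in> smul m A" if "z \<in> iprod Y Y'" for z
        using that
      proof induction
        case zero
        then show ?case using A_0 Y' by (simp add: smul_iff)
      next
        case (step y y' z)
        have "e * y \<in> Y" using e step XY by (auto simp: Q_def)
        then have "(e * y) * y' \<in> smul m A" using iprodI step Y' by blast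
        then have "e * y * y' / m + e * z / m \<in> A" using step Y' by (auto simp: smul_iff intro: A_add)
        then show ?case using Y' by (simp add: smul_iff add_divide_distrib distrib_left mult.assoc)
      qed
      then have "e * m \<in> smul m A" using Y' smul_ring_iff[OF subring] by simp
      then show "e \<in> A" using Y' by (simp add: smul_iff)
    qed
    show "is_module A Q" unfolding is_module_def
    proof (intro conjI ballI)
      show "0 \<in> Q" using Xid by (auto simp: Q_def F_0 is_ideal_def)
      show "x + y \<in> Q" if "x \<in> Q" "y \<in> Q" for x y
        using that Xid by (auto simp: Q_def F_add is_ideal_def distrib_right)
      show "a * x \<in> Q" if "a \<in> A" "x \<in> Q" for a x
        using that Xid A_F by (auto simp: Q_def is_ideal_def mult.assoc intro!: F_mult)
    qed
  qed
  have "d \<in> Q" using dYX d_F by (simp add: Q_def)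
  then consider "Q = A" | "Q = smul d A" using div_d[OF Qid] by blast
  then show ?thesis
  proof cases
    case 1
    then have "1 \<in> Q" using A_1 by simp
    then have "X = Y" using XY by (auto simp: Q_def)
    have "\<exists>x\<in>A. \<exists>f\<in>Fs. \<exists>v\<in>A. \<exists>v'\<in>A. v * v' = 1 \<and> x \<noteq> 0 \<and> t = v * (x * x) * f"
    proof (rule half_genus[OF Xid _ t])
      show "X \<noteq> {0}" using Y0 \<open>X = Y\<close> by simp
      show "t \<in> iprod X X" using tab ab YYmod d_A unfolding \<open>X = Y\<close> is_module_def by blast
      show "2 * (x * y) \<in> smul t A" if "x \<in> X" "y \<in> X" for x y
        using that prods(1) unfolding X_def by blast
    qed
    then show ?thesis by fastforce
  next
    case 2
    have XdY: "X \<subseteq> smul d Y"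
    proof -
      have "iprod X Y' \<subseteq> smul m (smul d A)"
      proof
        fix z assume z: "z \<in> iprod X Y'"
        have "z / m \<in> Q" unfolding Q_def
        proof (intro CollectI conjI ballI)
          have "z \<in> F" using iprod_ideal[OF subring Xid Y'(1)] z A_F by (auto simp: is_ideal_def)
          then show "z / m \<in> F" using mF by (rule F_divide)
          fix y assume y: "y \<in> Y"
          have "y * z \<in> iprod Y (iprod X Y')" using y z by (rule iprodI)
          also have "\<dots> = iprod X (smul m A)" using Y' by (metis iprod_left_commute)
          also have "\<dots> = smul m X" using Xid by (simp add: iprod_smul_right iprod_ring_right subring is_ideal_iff)
          finally show "z / m * y \<in> X" using Y' by (simp add: smul_iff mult_ac)
        qed
        then show "z \<in> smul m (smul d A)" using 2 Y' by (simp add: smul_iff)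
      qed
      then have "iprod Y (iprod X Y') \<subseteq> iprod Y (smul m (smul d A))" by (rule iprod_mono[OF order_refl])
      moreover have "iprod Y (iprod X Y') = smul m X"
        using Y' Xid by (metis iprod_left_commute iprod_smul_right iprod_ring_right subring is_ideal_iff)
      moreover have "iprod Y (smul m (smul d A)) = smul m (smul d Y)"
        using Yid by (simp add: iprod_smul_right iprod_ring_right subring is_ideal_iff)
      ultimately show ?thesis using Y' by (simp add: smul_subset_cancel)
    qed
    \<comment> \<open>As \<open>X\<close> lies in \<open>d Y\<close>, the part \<open>a\<close> from
      \<open>X^2\<close> carries the factor \<open>d\<close> twice, so \<open>t / d\<close> falls
      into \<open>Y^2\<close>, ready for \<open>half_genus\<close>.\<close>
    have "iprod X X \<subseteq> smul d (smul d (iprod Y Y))"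
      using iprod_mono[OF XdY XdY] by (simp add: iprod_smul_left iprod_smul_right)
    then have "a / d / d \<in> iprod Y Y" using ab d_nz by (auto simp: smul_iff)
    then have "d * (a / d / d) \<in> iprod Y Y" using YYmod d_A unfolding is_module_def by blast
    then have "d * (a / d / d) + b \<in> iprod Y Y" using ab(2) by (rule iprod_add)
    then have tdY: "t / d \<in> iprod Y Y" using tab d_nz by (simp add: field_simps)
    have "\<exists>x\<in>A. \<exists>f\<in>Fs. \<exists>v\<in>A. \<exists>v'\<in>A. v * v' = 1 \<and> x \<noteq> 0 \<and> t / d = v * (x * x) * f"
    proof (rule half_genus[OF Yid Y0 F_divide[OF t(1) d_F] _ tdY])
      show "t / d \<noteq> 0" using t d_nz by simp
      show "2 * (x * y) \<in> smul (t / d) A" if "x \<in> Y" "y \<in> Y" for x y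
      proof -
        have "2 * (d * (x * y)) \<in> smul t A" using that prods(2) unfolding Y_def by blast
        then show ?thesis using t d_nz by (simp add: smul_iff mult_ac)
      qed
    qed
    then obtain x f v v' where "x \<in> A" "f \<in> Fs" "v \<in> A" "v' \<in> A" "v * v' = 1" "x \<noteq> 0" "t / d = v * (x * x) * f"
      by blast
    moreover from this have "t = v * (x * x) * d * f" using d_nz by (simp add: field_simps)
    ultimately show ?thesis by blast
  qed
qed

text \<open>Hilbert 90 supplies \<open>\<gamma> = cj \<delta> + c\<close>, for which \<open>\<gamma> I\<close> becomes invariant under \<open>cj\<close>.\<close>

lemma ambiguous_class:
  assumes I: "is_ideal B I" "I \<noteq> {0}" and \<delta>: "\<delta> \<in> E" "\<delta> + c \<noteq> 0" and c: "c \<in> F"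
    and II: "iprod I I = smul \<delta> B" and IcI: "iprod I (cj ` I) = smul c B" and N: "\<delta> * cj \<delta> = c * c"
  defines "\<gamma> \<equiv> cj \<delta> + c"
  obtains x g f v v' where "\<gamma> \<in> B" "\<gamma> \<noteq> 0" "x \<in> A" "g \<in> {1, d}" "f \<in> Fs" "v \<in> A" "v' \<in> A"
    "v * v' = 1" "x \<noteq> 0" "iprod (smul \<gamma> I) (smul \<gamma> I) = smul (x * x * g * f) B"
    "\<gamma> * \<gamma> * c * c = cj \<delta> * (v * (x * x) * g * f)"
proof -
  \<comment> \<open>This is why \<open>\<delta> + c\<close> must not vanish; where necessary,
    callers change the sign of \<open>c\<close>.\<close>
  have cj0: "cj \<gamma> = \<delta> + c" unfolding \<gamma>_def using \<delta> c by (simp add: cj_add cj_E F_E cj_cj cj_F)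
  have g0: "\<gamma> \<noteq> 0" using cj0 \<delta> by auto
  have IIid: "is_ideal B (iprod I I)" by (rule iprod_ideal[OF B_subring I(1) I(1)])
  have IcIid: "is_ideal B (iprod I (cj ` I))" by (rule iprod_ideal[OF B_subring I(1) cj_ideal[OF I(1)]])
  have \<delta>B: "\<delta> \<in> B" using smul_ring_iff[OF B_subring, of \<delta>] IIid II by (auto simp: is_ideal_def)
  have cB: "c \<in> B" using smul_ring_iff[OF B_subring, of c] IcIid IcI by (auto simp: is_ideal_def)
  have c0: "c \<noteq> 0"
  proof
    assume "c = 0"
    then have "iprod I (cj ` I) \<subseteq> {0}" unfolding IcI by (auto simp: smul_def)
    moreover have "iprod I (cj ` I) \<noteq> {0}"
      using I cj_ideal[OF I(1)] by (intro iprod_nonzero cj_nonzero) (auto simp: is_ideal_iff)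
    moreover have "0 \<in> iprod I (cj ` I)" by (rule iprod.zero)
    ultimately show False by blast
  qed
  have gB: "\<gamma> \<in> B" using \<delta>B cB cj_B B_subring by (auto simp: \<gamma>_def is_subring_def)
  have gE: "\<gamma> \<in> E" using gB B_in_E by blast
  define t where "t = \<delta> + cj \<delta> + (c + c)"
  have tF: "t \<in> F" unfolding t_def by (rule F_add[OF trace_F[OF \<delta>(1)] F_add[OF c c]])
  \<comment> \<open>Expanding and replacing \<open>c * c\<close> by
    \<open>\<delta> * cj \<delta>\<close> pulls out the factor \<open>cj \<delta>\<close>; likewise
    \<open>c\<close> comes out of the norm of \<open>\<gamma>\<close>. So \<open>L^2\<close> and
    \<open>L (cj L)\<close> get the same generator \<open>c * c * t\<close>, which lies in
    \<open>F\<close>.\<close>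
  have gg: "\<gamma> * \<gamma> = cj \<delta> * t"
    using N by (simp add: \<gamma>_def t_def algebra_simps)
  have gcg: "\<gamma> * cj \<gamma> = c * t"
    using N unfolding cj0 by (simp add: \<gamma>_def t_def algebra_simps)
  have t0: "t \<noteq> 0" using gg g0 by auto
  define L where "L = smul \<gamma> I"
  have L: "is_ideal B L" "L \<noteq> {0}" unfolding L_def by (rule ideal_smul[OF B_subring gB I(1)], rule smul_nonzero[OF g0 I(2)])
  have LL: "iprod L L = smul (c * c * t) B"
  proof -
    have "iprod L L = smul (\<gamma> * \<gamma> * \<delta>) B"
      by (simp add: L_def iprod_smul_left iprod_smul_right II smul_smul mult_ac)
    also have "\<gamma> * \<gamma> * \<delta> = c * c * t" unfolding gg N[symmetric] by simp
    finally show ?thesis .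
  qed
  have IE: "I \<subseteq> E" using I B_in_E by (auto simp: is_ideal_def)
  have LcL: "iprod L (cj ` L) = smul (c * c * t) B"
  proof -
    have "iprod L (cj ` L) = smul (\<gamma> * cj \<gamma> * c) B"
      by (simp add: L_def cj_smul[OF gE IE] iprod_smul_left iprod_smul_right IcI smul_smul mult_ac)
    also have "\<gamma> * cj \<gamma> * c = c * c * t" unfolding gcg by simp
    finally show ?thesis .
  qed
  have "c * c * t \<in> F" "c * c * t \<noteq> 0" using c tF c0 t0 by (auto intro!: F_mult)
  then obtain x g f v v' where *: "x \<in> A" "g \<in> {1, d}" "f \<in> Fs" "v \<in> A" "v' \<in> A" "v * v' = 1" "x \<noteq> 0"
    "c * c * t = v * (x * x) * g * f"
    using genus[OF L _ _ LL LcL] by blast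
  have "smul (c * c * t) B = smul (x * x * g * f) (smul v B)"
    unfolding *(8) by (simp add: smul_smul mult_ac)
  also have "smul v B = B"
    using *(4-6) A_B by (intro smul_unit[OF B_subring subring_module[OF B_subring], of v v']) auto
  finally have "iprod L L = smul (x * x * g * f) B" using LL by simp
  moreover have "\<gamma> * \<gamma> * c * c = cj \<delta> * (v * (x * x) * g * f)"
    unfolding gg *(8)[symmetric] by simp
  ultimately show thesis using that[OF gB g0 *(1-7)] unfolding L_def by blast
qed

end

section \<open>The integers of the quadratic and of the quartic field\<close>

text \<open>Unlike integrality over \<open>A\<close>, this property visibly passes from \<open>z\<close> to its trace and norm, so
  the closure of algebraic integers under addition is not needed.\<close>

definition completely_closed :: "real set \<Rightarrow> real set \<Rightarrow> bool" where
  "completely_closed A F \<longleftrightarrow> (\<forall>z\<in>F. \<forall>D\<in>A. D \<noteq> 0 \<longrightarrow> (\<forall>i::nat. D * z ^ i \<in> A) \<longrightarrow> z \<in> A)"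

context quad0
begin

lemma B_mult: "x \<in> B \<Longrightarrow> y \<in> B \<Longrightarrow> x * y \<in> B"
  and B_add: "x \<in> B \<Longrightarrow> y \<in> B \<Longrightarrow> x + y \<in> B"
  and B_diff: "x \<in> B \<Longrightarrow> y \<in> B \<Longrightarrow> x - y \<in> B"
  using B_subring by (auto simp: is_subring_def)

lemma E_power: "z \<in> E \<Longrightarrow> z ^ i \<in> E"
  by (induction i) (auto simp: E_mult F_E F_1)

lemma cj_power: "z \<in> E \<Longrightarrow> cj (z ^ i) = cj z ^ i"
  by (induction i) (auto simp: cj_mult E_power)

text \<open>If \<open>D\<close> clears the denominators of all powers of \<open>z\<close>, then
  \<open>D * cj D\<close> clears those of all \<open>z ^ i * cj z ^ j\<close>, hence of all powers
  of trace and norm, which lie in \<open>F\<close>.\<close>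

lemma trace_norm_closed:
  assumes A: "completely_closed A F" and z: "z \<in> E" and D: "D \<in> B" "D \<noteq> 0" "\<And>i::nat. D * z ^ i \<in> B"
  shows "z + cj z \<in> A" "z * cj z \<in> A"
proof -
  define D' where "D' = D * cj D"
  have D': "D' \<in> A" "D' \<noteq> 0" using norm_A[OF D(1)] cj_nz[OF B_in_E[OF D(1)]] D by (auto simp: D'_def)
  have cjD: "cj D * cj z ^ i \<in> B" for i
    using cj_B[OF D(3)[of i]] z D by (simp add: cj_mult cj_power E_power B_in_E)
  have 1: "D' * (z ^ i * cj z ^ j) \<in> B" for i j
    using B_mult[OF D(3)[of i] cjD[of j]] by (simp add: D'_def mult_ac)
  have D'F: "D' \<in> F" using D' A_F by blast
  have Fpow: "x ^ i \<in> F" if "x \<in> F" for x and i :: nat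
    using that by (induction i) (auto simp: F_1 F_mult)
  have "D' * (z * cj z) ^ i \<in> A" for i
  proof (rule B_Int_F)
    show "D' * (z * cj z) ^ i \<in> B" using 1[of i i] by (simp add: power_mult_distrib)
    show "D' * (z * cj z) ^ i \<in> F" by (intro F_mult D'F Fpow norm_F z)
  qed
  moreover have "z * cj z \<in> F" by (rule norm_F[OF z])
  ultimately show "z * cj z \<in> A" using A D' unfolding completely_closed_def by blast
  \<comment> \<open>Carrying a general cofactor \<open>w\<close> lets one factor
    \<open>z + cj z\<close> at a time be split into \<open>w * z\<close> and
    \<open>w * cj z\<close>, in place of the binomial formula.\<close>
  have "D' * (w * (z + cj z) ^ i) \<in> B" if "\<And>i j. D' * (w * (z ^ i * cj z ^ j)) \<in> B" for w i
    using that
  proof (induction i arbitrary: w)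
    case 0
    then show ?case using 0[of 0 0] by simp
  next
    case (Suc i)
    have "D' * ((w * z) * (z + cj z) ^ i) \<in> B"
    proof (rule Suc.IH)
      show "D' * (w * z * (z ^ i * cj z ^ j)) \<in> B" for i j
        using Suc.prems[of "Suc i" j] by (simp add: mult_ac)
    qed
    moreover have "D' * ((w * cj z) * (z + cj z) ^ i) \<in> B"
    proof (rule Suc.IH)
      show "D' * (w * cj z * (z ^ i * cj z ^ j)) \<in> B" for i j
        using Suc.prems[of i "Suc j"] by (simp add: mult_ac)
    qed
    ultimately have "D' * ((w * z) * (z + cj z) ^ i) + D' * ((w * cj z) * (z + cj z) ^ i) \<in> B"
      by (rule B_add)
    then show ?case by (simp add: algebra_simps)
  qed
  from this[of 1] 1 have 2: "D' * (z + cj z) ^ i \<in> B" for i by simp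
  have "D' * (z + cj z) ^ i \<in> A" for i
  proof (rule B_Int_F)
    show "D' * (z + cj z) ^ i \<in> F" by (intro F_mult D'F Fpow trace_F z)
  qed (rule 2)
  moreover have "z + cj z \<in> F" by (rule trace_F[OF z])
  ultimately show "z + cj z \<in> A" using A D' unfolding completely_closed_def by blast
qed

text \<open>The powers of a root of a monic quadratic equation satisfy a two-term recurrence, so any
  \<open>a\<close> clearing the denominator of \<open>z\<close> clears those of all its
  powers.\<close>

lemma quad_if_completely_closed:
  assumes "completely_closed B E"
  shows "quad A F d r"
proof
  fix z x y assume z: "z \<in> E" and xy: "x \<in> B" "y \<in> B" "z * z = x * z + y"
  obtain a where a: "a \<in> A" "a \<noteq> 0" "a * z \<in> B" using E_frac[OF z] by blast
  have "a * z ^ i \<in> B \<and> a * z ^ Suc i \<in> B" for i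
  proof (induction i)
    case (Suc i)
    have "a * z ^ Suc (Suc i) = a * (z * z) * z ^ i" by (simp add: mult_ac)
    also have "\<dots> = x * (a * z ^ Suc i) + y * (a * z ^ i)" unfolding xy(3) by (simp add: algebra_simps)
    finally show ?case using Suc xy by (auto intro!: B_add B_mult)
  qed (use a A_B in auto)
  then show "z \<in> B" using assms z a A_B unfolding completely_closed_def by blast
qed

end

section \<open>The base case of the rational integers\<close>

lemma Ints_subring: "is_subring \<int>"
  by (auto simp: is_subring_def)

lemma Rats_subfield: "is_subfield \<rat>"
  by (auto simp: is_subfield_def)

lemma Rats_frac: "x \<in> \<rat> \<Longrightarrow> \<exists>a\<in>\<int>. a \<noteq> 0 \<and> a * x \<in> (\<int> :: real set)"
  by (elim Rats_cases') (metis Ints_of_int less_irrefl of_int_0_less_iff nonzero_mult_div_cancel_left times_divide_eq_right)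

text \<open>In lowest terms \<open>a / b\<close>, every power of \<open>b\<close> divides the fixed
  nonzero integer \<open>m\<close>; the exponent \<open>\<bar>m\<bar>\<close> already forces
  \<open>b = 1\<close>, as \<open>2 ^ n\<close> exceeds \<open>n\<close>.\<close>

lemma Ints_completely_closed: "completely_closed \<int> \<rat>"
  unfolding completely_closed_def
proof (intro ballI impI)
  fix z D :: real assume z: "z \<in> \<rat>" and D: "D \<in> \<int>" "D \<noteq> 0" "\<forall>i. D * z ^ i \<in> \<int>"
  obtain a b :: int where ab: "b > 0" "coprime a b" "z = of_int a / of_int b"
    using z by (rule Rats_cases')
  obtain m :: int where m: "D = of_int m" using D by (auto elim: Ints_cases)
  have "b ^ i dvd m" for i
  proof -
    obtain n :: int where "D * z ^ i = of_int n" using D by (auto elim: Ints_cases)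
    then have "real_of_int (m * a ^ i) = real_of_int (n * b ^ i)"
      using ab m by (simp add: field_simps)
    then have "m * a ^ i = n * b ^ i" by (simp only: of_int_eq_iff)
    then have "b ^ i dvd m * a ^ i" by simp
    moreover have "coprime (b ^ i) (a ^ i)" using ab by (simp add: coprime_commute)
    ultimately show ?thesis by (simp add: coprime_dvd_mult_left_iff)
  qed
  from this[of "nat \<bar>m\<bar>"] have "b ^ nat \<bar>m\<bar> \<le> \<bar>m\<bar>"
    using m D by (metis dvd_imp_le_int abs_of_nonneg ab(1) less_imp_le zero_le_power of_int_0)
  moreover have "\<bar>m\<bar> < b ^ nat \<bar>m\<bar>" if "b \<ge> 2"
  proof -
    have "\<bar>m\<bar> = int (nat \<bar>m\<bar>)" by simp
    also have "\<dots> < 2 ^ nat \<bar>m\<bar>" by (metis of_nat_less_two_power)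
    also have "\<dots> \<le> b ^ nat \<bar>m\<bar>" using that by (intro power_mono) auto
    finally show ?thesis .
  qed
  ultimately have "b = 1" using ab by linarith
  then show "z \<in> \<int>" using ab by simp
qed

lemma int_ideal_principal:
  assumes I: "is_ideal \<int> I"
  shows "\<exists>a::int. I = smul (of_int a) \<int>"
proof (cases "I = {0}")
  case True
  then show ?thesis by (intro exI[of _ 0]) (auto simp: smul_def)
next
  case False
  have Isub: "I \<subseteq> \<int>" and Iadd: "\<And>x y. x \<in> I \<Longrightarrow> y \<in> I \<Longrightarrow> x + y \<in> I"
    and Imul: "\<And>a x. a \<in> \<int> \<Longrightarrow> x \<in> I \<Longrightarrow> a * x \<in> I" and I0: "0 \<in> I"
    using I by (auto simp: is_ideal_def)
  define P where "P = (\<lambda>n::nat. n > 0 \<and> real n \<in> I)"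
  obtain x where x: "x \<in> I" "x \<noteq> 0" using False I0 by blast
  then obtain m :: int where m: "x = of_int m" using Isub by (auto elim: Ints_cases)
  have "of_int (sgn m) * x = \<bar>x\<bar>" unfolding m by (simp add: sgn_if)
  then have "\<bar>x\<bar> \<in> I" using Imul[OF Ints_of_int x(1)] by metis
  then have "P (nat \<bar>m\<bar>)" using x m by (simp add: P_def)
  define n where "n = (LEAST n. P n)"
  have n: "n > 0" "real n \<in> I" using LeastI[of P, OF \<open>P (nat \<bar>m\<bar>)\<close>] by (auto simp: n_def P_def)
  have min: "k = 0 \<or> n \<le> k" if "real k \<in> I" for k
    using Least_le[of P k] that by (auto simp: n_def P_def)
  have "I \<subseteq> smul (of_int (int n)) \<int>"
  proof
    fix y assume y: "y \<in> I"
    then obtain m :: int where m: "y = of_int m" using Isub by (auto elim: Ints_cases)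
    have "real (nat (m mod int n)) = of_int (m mod int n)" using n by simp
    also have "\<dots> = y + of_int (- (m div int n)) * real n"
      unfolding m by (simp add: minus_div_mult_eq_mod[symmetric])
    also have "\<dots> \<in> I" using y n by (intro Iadd Imul) auto
    finally have "nat (m mod int n) = 0 \<or> n \<le> nat (m mod int n)" by (rule min)
    moreover have "nat (m mod int n) < n" using n by (simp add: nat_less_iff)
    ultimately have "m mod int n = 0" using n by (metis not_le nat_0_iff pos_mod_sign of_nat_0_less_iff order_antisym)
    then have "m = int n * (m div int n)" by (simp add: mult.commute mod_0_imp_dvd)
    then have "y = of_int (int n) * of_int (m div int n)" unfolding m by (metis of_int_mult)
    then show "y \<in> smul (of_int (int n)) \<int>" by (metis smul_memI Ints_of_int)
  qed
  moreover have "smul (of_int (int n)) \<int> \<subseteq> I"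
    using Imul n by (auto simp: smul_def mult.commute)
  ultimately show ?thesis by blast
qed

lemma ded_Ints: "ded \<int> \<rat>"
proof
  show "x \<in> \<int>" if x: "x \<in> \<rat>" "x * x \<in> \<int>" for x :: real
  proof -
    obtain a where a: "a \<in> \<int>" "a \<noteq> 0" "a * x \<in> \<int>" using Rats_frac[OF x(1)] by blast
    have "a * x ^ i \<in> \<int> \<and> a * x ^ Suc i \<in> \<int>" for i
    proof (induction i)
      case (Suc i)
      have "a * x ^ Suc (Suc i) = (x * x) * (a * x ^ i)" by simp
      then show ?case using Suc x by (metis Ints_mult)
    qed (use a in auto)
    then show ?thesis using Ints_completely_closed x a unfolding completely_closed_def by blast
  qed
  show "\<exists>I' m. is_ideal \<int> I' \<and> I' \<noteq> {0} \<and> m \<in> \<int> \<and> m \<noteq> 0 \<and> iprod I I' = smul m \<int>"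
    if I: "is_ideal \<int> I" "I \<noteq> {0}" for I
  proof -
    obtain a :: int where a: "I = smul (of_int a) \<int>" using int_ideal_principal[OF I(1)] by blast
    then have "a \<noteq> 0" using I by (auto simp: smul_def)
    moreover have "iprod I \<int> = I" using I Ints_subring by (simp add: iprod_ring_right is_ideal_iff)
    ultimately show ?thesis using a subring_ideal[OF Ints_subring] subring_nonzero[OF Ints_subring]
      by (metis Ints_of_int of_int_eq_0_iff)
  qed
qed (auto simp: Ints_subring Rats_subfield Rats_frac elim!: Ints_cases)

section \<open>The tower of the quadratic field \<open>k\<close> and the quartic field
  \<open>K\<close>\<close>

locale prime7 =
  fixes p :: nat
  assumes p_prime: "prime p" and p_mod: "p mod 16 = 7"
begin

definition s :: real where "s = sqrt (real p)"
definition \<theta> :: real where "\<theta> = root 4 (real p)"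

lemma p_pos: "p > 0" using p_prime prime_gt_0_nat by blast

lemma s_sq: "s * s = real p" by (simp add: s_def)

lemma s_pos: "s > 0" using p_pos by (simp add: s_def)

lemma \<theta>_pos: "\<theta> > 0" using p_pos by (simp add: \<theta>_def)

lemma \<theta>_sq: "\<theta> * \<theta> = s"
proof -
  have "(\<theta> * \<theta>) ^ 2 = \<theta> ^ 4" by (simp add: power_mult_distrib power2_eq_square power4_eq_xxxx)
  also have "\<dots> = real p" by (simp add: \<theta>_def)
  finally show ?thesis unfolding s_def using \<theta>_pos by (metis real_sqrt_unique mult_nonneg_nonneg less_imp_le)
qed

lemma s_irrational: "s \<notin> \<rat>"
proof
  assume s: "s \<in> \<rat>"
  interpret Z: ded \<int> \<rat> by (rule ded_Ints)
  have "s \<in> \<int>" using Z.sq_closed[OF s] by (simp add: s_sq)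
  then obtain n :: int where n: "s = of_int n" by (auto elim: Ints_cases)
  have "of_int (n * n) = real_of_int (int p)" using s_sq unfolding n by simp
  then have eq: "n * n = int p" by (simp only: of_int_eq_iff)
  have pp: "prime (int p)" using p_prime by simp
  then have "int p dvd n" using eq by (metis dvd_refl prime_dvd_mult_iff)
  then have "int p * int p dvd int p" using eq by (metis mult_dvd_mono)
  then show False using pp by (simp add: prime_int_iff)
qed

end

sublocale prime7 \<subseteq> k: quad0 \<int> \<rat> "real p" s
proof -
  interpret Z: ded \<int> \<rat> by (rule ded_Ints)
  show "quad0 \<int> \<rat> (real p) s"
    by unfold_locales (auto simp: s_sq s_irrational)
qed

lemma int_sq_mod4:
  fixes x :: int
  shows "even x \<Longrightarrow> \<exists>e. x * x = 4 * e" "odd x \<Longrightarrow> \<exists>e. x * x = 4 * e + 1"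
proof -
  assume "even x"
  then obtain k where "x = 2 * k" by (auto elim: evenE)
  then have "x * x = 4 * (k * k)" by simp
  then show "\<exists>e. x * x = 4 * e" by blast
next
  assume "odd x"
  then obtain k where "x = 2 * k + 1" by (auto elim: oddE)
  then have "x * x = 4 * (k * k + k) + 1" by (simp add: algebra_simps)
  then show "\<exists>e. x * x = 4 * e + 1" by blast
qed

context prime7
begin

lemma p_int_form: "\<exists>q. int p = 16 * q + 7"
  using p_mod by (intro exI[of _ "int (p div 16)"]) presburger

lemma p_sq_mod4:
  fixes x :: int
  shows "even x \<Longrightarrow> \<exists>e. int p * (x * x) = 4 * e" "odd x \<Longrightarrow> \<exists>e. int p * (x * x) = 4 * e + 3"
proof -
  obtain q where q: "int p = 16 * q + 7" using p_int_form by blast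
  show "\<exists>e. int p * (x * x) = 4 * e" if x: "even x"
  proof -
    obtain e where "x * x = 4 * e" using int_sq_mod4(1)[OF x] by blast
    then have "int p * (x * x) = 4 * (int p * e)" by simp
    then show ?thesis by blast
  qed
  show "\<exists>e. int p * (x * x) = 4 * e + 3" if x: "odd x"
  proof -
    obtain e where "x * x = 4 * e + 1" using int_sq_mod4(2)[OF x] by blast
    then have "int p * (x * x) = 4 * (int p * e + 4 * q + 1) + 3" using q by (simp add: algebra_simps)
    then show ?thesis by blast
  qed
qed

text \<open>\<open>- p\<close> is 1 modulo 4, so modulo 4 the left side is a sum of two squares and
  vanishes only if both are even. This excludes half-integral coordinates: the integers of
  \<open>k\<close> are \<open>\<int>[s]\<close>.\<close>

lemma norm_even:
  fixes m b n :: int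
  assumes "m * m - int p * (b * b) = 4 * n"
  shows "even m \<and> even b"
proof (rule ccontr)
  obtain e f where "m * m = 4 * e \<or> m * m = 4 * e + 1" "int p * (b * b) = 4 * f \<or> int p * (b * b) = 4 * f + 3"
    using int_sq_mod4[of m] p_sq_mod4[of b] by metis
  moreover assume "\<not> (even m \<and> even b)"
  ultimately show False using assms int_sq_mod4[of m] p_sq_mod4[of b]
    by (cases "even m"; cases "even b") (auto, presburger+)
qed

lemma int_prime: "prime (int p)" using p_prime by simp

text \<open>Trace and norm are integers, so \<open>2 a\<close> is one. Then
  \<open>p * (2 b)^2\<close> is an integer, and so is \<open>2 b\<close> because \<open>p\<close> is
  prime; \<open>norm_even\<close> removes the factor 2.\<close>

lemma k_completely_closed: "completely_closed k.B k.E"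
  unfolding completely_closed_def
proof (intro ballI impI)
  fix z D assume z: "z \<in> k.E" and D: "D \<in> k.B" "D \<noteq> 0" "\<forall>i. D * z ^ i \<in> k.B"
  obtain a b where ab: "a \<in> \<rat>" "b \<in> \<rat>" "z = a + b * s" using z by (rule k.E_E)
  have cjz: "k.cj z = a - b * s" using ab by (simp add: k.cj_rep)
  have "z + k.cj z \<in> \<int>" "z * k.cj z \<in> \<int>"
    using k.trace_norm_closed[OF Ints_completely_closed z D(1,2)] D(3) by blast+
  then obtain m n :: int where m: "z + k.cj z = of_int m" and n: "z * k.cj z = of_int n" by (auto elim!: Ints_cases)
  have m': "2 * a = of_int m" using m ab cjz by simp
  have n': "a * a - real p * (b * b) = of_int n"
    using n unfolding cjz unfolding ab by (simp add: algebra_simps s_sq[symmetric])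
  have pb: "real p * ((2 * b) * (2 * b)) = of_int (m * m - 4 * n)"
    using n' m' by (simp add: algebra_simps flip: m')
  have "real p * (2 * b) \<in> \<int>"
  proof (rule k.sq_closed)
    show "real p * (2 * b) \<in> \<rat>" using ab by auto
    have "real p * (2 * b) * (real p * (2 * b)) = real p * of_int (m * m - 4 * n)"
      using pb by (simp add: mult_ac)
    also have "\<dots> \<in> \<int>" by (intro Ints_mult) auto
    finally show "real p * (2 * b) * (real p * (2 * b)) \<in> \<int>" .
  qed
  then obtain c :: int where c: "real p * (2 * b) = of_int c" by (auto elim: Ints_cases)
  have "real_of_int (c * c) = of_int (int p * (m * m - 4 * n))"
    using pb by (simp flip: c) (simp add: mult_ac)
  then have "c * c = int p * (m * m - 4 * n)" by (simp only: of_int_eq_iff)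
  then have "int p dvd c" using int_prime by (metis dvd_triv_left prime_dvd_mult_iff)
  then obtain \<beta> where \<beta>: "c = int p * \<beta>" by blast
  then have b: "2 * b = of_int \<beta>" using c p_pos by simp
  have "real_of_int (m * m - int p * (\<beta> * \<beta>)) = of_int (4 * n)"
    using n' by (simp add: algebra_simps flip: b m')
  then have "m * m - int p * (\<beta> * \<beta>) = 4 * n" by (simp only: of_int_eq_iff)
  then have "even m" "even \<beta>" using norm_even by blast+
  then obtain m1 \<beta>1 where "m = 2 * m1" "\<beta> = 2 * \<beta>1" by (auto elim!: evenE)
  then have "a = of_int m1" "b = of_int \<beta>1" using m' b by auto
  then show "z \<in> k.B" using ab k.B_I by simp
qed

end

sublocale prime7 \<subseteq> k: quad \<int> \<rat> "real p" s
  by (rule k.quad_if_completely_closed[OF k_completely_closed])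

context prime7
begin

lemma k_rep_of_int:
  assumes "real_of_int a + of_int b * s = of_int c + of_int d * s"
  shows "a = c" "b = d"
  using k.rep_unique[of "of_int a" "of_int b" "of_int c" "of_int d"] assms by auto

lemma o_cases:
  assumes "z \<in> k.B"
  obtains a b :: int where "z = of_int a + of_int b * s"
  using assms by (auto elim!: k.B_E Ints_cases)

lemma o_I: "of_int a + of_int b * s \<in> k.B"
  by (rule k.B_I) auto

text \<open>The square of \<open>x + y * s\<close> has rational part
  \<open>x * x + p * y * y\<close>, which would have to vanish.\<close>

lemma \<theta>_notin: "\<theta> \<notin> k.E"
proof
  assume "\<theta> \<in> k.E"
  then obtain x y where xy: "x \<in> \<rat>" "y \<in> \<rat>" "\<theta> = x + y * s" by (rule k.E_E)
  have "0 + 1 * s = (x * x + real p * (y * y)) + (2 * x * y) * s"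
    using \<theta>_sq unfolding xy(3) by (simp add: algebra_simps s_sq[symmetric])
  then have 0: "x * x + real p * (y * y) = 0" "1 = 2 * x * y"
    using k.rep_unique[of 0 1 "x * x + real p * (y * y)" "2 * x * y"] xy by auto
  moreover have "0 \<le> x * x" "0 \<le> real p * (y * y)" by auto
  ultimately have "x * x = 0" by linarith
  then show False using 0 by auto
qed

end

sublocale prime7 \<subseteq> K: quad0 k.B k.E s \<theta>
  using k.r_B by unfold_locales (auto simp: \<theta>_sq \<theta>_notin)

context prime7
begin

text \<open>The left sides are the coordinates of the relative norm of
  \<open>(a + b s) + (c + d s) \<theta>\<close>. The double of an integral element has norm
  divisible by 4, so its coordinates are even: no halves occur in the integers of \<open>K\<close>
  either.\<close>

lemma relative_norm_even:
  fixes a b c d :: int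
  assumes 1: "a * a + int p * (b * b) - 2 * (int p * (c * d)) = 4 * m"
    and 2: "2 * (a * b) - c * c - int p * (d * d) = 4 * n"
  shows "even a \<and> even b \<and> even c \<and> even d"
proof -
  obtain q where q: "int p = 16 * q + 7" using p_int_form by blast
  have "odd (int p)" using q by presburger
  have ab: "even a \<longleftrightarrow> even b"
  proof -
    have "a * a + int p * (b * b) = 2 * (2 * m + int p * (c * d))" using 1 by (simp add: algebra_simps)
    then have "even (a * a + int p * (b * b))" by simp
    then show ?thesis using \<open>odd (int p)\<close> by simp
  qed
  have cd: "even c \<longleftrightarrow> even d"
  proof -
    have "c * c + int p * (d * d) = 2 * (a * b - 2 * n)" using 2 by (simp add: algebra_simps)
    then have "even (c * c + int p * (d * d))" by simp
    then show ?thesis using \<open>odd (int p)\<close> by simp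
  qed
  have "even c"
  proof (rule ccontr)
    assume "odd c"
    then have "odd d" using cd by simp
    then obtain e where e: "int p * (c * d) = 2 * e + 1" using \<open>odd c\<close> \<open>odd (int p)\<close> by (metis even_mult_iff oddE)
    show False
    proof (cases "even a")
      case True
      then obtain f g where "a * a = 4 * f" "int p * (b * b) = 4 * g"
        using int_sq_mod4 p_sq_mod4 ab by meson
      then show False using 1 e by presburger
    next
      case False
      then obtain f g where "a * a = 4 * f + 1" "int p * (b * b) = 4 * g + 3"
        using int_sq_mod4 p_sq_mod4 ab by meson
      then show False using 1 e by presburger
    qed
  qed
  then obtain f g where fg: "c * c = 4 * f" "int p * (d * d) = 4 * g"
    using int_sq_mod4 p_sq_mod4 cd by meson
  have "a * b = 2 * (n + f + g)" using 2 unfolding fg by simp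
  then have "even (a * b)" by simp
  then show ?thesis using ab cd \<open>even c\<close> by auto
qed

text \<open>\<open>s\<close> is a prime element: modulo \<open>s\<close> an element is its first
  coordinate modulo \<open>p\<close>.\<close>

lemma s_dvd_sq:
  assumes c: "c \<in> k.B" and e: "e \<in> k.B" and eq: "c * c = s * e"
  shows "c / s \<in> k.B"
proof -
  obtain c0 c1 where c': "c = of_int c0 + of_int c1 * s" using c by (rule o_cases)
  obtain e0 e1 where e': "e = of_int e0 + of_int e1 * s" using e by (rule o_cases)
  have "real_of_int (c0 * c0 + int p * (c1 * c1)) + of_int (2 * c0 * c1) * s = of_int (int p * e1) + of_int e0 * s"
    using eq unfolding c' e' by (simp add: algebra_simps s_sq[symmetric])
  then have "c0 * c0 + int p * (c1 * c1) = int p * e1" by (rule k_rep_of_int)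
  then have "c0 * c0 = int p * (e1 - c1 * c1)" by (simp add: algebra_simps)
  then have "int p dvd c0" using int_prime by (metis dvd_triv_left prime_dvd_mult_iff)
  then obtain c2 where "c0 = int p * c2" by blast
  then have "c / s = of_int c1 + of_int c2 * s" unfolding c' using s_pos by (simp add: field_simps s_sq[symmetric])
  then show ?thesis using o_I by simp
qed

text \<open>The argument of \<open>k_completely_closed\<close> one level up, with the prime element
  \<open>s\<close> in place of \<open>p\<close> and \<open>relative_norm_even\<close> in place of
  \<open>norm_even\<close>.\<close>

lemma K_completely_closed: "completely_closed K.B K.E"
  unfolding completely_closed_def
proof (intro ballI impI)
  fix z D assume z: "z \<in> K.E" and D: "D \<in> K.B" "D \<noteq> 0" "\<forall>i. D * z ^ i \<in> K.B"
  obtain a b where ab: "a \<in> k.E" "b \<in> k.E" "z = a + b * \<theta>" using z by (rule K.E_E)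
  have cjz: "K.cj z = a - b * \<theta>" using ab by (simp add: K.cj_rep)
  have T: "z + K.cj z \<in> k.B" "z * K.cj z \<in> k.B"
    using K.trace_norm_closed[OF k_completely_closed z D(1,2)] D(3) by blast+
  have T1: "z + K.cj z = 2 * a" unfolding cjz unfolding ab by simp
  have T2: "z * K.cj z = a * a - s * (b * b)"
    unfolding cjz unfolding ab by (simp add: algebra_simps \<theta>_sq[symmetric])
  obtain M where M: "2 * a = M" "M \<in> k.B" using T(1) unfolding T1 by blast
  obtain n where n: "a * a - s * (b * b) = n" "n \<in> k.B" using T(2) unfolding T2 by blast
  have four: "4 \<in> k.B" and two: "2 \<in> k.B" using o_I[of 4 0] o_I[of 2 0] by auto
  have W: "M * M - 4 * n \<in> k.B" using M n four by (intro k.B_diff k.B_mult)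
  have sb: "s * ((2 * b) * (2 * b)) = M * M - 4 * n"
    unfolding M(1)[symmetric] n(1)[symmetric] by (simp add: algebra_simps)
  have "2 * b \<in> k.E" using ab two k.B_in_E by (intro k.E_mult) auto
  have "s * (2 * b) \<in> k.B"
  proof (rule k.BE.sq_closed)
    show "s * (2 * b) \<in> k.E" using \<open>2 * b \<in> k.E\<close> by (rule k.E_mult[OF k.r_E])
    have "s * (2 * b) * (s * (2 * b)) = s * (M * M - 4 * n)" unfolding sb[symmetric] by simp
    also have "\<dots> \<in> k.B" using W by (rule k.B_mult[OF k.r_B])
    finally show "s * (2 * b) * (s * (2 * b)) \<in> k.B" .
  qed
  moreover have "(s * (2 * b)) * (s * (2 * b)) = s * (M * M - 4 * n)" unfolding sb[symmetric] by simp
  ultimately have "(s * (2 * b)) / s \<in> k.B" using W s_dvd_sq by blast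
  then have "2 * b \<in> k.B" using s_pos by simp
  then obtain c d where cd: "2 * b = of_int c + of_int d * s" by (rule o_cases)
  obtain a0 a1 where "M = of_int a0 + of_int a1 * s" using M(2) by (rule o_cases)
  then have a: "2 * a = of_int a0 + of_int a1 * s" using M by simp
  obtain n0 n1 where n': "n = of_int n0 + of_int n1 * s" using n o_cases by metis
  have "(2 * a) * (2 * a) - s * ((2 * b) * (2 * b)) = 4 * n" using n by (simp add: algebra_simps)
  then have "real_of_int (a0 * a0 + int p * (a1 * a1) - 2 * (int p * (c * d))) +
      of_int (2 * (a0 * a1) - c * c - int p * (d * d)) * s = of_int (4 * n0) + of_int (4 * n1) * s"
    unfolding a cd n' by (simp add: algebra_simps s_sq[symmetric])
  then have "a0 * a0 + int p * (a1 * a1) - 2 * (int p * (c * d)) = 4 * n0"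
    "2 * (a0 * a1) - c * c - int p * (d * d) = 4 * n1" by (rule k_rep_of_int)+
  then have "even a0 \<and> even a1 \<and> even c \<and> even d" by (rule relative_norm_even)
  then obtain a0' a1' c' d' where "a0 = 2 * a0'" "a1 = 2 * a1'" "c = 2 * c'" "d = 2 * d'" by (auto elim!: evenE)
  then have "a = of_int a0' + of_int a1' * s" "b = of_int c' + of_int d' * s" using a cd by auto
  then show "z \<in> K.B" unfolding ab(3) using o_I by (auto intro: K.B_I)
qed

end

sublocale prime7 \<subseteq> K: quad k.B k.E s \<theta>
  by (rule K.quad_if_completely_closed[OF K_completely_closed])

section \<open>Quadratic residues and Pell's equation\<close>

lemma Legendre_values: "Legendre a p = 0 \<or> Legendre a p = 1 \<or> Legendre a p = -1"
  by (auto simp: Legendre_def)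

text \<open>Upgrades Euler's congruence to an equality: two values among -1, 0, 1 differ by at most
  2.\<close>

lemma Legendre_cong_eq:
  fixes p :: int
  assumes "[x = y] (mod p)" "p > 2" "x = 0 \<or> x = 1 \<or> x = -1" "y = 0 \<or> y = 1 \<or> y = -1"
  shows "x = y"
proof (rule ccontr)
  assume "x \<noteq> y"
  have "p dvd x - y" using assms(1) by (simp add: cong_iff_dvd_diff)
  then have "p \<le> \<bar>x - y\<bar>" using \<open>x \<noteq> y\<close> by (intro zdvd_imp_le) (auto simp: dvd_abs_iff)
  moreover have "\<bar>x - y\<bar> \<le> 2" using assms(3,4) by auto
  ultimately show False using assms(2) by simp
qed

lemma Legendre_mult:
  assumes p: "prime p" "2 < p"
  shows "Legendre (a * b) (int p) = Legendre a (int p) * Legendre b (int p)"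
proof -
  have "[Legendre a p * Legendre b p = a ^ ((p - 1) div 2) * b ^ ((p - 1) div 2)] (mod p)"
    using euler_criterion[OF p] by (intro cong_mult)
  then have "[Legendre a p * Legendre b p = Legendre (a * b) p] (mod p)"
    using euler_criterion[OF p, of "a * b"] by (metis cong_sym cong_trans power_mult_distrib)
  moreover have "Legendre a p * Legendre b p = 0 \<or> Legendre a p * Legendre b p = 1 \<or> Legendre a p * Legendre b p = -1"
    using Legendre_values[of a p] Legendre_values[of b p] by auto
  ultimately show ?thesis using Legendre_cong_eq[of _ _ "int p"] p Legendre_values[of "a * b" p] by (metis of_nat_less_iff of_nat_numeral)
qed

lemma Legendre_minus_1:
  assumes p: "prime p" "2 < p"
  shows "Legendre (-1) (int p) = (-1) ^ ((p - 1) div 2)"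
proof -
  have "(-1::int) ^ n = 0 \<or> (-1::int) ^ n = 1 \<or> (-1::int) ^ n = - 1" for n :: nat
    by (cases "even n") auto
  then show ?thesis
    using Legendre_cong_eq[OF euler_criterion[OF p]] p Legendre_values by auto
qed

text \<open>Gauss's lemma with multiplier 2. For \<open>h = (p - 1) / 2\<close> the doubles that
  exceed \<open>h\<close> come from the interval from \<open>h div 2\<close> to \<open>h\<close>,
  and the parity of its length depends on \<open>h\<close> modulo 4.\<close>

lemma Legendre_2:
  assumes p: "prime p" "2 < p"
  shows "Legendre 2 (int p) = (if p mod 8 = 1 \<or> p mod 8 = 7 then 1 else -1)"
proof -
  have "\<not> int p dvd 2"
    using p by (metis of_nat_dvd_iff of_nat_numeral nat_dvd_not_less zero_less_numeral)
  then interpret G: GAUSS p 2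
    using p by unfold_locales (auto simp: cong_0_iff)
  have odd: "odd p" using p by (simp add: prime_odd_nat)
  define h where "h = (int p - 1) div 2"
  have h: "int p = 2 * h + 1" "h \<ge> 0" using odd p by (auto simp: h_def)
  have C: "G.C = (\<lambda>x. x * 2) ` {0<..h}"
  proof -
    have "(x * 2) mod int p = x * 2" if "x \<in> {0<..h}" for x using that h by (intro mod_pos_pos_trivial) auto
    then show ?thesis unfolding G.C_def G.B_def G.A_def h_def[symmetric] image_image
      by (intro image_cong refl)
  qed
  have "G.E = (\<lambda>x. x * 2) ` {h div 2<..h}"
  proof
    show "G.E \<subseteq> (\<lambda>x. x * 2) ` {h div 2<..h}"
    proof
      fix y assume "y \<in> G.E"
      then obtain x where "y = x * 2" "0 < x" "x \<le> h" "h < y" unfolding G.E_def C h_def[symmetric] by auto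
      moreover from this have "h div 2 < x" by presburger
      ultimately show "y \<in> (\<lambda>x. x * 2) ` {h div 2<..h}" by auto
    qed
    show "(\<lambda>x. x * 2) ` {h div 2<..h} \<subseteq> G.E"
    proof
      fix y assume "y \<in> (\<lambda>x. x * 2) ` {h div 2<..h}"
      then obtain x where x: "y = x * 2" "h div 2 < x" "x \<le> h" by auto
      moreover have "0 < x" "h < x * 2" using x h(2) by presburger+
      ultimately show "y \<in> G.E" unfolding G.E_def C h_def[symmetric] by auto
    qed
  qed
  then have card: "card G.E = nat (h - h div 2)" by (simp add: card_image inj_on_def)
  have "even (nat (h - h div 2)) \<longleftrightarrow> even (h - h div 2)" using h(2) by (simp add: even_nat_iff)
  also have "\<dots> \<longleftrightarrow> (h mod 4 = 0 \<or> h mod 4 = 3)" by presburger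
  finally have "even (nat (h - h div 2)) \<longleftrightarrow> (h mod 4 = 0 \<or> h mod 4 = 3)" .
  moreover have "(h mod 4 = 0 \<or> h mod 4 = 3) \<longleftrightarrow> (int p mod 8 = 1 \<or> int p mod 8 = 7)"
  proof -
    have "(2 * h + 1) mod 8 = 2 * (h mod 4) + 1" 
    proof -
      have "2 * h + 1 = (2 * (h mod 4) + 1) + 8 * (h div 4)" using div_mult_mod_eq[of h 4] by linarith
      then have "(2 * h + 1) mod 8 = (2 * (h mod 4) + 1) mod 8" by (metis mod_mult_self2)
      also have "\<dots> = 2 * (h mod 4) + 1"
        using pos_mod_bound[of 4 h] pos_mod_sign[of 4 h] by (intro mod_pos_pos_trivial) linarith+
      finally show ?thesis .
    qed
    then have eq: "int p mod 8 = 2 * (h mod 4) + 1" unfolding h(1) .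
    show ?thesis unfolding eq by auto
  qed
  moreover have "int p mod 8 = int (p mod 8)" by (simp add: of_nat_mod)
  then have "(int p mod 8 = 1 \<or> int p mod 8 = 7) \<longleftrightarrow> (p mod 8 = 1 \<or> p mod 8 = 7)" by auto
  ultimately show ?thesis using G.gauss_lemma card by (simp add: minus_one_power_iff)
qed

lemma coprime_mult_square:
  fixes m n b :: nat
  assumes "coprime m n" "m * n = b * b" "m > 0" "n > 0"
  shows "\<exists>u v. m = u * u \<and> n = v * v"
proof -
  have "is_nth_power 2 (m * n)" using assms(2) by (auto simp: is_nth_power_def power2_eq_square)
  then have "is_nth_power 2 m" "is_nth_power 2 n"
    using is_nth_power_mult_coprime_natD[OF assms(1) _ assms(3,4)] by auto
  then show ?thesis by (auto simp: is_nth_power_def power2_eq_square)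
qed

lemma nat_sq_mod8: "odd (x::nat) \<Longrightarrow> \<exists>e. x * x = 8 * e + 1"
proof -
  assume "odd x"
  then obtain k where k: "x = 2 * k + 1" by (auto elim: oddE)
  have "even (k * (k + 1))" by simp
  then obtain e where "k * (k + 1) = 2 * e" by (rule evenE)
  moreover have "x * x = 4 * (k * (k + 1)) + 1" unfolding k by (simp add: algebra_simps)
  ultimately show ?thesis by auto
qed

lemma nat_sq_even: "even (x::nat) \<Longrightarrow> \<exists>e. x * x = 4 * e"
proof -
  assume "even x"
  then obtain k where k: "x = 2 * k" by (auto elim: evenE)
  then have "x * x = 4 * (k * k)" by simp
  then show ?thesis by blast
qed

section \<open>Small norms from the quadratic field and the descent on Pell's equation\<close>

context prime7
begin

lemma p_nat_form: "\<exists>q. p = 16 * q + 7"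
  using p_mod by (intro exI[of _ "p div 16"]) presburger

lemma p_nat_sq_odd: "odd (x::nat) \<Longrightarrow> \<exists>e. p * (x * x) = 8 * e + 7"
proof -
  assume "odd x"
  then obtain e where e: "x * x = 8 * e + 1" using nat_sq_mod8 by blast
  obtain q where "p = 16 * q + 7" using p_nat_form by blast
  then have "p * (x * x) = 8 * (p * e + 2 * q) + 7" unfolding e by (simp add: algebra_simps)
  then show ?thesis by blast
qed

lemma p_nat_sq_even: "even (x::nat) \<Longrightarrow> \<exists>e. p * (x * x) = 4 * e"
proof -
  assume "even x"
  then obtain e where e: "x * x = 4 * e" using nat_sq_even by blast
  then have "p * (x * x) = 4 * (p * e)" by simp
  then show ?thesis by blast
qed

lemma p_odd: "odd p" using p_mod by presburger

text \<open>As \<open>p\<close> is 7 modulo 8, comparing squares modulo 4 and 8 excludes the norm -1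
  here and -2 in \<open>not_norm_m2\<close>. These are the factorisations that
  \<open>pell_step\<close> has to discard.\<close>

lemma not_norm_m1: "x * x + 1 \<noteq> p * (y * y)"
proof
  assume eq: "x * x + 1 = p * (y * y)"
  consider e where "x * x = 8 * e + 1" | e where "x * x = 4 * e" using nat_sq_mod8 nat_sq_even by blast
  then show False
  proof cases
    case 1
    consider f where "p * (y * y) = 8 * f + 7" | f where "p * (y * y) = 4 * f" using p_nat_sq_odd p_nat_sq_even by blast
    then show False using 1 eq by cases presburger+
  next
    case 2
    consider f where "p * (y * y) = 8 * f + 7" | f where "p * (y * y) = 4 * f" using p_nat_sq_odd p_nat_sq_even by blast
    then show False using 2 eq by cases presburger+
  qed
qed

lemma not_norm_m2: "x * x + 2 \<noteq> p * (y * y)"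
proof
  assume eq: "x * x + 2 = p * (y * y)"
  consider e where "x * x = 8 * e + 1" | e where "x * x = 4 * e" using nat_sq_mod8 nat_sq_even by blast
  then show False
  proof cases
    case 1
    consider f where "p * (y * y) = 8 * f + 7" | f where "p * (y * y) = 4 * f" using p_nat_sq_odd p_nat_sq_even by blast
    then show False using 1 eq by cases presburger+
  next
    case 2
    consider f where "p * (y * y) = 8 * f + 7" | f where "p * (y * y) = 4 * f" using p_nat_sq_odd p_nat_sq_even by blast
    then show False using 2 eq by cases presburger+
  qed
qed

text \<open>Of two coprime factors of \<open>p * b^2\<close> one absorbs \<open>p\<close>, and what
  remains on both sides is a square.\<close>

lemma split_p:
  fixes m n b :: nat
  assumes "coprime m n" "m * n = p * (b * b)" "m > 0" "n > 0"
  shows "(\<exists>u v. m = p * (u * u) \<and> n = v * v \<and> u * v = b) \<or> (\<exists>u v. m = u * u \<and> n = p * (v * v) \<and> u * v = b)"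
proof -
  have *: "\<exists>u v. m = p * (u * u) \<and> n = v * v \<and> u * v = b"
    if mn: "coprime m n" "m * n = p * (b * b)" "m > 0" "n > 0" "p dvd m" for m n
  proof -
    obtain m' where m': "m = p * m'" using mn(5) by blast
    then have "m' * n = b * b" using mn(2) p_pos by simp
    moreover have "coprime m' n" using mn(1) m' by simp
    ultimately obtain u v where uv: "m' = u * u" "n = v * v"
      using coprime_mult_square[of m' n b] m' mn by auto
    then have "(u * v) * (u * v) = b * b" using \<open>m' * n = b * b\<close> by (simp add: mult_ac)
    then have "u * v = b" by (metis power2_eq_square power2_eq_iff_nonneg zero_le)
    then show ?thesis using uv m' by blast
  qed
  have "p dvd m * n" using assms(2) by simp
  then consider "p dvd m" | "p dvd n" using p_prime by (meson prime_dvd_mult_iff)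
  then show ?thesis
  proof cases
    case 1
    then show ?thesis using *[OF assms] by blast
  next
    case 2
    moreover have "coprime n m" "n * m = p * (b * b)" using assms by (simp_all add: coprime_commute mult.commute[of n])
    ultimately obtain u v where "n = p * (u * u)" "m = v * v" "u * v = b"
      using *[of n m] assms(3,4) by blast
    then show ?thesis by (metis mult.commute)
  qed
qed

text \<open>Factor \<open>(a - 1) * (a + 1) = p * b^2\<close>; the factors are coprime if
  \<open>a\<close> is even, and their halves are if \<open>a\<close> is odd. In terms of
  \<open>w = x + y s\<close>, the first alternative says \<open>w * w = 2 * (a + b s)\<close> and
  the second \<open>w * w = a + b s\<close>.\<close>

lemma pell_step:
  fixes a b :: nat
  assumes ab: "a * a = p * (b * b) + 1" and a1: "a > 1"
  shows "(\<exists>x y. x * x = p * (y * y) + 2 \<and> x * y = b \<and> a + 1 = x * x) \<or>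
    (\<exists>x y. x * x = p * (y * y) + 1 \<and> 2 * x * y = b \<and> a + 1 = 2 * (x * x))"
proof (cases "even a")
  case True
  obtain c where c: "a = Suc c" using a1 by (cases a) auto
  have "odd c" using True c by simp
  have "c * (c + 2) = p * (b * b)" using ab unfolding c by (simp add: algebra_simps)
  moreover have "coprime c (c + 2)" 
  proof (rule coprimeI)
    fix d assume d: "d dvd c" "d dvd c + 2"
    then have "d dvd 2" using dvd_add_right_iff by blast
    then have "d \<le> 2" using dvd_imp_le[of d 2] by auto
    moreover have "d \<noteq> 0" using d \<open>odd c\<close> by (metis dvd_0_left even_zero)
    moreover have "d \<noteq> 2" using d \<open>odd c\<close> by blast
    ultimately have "d = 1" by linarith
    then show "is_unit d" by simp
  qed
  moreover have "c > 0" using a1 c by simp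
  ultimately consider u v where "c = p * (u * u)" "c + 2 = v * v" "u * v = b"
    | u v where "c = u * u" "c + 2 = p * (v * v)" using split_p[of c "c + 2" b] by auto
  then show ?thesis
  proof cases
    case 1
    then have "v * v = p * (u * u) + 2" "v * u = b" "a + 1 = v * v" using c mult.commute[of v u] by simp_all
    then show ?thesis by blast
  next
    case 2
    then show ?thesis using not_norm_m2[of u v] by simp
  qed
next
  case False
  then obtain e where e: "a = 2 * e + 1" by (auto elim: oddE)
  have "p * (b * b) = 4 * (e * (e + 1))" using ab unfolding e by (simp add: algebra_simps)
  then have "even (p * (b * b))" by simp
  then have "even b" using p_odd by simp
  then obtain b' where b': "b = 2 * b'" by (auto elim: evenE)
  have "e * (e + 1) = p * (b' * b')" using \<open>p * (b * b) = 4 * (e * (e + 1))\<close> unfolding b' by simp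
  moreover have "e > 0" using a1 e by simp
  ultimately consider u v where "e = p * (u * u)" "e + 1 = v * v" "u * v = b'"
    | u v where "e = u * u" "e + 1 = p * (v * v)" using split_p[of e "e + 1" b'] by auto
  then show ?thesis
  proof cases
    case 1
    then have "v * v = p * (u * u) + 1" "2 * v * u = b" "a + 1 = 2 * (v * v)" using e b' mult.commute[of v u] by simp_all
    then show ?thesis by blast
  next
    case 2
    then show ?thesis using not_norm_m1[of u v] by simp
  qed
qed

text \<open>The second alternative of \<open>pell_step\<close> is a smaller solution of Pell's
  equation, so the descent ends in the first one, an element of norm 2.\<close>

lemma norm_2_if_pell:
  fixes a b :: nat
  assumes ab: "a * a = p * (b * b) + 1" and b0: "b > 0"
  shows "\<exists>x y. x * x = p * (y * y) + 2"
  using assms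
proof (induction b arbitrary: a rule: less_induct)
  case (less b)
  have "a > 1"
  proof (rule ccontr)
    assume "\<not> a > 1"
    then have "a = 0 \<or> a = 1" by auto
    then show False using less.prems p_pos by auto
  qed
  with less.prems(1) consider x y where "x * x = p * (y * y) + 2" | x y where "x * x = p * (y * y) + 1" "2 * x * y = b"
    using pell_step by blast
  then show ?case
  proof cases
    case 2
    then have "y > 0" "x > 0" using less.prems by auto
    moreover have "1 * y \<le> x * y" using \<open>x > 0\<close> by (intro mult_right_mono) auto
    moreover have "2 * (x * y) = b" using 2 by simp
    ultimately have "y < b" by linarith
    then show ?thesis using less.IH[OF _ 2(1)] \<open>y > 0\<close> by blast
  qed blast
qed

section \<open>Legendre symbols at divisors of a solution of \<open>x^2 = p y^2 + 2\<close>\<close>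

lemma norm_2_odd:
  fixes x y :: nat
  assumes "x * x = p * (y * y) + 2"
  shows "odd x \<and> odd y"
proof -
  have "even x \<longleftrightarrow> even y"
  proof -
    have "even (x * x) \<longleftrightarrow> even (p * (y * y))" unfolding assms by simp
    then show ?thesis using p_odd by simp
  qed
  moreover have "\<not> (even x \<and> even y)"
  proof
    assume "even x \<and> even y"
    then obtain e f where "x * x = 4 * e" "p * (y * y) = 4 * f" using nat_sq_even p_nat_sq_even by blast
    then show False using assms by presburger
  qed
  ultimately show ?thesis by blast
qed

text \<open>Modulo \<open>r\<close> the equation reads \<open>- p * y^2 = 2\<close>, so 2 and
  \<open>- p\<close> have the same symbol modulo \<open>r\<close>. Because \<open>p\<close> is 3
  modulo 4, reciprocity turns the symbol of \<open>- p\<close> modulo \<open>r\<close> into that of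
  \<open>r\<close> modulo \<open>p\<close>.\<close>

lemma Legendre_prime_factor:
  fixes x y r :: nat
  assumes xy: "x * x = p * (y * y) + 2" and r: "prime r" "r dvd x"
  shows "2 < r" "Legendre (int r) (int p) = Legendre 2 (int r)"
proof -
  have odd: "odd x" "odd y" using norm_2_odd[OF xy] by auto
  have "r \<noteq> 2" using r odd by auto
  then show r2: "2 < r" using r(1) prime_ge_2_nat[of r] by simp
  have p2: "2 < p" using p_nat_form by auto
  have nr2: "\<not> r dvd 2" using r2 by (simp add: nat_dvd_not_less)
  have rp: "r \<noteq> p"
  proof
    assume "r = p"
    then have "p dvd x * x" using r by simp
    then have "p dvd p * (y * y) + 2" unfolding xy .
    then have "p dvd 2" using dvd_add_right_iff dvd_triv_left by blast
    then show False using p2 by (simp add: nat_dvd_not_less)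
  qed
  have ry: "\<not> int r dvd int y"
  proof
    assume "int r dvd int y"
    then have "r dvd y" by simp
    then have "r dvd p * (y * y)" by simp
    moreover have "r dvd p * (y * y) + 2" unfolding xy[symmetric] using r by simp
    ultimately have "r dvd 2" using dvd_add_right_iff by blast
    then show False using nr2 by blast
  qed
  have Ly: "Legendre (int y * int y) (int r) = 1"
    using ry r(1) by (auto simp: Legendre_def cong_0_iff QuadRes_def power2_eq_square prime_dvd_mult_iff
        intro: exI[of _ "int y"])
  have c: "[- int p * (int y * int y) = 2] (mod int r)"
  proof -
    have "int r dvd int x * int x" using r by simp
    also have "int x * int x = int p * (int y * int y) + 2"
      using xy by (metis of_nat_add of_nat_mult of_nat_numeral)
    also have "\<dots> = - (- int p * (int y * int y) - 2)" by simp
    finally show ?thesis by (simp only: cong_iff_dvd_diff dvd_minus_iff)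
  qed
  have Lc: "Legendre a (int r) = Legendre b (int r)" if "[a = b] (mod int r)" for a b
  proof -
    have "[x = a] (mod int r) \<longleftrightarrow> [x = b] (mod int r)" for x using that unfolding cong_def by simp
    moreover have "[a = 0] (mod int r) \<longleftrightarrow> [b = 0] (mod int r)" using that unfolding cong_def by simp
    ultimately show ?thesis unfolding Legendre_def QuadRes_def by presburger
  qed
  have "Legendre 2 r = Legendre (- int p * (int y * int y)) r" using Lc[OF c] by simp
  also have "\<dots> = Legendre (- int p) r" unfolding Legendre_mult[OF r(1) r2, of "- int p"] Ly by simp
  also have "\<dots> = Legendre (-1) r * Legendre (int p) r"
    using Legendre_mult[OF r(1) r2, of "-1" "int p"] by simp
  also have "\<dots> = (-1) ^ ((r - 1) div 2) * Legendre (int p) r" by (simp add: Legendre_minus_1[OF r(1) r2])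
  \<comment> \<open>The exponent \<open>(p - 1) div 2\<close> is odd, so the sign in the reciprocity
    law is precisely the symbol of -1 modulo \<open>r\<close>.\<close>
  also have "(-1::int) ^ ((r - 1) div 2) = Legendre p r * Legendre r p"
  proof -
    obtain q where "p = 16 * q + 7" using p_nat_form by blast
    then have "odd ((p - 1) div 2)" by simp
    then have "(-1::int) ^ ((p - 1) div 2 * ((r - 1) div 2)) = (-1) ^ ((r - 1) div 2)"
      by (simp add: power_mult)
    then show ?thesis using Quadratic_Reciprocity[OF p_prime p2 r(1) r2 rp[symmetric]] by simp
  qed
  finally have 1: "Legendre 2 r = (Legendre p r * Legendre p r) * Legendre r p" by (simp add: mult_ac)
  have "Legendre p r \<noteq> 0"
  proof -
    have "\<not> int r dvd int p" using primes_dvd_imp_eq[OF r(1) p_prime] rp by auto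
    then show ?thesis by (simp add: Legendre_def cong_0_iff)
  qed
  then have "Legendre p r * Legendre p r = 1" using Legendre_values[of p r] by auto
  then show "Legendre (int r) (int p) = Legendre 2 (int r)" using 1 by simp
qed

text \<open>Modulo a prime divisor of \<open>y\<close> the equation makes 2 a square, so such a
  prime is 1 or 7 modulo 8, and these classes are closed under products.\<close>

lemma norm_2_y_mod8:
  fixes x y n :: nat
  assumes xy: "x * x = p * (y * y) + 2" and n: "n dvd y"
  shows "n mod 8 = 1 \<or> n mod 8 = 7"
  using n
proof (induction n rule: prime_divisors_induct)
  case zero
  then show ?case using norm_2_odd[OF xy] by auto
next
  case (unit n)
  then show ?case by simp
next
  case (factor r n)
  have r: "r dvd y" "n dvd y" using factor.prems by (auto dest: dvd_mult_left dvd_mult_right)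
  have "odd r" using r norm_2_odd[OF xy] by (meson dvd_trans)
  then have r2: "2 < r" using factor.hyps prime_ge_2_nat[of r] by (metis even_numeral le_neq_implies_less)
  have "[int x ^ 2 = 2] (mod int r)"
  proof -
    have "int x ^ 2 - 2 = int p * (int y * int y)"
      using xy by (metis add_diff_cancel_right' of_nat_add of_nat_mult of_nat_numeral power2_eq_square)
    then show ?thesis using r by (simp add: cong_iff_dvd_diff)
  qed
  moreover have "\<not> int r dvd 2" using r2 by (metis of_nat_dvd_iff of_nat_numeral nat_dvd_not_less zero_less_numeral)
  ultimately have "Legendre 2 r = 1" by (auto simp: Legendre_def QuadRes_def cong_0_iff)
  then have "r mod 8 = 1 \<or> r mod 8 = 7" using Legendre_2[OF factor.hyps r2] by (auto split: if_splits)
  moreover have "n mod 8 = 1 \<or> n mod 8 = 7" using factor.IH r by blast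
  ultimately have "(r mod 8) * (n mod 8) mod 8 = 1 \<or> (r mod 8) * (n mod 8) mod 8 = 7" by auto
  then show ?case by (simp add: mod_mult_eq)
qed

text \<open>The right side is the quadratic character of 2, multiplicative on odd numbers;
  \<open>Legendre_prime_factor\<close> and \<open>Legendre_2\<close> give agreement at the prime
  divisors of \<open>x\<close>.\<close>

lemma norm_2_Legendre:
  fixes x y n :: nat
  assumes xy: "x * x = p * (y * y) + 2" and n: "n dvd x"
  shows "Legendre (int n) (int p) = (if n mod 8 = 1 \<or> n mod 8 = 7 then 1 else -1)"
  using n
proof (induction n rule: prime_divisors_induct)
  case zero
  then show ?case using norm_2_odd[OF xy] by auto
next
  case (unit n)
  have "\<not> int p dvd 1" using int_prime by (simp add: prime_int_iff)
  then have "Legendre 1 (int p) = 1" by (auto simp: Legendre_def QuadRes_def cong_0_iff intro!: exI[of _ 1])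
  then show ?case using unit by simp
next
  case (factor r n)
  have r: "r dvd x" "n dvd x" using factor.prems by (auto dest: dvd_mult_left dvd_mult_right)
  have "odd r" "odd n" using r norm_2_odd[OF xy] by (meson dvd_trans)+
  then have m: "r mod 8 \<in> {1, 3, 5, 7}" "n mod 8 \<in> {1, 3, 5, 7}" by (simp; presburger)+
  have p2: "2 < p" using p_nat_form by auto
  have "Legendre (int (r * n)) p = Legendre r p * Legendre n p"
    using Legendre_mult[OF p_prime p2] by simp
  also have "Legendre r p = (if r mod 8 = 1 \<or> r mod 8 = 7 then 1 else -1)"
    using Legendre_prime_factor[OF xy factor.hyps r(1)] Legendre_2[OF factor.hyps] by simp
  also have "Legendre n p = (if n mod 8 = 1 \<or> n mod 8 = 7 then 1 else -1)"
    using factor.IH r by blast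
  finally have 1: "Legendre (int (r * n)) p = (if r mod 8 = 1 \<or> r mod 8 = 7 then 1 else -1) * (if n mod 8 = 1 \<or> n mod 8 = 7 then 1 else -1)" .
  have "(r * n) mod 8 = (r mod 8) * (n mod 8) mod 8" by (simp add: mod_mult_eq)
  then show ?case unfolding 1 using m by auto
qed

text \<open>\<open>y\<close> is 1 or 7 modulo 8, so \<open>y * y\<close> is 1 modulo 16 and
  \<open>x * x\<close> is \<open>7 + 2 = 9\<close> modulo 16. Hence \<open>x\<close> is 3 or 5
  modulo 8 and its symbol is -1. With 15 in place of 7 it would be 1.\<close>

lemma norm_2_nonresidue:
  fixes x y :: nat
  assumes xy: "x * x = p * (y * y) + 2"
  shows "\<not> QuadRes (int p) (int x)"
proof -
  obtain q where q: "p = 16 * q + 7" using p_nat_form by blast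
  have y: "y mod 8 = 1 \<or> y mod 8 = 7" using norm_2_y_mod8[OF xy] by simp
  then obtain k where "y = 8 * k + 1 \<or> y = 8 * k + 7"
    by (metis mult_div_mod_eq)
  then have "\<exists>e. y * y = 16 * e + 1"
  proof
    assume "y = 8 * k + 1"
    then have "y * y = 16 * (4 * k * k + k) + 1" by (simp add: algebra_simps)
    then show ?thesis by blast
  next
    assume "y = 8 * k + 7"
    then have "y * y = 16 * (4 * k * k + 7 * k + 3) + 1" by (simp add: algebra_simps)
    then show ?thesis by blast
  qed
  then obtain e where e: "y * y = 16 * e + 1" by blast
  have "x * x = 16 * (p * e + q) + 9" unfolding xy e using q by (simp add: algebra_simps)
  then have x16: "(x * x) mod 16 = 9" by presburger
  have "\<not> (x mod 8 = 1 \<or> x mod 8 = 7)"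
  proof
    assume "x mod 8 = 1 \<or> x mod 8 = 7"
    then obtain k where "x = 8 * k + 1 \<or> x = 8 * k + 7" by (metis mult_div_mod_eq)
    then have "(x * x) mod 16 = 1"
    proof
      assume "x = 8 * k + 1"
      then have "x * x = 16 * (4 * k * k + k) + 1" by (simp add: algebra_simps)
      then show ?thesis by presburger
    next
      assume "x = 8 * k + 7"
      then have "x * x = 16 * (4 * k * k + 7 * k + 3) + 1" by (simp add: algebra_simps)
      then show ?thesis by presburger
    qed
    then show False using x16 by simp
  qed
  then have "Legendre (int x) (int p) = -1" using norm_2_Legendre[OF xy, of x] by simp
  then show ?thesis by (auto simp: Legendre_def split: if_splits)
qed

text \<open>The equations say that \<open>(x + y s) * z^2\<close> is the relative norm of
  \<open>(a0 + a1 s) + (b0 + b1 s) \<theta>\<close>. Modulo \<open>p\<close> the first reads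
  \<open>x * z^2 = a0^2\<close>. If \<open>p\<close> divides \<open>z\<close>, it divides all four
  coordinates, and dividing the equations by \<open>p^2\<close> gives a descent.\<close>

lemma relative_norm_residue:
  fixes x y z a0 a1 b0 b1 :: int
  assumes "x * (z * z) = a0 * a0 + int p * (a1 * a1) - 2 * (int p * (b0 * b1))"
    "y * (z * z) = 2 * (a0 * a1) - b0 * b0 - int p * (b1 * b1)" "z \<noteq> 0"
  shows "QuadRes (int p) x"
  using assms
proof (induction "nat \<bar>z\<bar>" arbitrary: z a0 a1 b0 b1 rule: less_induct)
  case less
  note e1 = less.prems(1) and e2 = less.prems(2)
  define P where "P = int p"
  have P: "prime P" using int_prime by (simp add: P_def)
  note e1 = e1[folded P_def] and e2 = e2[folded P_def]
  show ?case
  proof (cases "P dvd z")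
    case False
    then have "coprime P z" using P by (simp add: prime_imp_coprime)
    then obtain w where w: "[z * w = 1] (mod P)" using cong_solve_coprime_int[of z P] by (auto simp: coprime_commute)
    have "[a0 * a0 = x * (z * z)] (mod P)"
    proof -
      have "a0 * a0 - x * (z * z) = P * (2 * (b0 * b1) - a1 * a1)" unfolding e1 by (simp add: algebra_simps)
      then show ?thesis by (simp add: cong_iff_dvd_diff)
    qed
    then have "[(a0 * a0) * (w * w) = x * (z * z) * (w * w)] (mod P)" by (rule cong_scalar_right)
    moreover have "[x * ((z * w) * (z * w)) = x * (1 * 1)] (mod P)" by (intro cong_mult cong_refl w)
    ultimately have "[(a0 * w)^2 = x] (mod P)" by (simp add: power2_eq_square mult_ac cong_trans)
    then show ?thesis by (auto simp: QuadRes_def P_def)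
  next
    case True
    then obtain z' where z': "z = P * z'" by blast
    \<comment> \<open>The order \<open>a0\<close>, \<open>b0\<close>, \<open>a1\<close>,
      \<open>b1\<close> is that of the powers of \<open>\<theta>\<close> which they multiply:
      \<open>p\<close> is the fourth power of \<open>\<theta>\<close>, and divisibility by
      \<open>\<theta>\<close> is extracted four times.\<close>
    have "a0 * a0 = P * (x * (P * (z' * z')) - a1 * a1 + 2 * (b0 * b1))" using e1 unfolding z' by (simp add: algebra_simps)
    then have "P dvd a0" using P by (metis dvd_triv_left prime_dvd_mult_iff)
    then obtain a0' where a0: "a0 = P * a0'" by blast
    have "b0 * b0 = P * (2 * (a0' * a1) - b1 * b1 - y * (P * (z' * z')))" using e2 unfolding z' a0 by (simp add: algebra_simps)
    then have "P dvd b0" using P by (metis dvd_triv_left prime_dvd_mult_iff)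
    then obtain b0' where b0: "b0 = P * b0'" by blast
    have P0: "P \<noteq> 0" using P by auto
    have "P * (a1 * a1) = P * (P * (x * (z' * z') - a0' * a0' + 2 * (b0' * b1)))"
      using e1 unfolding z' a0 b0 by (simp add: algebra_simps)
    then have "a1 * a1 = P * (x * (z' * z') - a0' * a0' + 2 * (b0' * b1))" using P0 by simp
    then have "P dvd a1" using P by (metis dvd_triv_left prime_dvd_mult_iff)
    then obtain a1' where a1: "a1 = P * a1'" by blast
    have "P * (b1 * b1) = P * (P * (2 * (a0' * a1') - b0' * b0' - y * (z' * z')))"
      using e2 unfolding z' a0 b0 a1 by (simp add: algebra_simps)
    then have "b1 * b1 = P * (2 * (a0' * a1') - b0' * b0' - y * (z' * z'))" using P0 by simp
    then have "P dvd b1" using P by (metis dvd_triv_left prime_dvd_mult_iff)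
    then obtain b1' where b1: "b1 = P * b1'" by blast
    have z0: "z' \<noteq> 0" using less.prems(3) z' by auto
    have "(P * P) * (x * (z' * z')) = (P * P) * (a0' * a0' + P * (a1' * a1') - 2 * (P * (b0' * b1')))"
      using e1 unfolding z' a0 b0 a1 b1 by (simp add: algebra_simps)
    then have 1: "x * (z' * z') = a0' * a0' + P * (a1' * a1') - 2 * (P * (b0' * b1'))" using P0 by simp
    have "(P * P) * (y * (z' * z')) = (P * P) * (2 * (a0' * a1') - b0' * b0' - P * (b1' * b1'))"
      using e2 unfolding z' a0 b0 a1 b1 by (simp add: algebra_simps)
    then have 2: "y * (z' * z') = 2 * (a0' * a1') - b0' * b0' - P * (b1' * b1')" using P0 by simp
    have "1 < P" using P by (simp add: prime_int_iff)
    then have "\<bar>z'\<bar> < \<bar>z\<bar>" using z0 unfolding z' by (simp add: abs_mult)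
    then have "nat \<bar>z'\<bar> < nat \<bar>z\<bar>" by simp
    then show ?thesis using less.hyps[OF _ 1[unfolded P_def] 2[unfolded P_def] z0] by blast
  qed
qed

end

section \<open>Units of the quadratic field\<close>

text \<open>Otherwise \<open>\<mu>\<close> would take at most one positive value on each of the
  finitely many fibres of \<open>g\<close>, and the smallest of these could not be undercut. The
  strict inequality in the conclusion later keeps the units nontrivial.\<close>

lemma small_pigeonhole:
  fixes \<mu> :: "'a \<Rightarrow> real"
  assumes small: "\<And>\<epsilon>. \<epsilon> > 0 \<Longrightarrow> \<exists>z\<in>S. 0 < \<mu> z \<and> \<mu> z < \<epsilon>" and fin: "finite (g ` S)"
  shows "\<exists>z\<in>S. \<exists>w\<in>S. g z = g w \<and> 0 < \<mu> z \<and> \<mu> z < \<mu> w"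
proof (rule ccontr)
  assume neg: "\<not> ?thesis"
  define T where "T = {z \<in> S. 0 < \<mu> z}"
  have const: "\<mu> z = \<mu> w" if "z \<in> T" "w \<in> T" "g z = g w" for z w
    using neg that unfolding T_def by (metis (mono_tags, lifting) linorder_neq_iff mem_Collect_eq)
  have "finite (g ` T)" using fin by (rule finite_subset[rotated]) (auto simp: T_def)
  moreover have "\<mu> ` T \<subseteq> (\<lambda>c. \<mu> (SOME z. z \<in> T \<and> g z = c)) ` g ` T"
  proof
    fix x assume "x \<in> \<mu> ` T"
    then obtain z where z: "z \<in> T" "x = \<mu> z" by auto
    define w where "w = (SOME w. w \<in> T \<and> g w = g z)"
    have "w \<in> T \<and> g w = g z" unfolding w_def by (rule someI[of _ z]) (use z in simp)
    then have "x = \<mu> w" using z const by metis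
    then show "x \<in> (\<lambda>c. \<mu> (SOME z. z \<in> T \<and> g z = c)) ` g ` T" using z by (auto simp: w_def)
  qed
  ultimately have finT: "finite (\<mu> ` T)" by (meson finite_imageI finite_subset)
  obtain z0 where "z0 \<in> T" using small[of 1] by (auto simp: T_def)
  then have "Min (\<mu> ` T) \<in> \<mu> ` T" using finT by (intro Min_in) auto
  then have "0 < Min (\<mu> ` T)" by (auto simp: T_def)
  then obtain z where "z \<in> T" "\<mu> z < Min (\<mu> ` T)" using small by (auto simp: T_def)
  then show False using finT by (meson Min_le image_eqI not_le)
qed

lemma box_pigeonhole:
  fixes f :: "'a \<Rightarrow> real"
  assumes fin: "finite I" and m: "0 < m" "m < card I" and L: "0 < L"
    and f: "\<And>i. i \<in> I \<Longrightarrow> 0 \<le> f i \<and> f i < L"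
  shows "\<exists>i\<in>I. \<exists>j\<in>I. i \<noteq> j \<and> \<bar>f i - f j\<bar> < L / real m"
proof -
  define c where "c = (\<lambda>i. nat \<lfloor>f i * real m / L\<rfloor>)"
  have "c ` I \<subseteq> {..<m}"
  proof
    fix x assume "x \<in> c ` I"
    then obtain i where i: "i \<in> I" "x = c i" by auto
    have "0 \<le> f i * real m / L" "f i * real m / L < real m"
      using f[OF i(1)] L m by (auto simp: field_simps)
    then show "x \<in> {..<m}" unfolding i(2) c_def by (simp add: nat_less_iff floor_less_iff)
  qed
  then have "card (c ` I) \<le> m" using card_mono[of "{..<m}" "c ` I"] by simp
  then have "\<not> inj_on c I" using m pigeonhole[of c I] by linarith
  then obtain i j where ij: "i \<in> I" "j \<in> I" "i \<noteq> j" "c i = c j" by (auto simp: inj_on_def)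
  have "0 \<le> \<lfloor>f i * real m / L\<rfloor>" "0 \<le> \<lfloor>f j * real m / L\<rfloor>"
    using f[OF ij(1)] f[OF ij(2)] L by auto
  then have "\<lfloor>f i * real m / L\<rfloor> = \<lfloor>f j * real m / L\<rfloor>"
    using ij(4) unfolding c_def by (simp add: nat_eq_iff)
  then have "\<bar>f i * real m / L - f j * real m / L\<bar> < 1" by linarith
  moreover have "f i * real m / L - f j * real m / L = (f i - f j) * (real m / L)"
    by (simp add: algebra_simps diff_divide_distrib)
  ultimately have "\<bar>f i - f j\<bar> * (real m / L) < 1" using m L by (simp add: abs_mult)
  then have "\<bar>f i - f j\<bar> < L / real m" using m L by (simp add: field_simps)
  then show ?thesis using ij by blast
qed

context prime7
begin

lemma s_ge_1: "1 \<le> s"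
  using p_pos by (simp add: s_def)

lemma k_norm: "(of_int a + of_int b * s) * k.cj (of_int a + of_int b * s) = of_int (a * a - int p * (b * b))"
proof -
  have "k.cj (of_int a + of_int b * s) = of_int a - of_int b * s" by (rule k.cj_rep) auto
  then show ?thesis by (simp only:) (simp add: algebra_simps s_sq[symmetric])
qed

text \<open>Dirichlet's proof: there are arbitrarily small elements of bounded norm, and two of them
  with equal norm \<open>n\<close> and congruent coordinates modulo \<open>n\<close> have a unit of
  norm 1 as quotient.\<close>

lemma pell_exists: "\<exists>a b :: int. a * a - int p * (b * b) = 1 \<and> b \<noteq> 0"
proof -
  define val where "val = (\<lambda>(a, b). real_of_int a + of_int b * s)"
  define N where "N = (\<lambda>(a, b). a * a - int p * (b * b))"
  \<comment> \<open>An element of absolute value below \<open>1 / M\<close> with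
    \<open>\<bar>b\<bar> \<le> M\<close> has norm at most
    \<open>1 / M * (1 / M + 2 * M * s)\<close>, which stays below this bound for every
    \<open>M\<close>.\<close>
  define S where "S = {q. \<bar>real_of_int (N q)\<bar> \<le> 1 + 2 * s}"
  define g where "g = (\<lambda>q. (N q, fst q mod N q, snd q mod N q))"
  define C where "C = \<lceil>1 + 2 * s\<rceil>"
  have "\<exists>z\<in>S. \<exists>w\<in>S. g z = g w \<and> 0 < \<bar>val z\<bar> \<and> \<bar>val z\<bar> < \<bar>val w\<bar>"
  proof (rule small_pigeonhole)
    fix \<epsilon> :: real assume "\<epsilon> > 0"
    then obtain M :: nat where M: "M > 0" "1 / real M < \<epsilon>"
      by (metis ex_inverse_of_nat_less inverse_eq_divide)
    have "\<exists>i\<in>{0..M}. \<exists>j\<in>{0..M}. i \<noteq> j \<and> \<bar>frac (real i * s) - frac (real j * s)\<bar> < 1 / real M"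
      using M by (intro box_pigeonhole) (auto simp: frac_ge_0 frac_lt_1)
    then obtain i j where ij: "i \<le> M" "j \<le> M" "i \<noteq> j" "\<bar>frac (real i * s) - frac (real j * s)\<bar> < 1 / real M" by auto
    define b where "b = int i - int j"
    define a where "a = \<lfloor>real j * s\<rfloor> - \<lfloor>real i * s\<rfloor>"
    have v: "val (a, b) = frac (real i * s) - frac (real j * s)"
      by (simp add: val_def a_def b_def frac_def algebra_simps)
    have b: "b \<noteq> 0" "\<bar>real_of_int b\<bar> \<le> real M" using ij by (auto simp: b_def)
    have v0: "val (a, b) \<noteq> 0"
    proof
      assume "val (a, b) = 0"
      then have "real_of_int a + of_int b * s = of_int 0 + of_int 0 * s" by (simp add: val_def)
      then show False using k_rep_of_int(2) b by blast
    qed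
    have "real_of_int (N (a, b)) = val (a, b) * (val (a, b) - 2 * of_int b * s)"
      by (simp add: N_def val_def algebra_simps s_sq[symmetric])
    also have "\<bar>\<dots>\<bar> \<le> (1 / real M) * (1 / real M + 2 * real M * s)"
    proof -
      have "\<bar>val (a, b) - 2 * of_int b * s\<bar> \<le> \<bar>val (a, b)\<bar> + \<bar>2 * of_int b * s\<bar>" by (rule abs_triangle_ineq4)
      also have "\<bar>2 * of_int b * s\<bar> \<le> 2 * real M * s" using b s_pos by (simp add: abs_mult)
      finally have "\<bar>val (a, b) - 2 * of_int b * s\<bar> \<le> 1 / real M + 2 * real M * s" using ij v by linarith
      then show ?thesis unfolding abs_mult using ij v by (intro mult_mono) auto
    qed
    also have "\<dots> = 1 / (real M * real M) + 2 * s" using M by (simp add: field_simps)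
    also have "\<dots> \<le> 1 + 2 * s"
    proof -
      have "1 * 1 \<le> real M * real M" using M by (intro mult_mono) auto
      then show ?thesis by (simp add: divide_le_eq_1)
    qed
    finally have "(a, b) \<in> S" by (simp add: S_def)
    then show "\<exists>z\<in>S. 0 < \<bar>val z\<bar> \<and> \<bar>val z\<bar> < \<epsilon>"
      using v0 v ij M by (intro bexI[of _ "(a, b)"]) auto
  next
    have "g ` S \<subseteq> {-C..C} \<times> {-C..C} \<times> {-C..C}"
    proof
      fix x assume "x \<in> g ` S"
      then obtain q where q: "q \<in> S" "x = g q" by auto
      have "real_of_int \<bar>N q\<bar> \<le> 1 + 2 * s" using q by (simp add: S_def)
      also have "\<dots> \<le> of_int C" by (simp add: C_def)
      finally have n: "\<bar>N q\<bar> \<le> C" by (simp only: of_int_le_iff)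
      have "N q \<noteq> 0 \<Longrightarrow> \<bar>y mod N q\<bar> \<le> C" for y
        using n abs_mod_less[of "N q" y] by linarith
      moreover have "N q \<noteq> 0 \<or> q = (0, 0)"
      proof (cases q)
        case (Pair a b)
        show ?thesis
        proof (cases "N q = 0")
          case True
          then have "(of_int a + of_int b * s) * k.cj (of_int a + of_int b * s) = 0"
            unfolding k_norm using Pair by (simp add: N_def)
          then have "real_of_int a + of_int b * s = of_int 0 + of_int 0 * s"
            using k.cj_nz[OF k.B_in_E[OF o_I]] by (metis add.right_neutral mult_eq_0_iff mult_zero_left of_int_0)
          then show ?thesis using k_rep_of_int Pair by blast
        qed simp
      qed
      ultimately have "\<bar>fst q mod N q\<bar> \<le> C" "\<bar>snd q mod N q\<bar> \<le> C" using n by auto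
      then show "x \<in> {-C..C} \<times> {-C..C} \<times> {-C..C}" using n q by (auto simp: g_def abs_le_iff)
    qed
    then show "finite (g ` S)" by (rule finite_subset) simp
  qed
  then obtain a b c d where ab: "g (a, b) = g (c, d)" "0 < \<bar>val (a, b)\<bar>" "\<bar>val (a, b)\<bar> < \<bar>val (c, d)\<bar>" by auto
  define n where "n = N (c, d)"
  have n: "a * a - int p * (b * b) = n" "c * c - int p * (d * d) = n" and m: "a mod n = c mod n" "b mod n = d mod n"
    using ab(1) by (auto simp: g_def N_def n_def)
  have n0: "n \<noteq> 0"
  proof
    assume "n = 0"
    then have "val (c, d) * k.cj (val (c, d)) = 0" using n unfolding val_def by (simp add: k_norm)
    moreover have "val (c, d) \<noteq> 0" using ab by auto
    ultimately show False using k.cj_nz[of "val (c, d)"] k.B_in_E[OF o_I] by (auto simp: val_def)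
  qed
  obtain e f where ef: "a = c + n * e" "b = d + n * f" using m by (metis mod_eqE mult.commute)
  \<comment> \<open>\<open>A + B s\<close> is the quotient of \<open>a + b s\<close> by
    \<open>c + d s\<close>: \<open>n\<close> times it is
    \<open>(a + b s) * (c - d s)\<close>.\<close>
  define A where "A = 1 + e * c - int p * (f * d)"
  define B where "B = f * c - e * d"
  have An: "a * c - int p * (b * d) = n * A"
  proof -
    have "a * c - int p * (b * d) = (c * c - int p * (d * d)) + n * (e * c - int p * (f * d))"
      unfolding ef by (simp add: algebra_simps)
    then show ?thesis unfolding n A_def by (simp add: algebra_simps)
  qed
  have Bn: "b * c - a * d = n * B" unfolding ef B_def by (simp add: algebra_simps)
  have "(n * n) * (A * A - int p * (B * B)) = (n * A) * (n * A) - int p * ((n * B) * (n * B))" by (simp add: algebra_simps)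
  also have "\<dots> = (a * a - int p * (b * b)) * (c * c - int p * (d * d))"
    unfolding An[symmetric] Bn[symmetric] by (simp add: algebra_simps)
  also have "\<dots> = (n * n) * 1" unfolding n by simp
  finally have AB: "A * A - int p * (B * B) = 1" using n0 by simp
  \<comment> \<open>If \<open>B\<close> vanished, the quotient would be 1 or -1 and the two absolute
    values would agree.\<close>
  have "B \<noteq> 0"
  proof
    assume "B = 0"
    then have "A * A = 1" using AB by simp
    then have A1: "\<bar>A\<bar> = 1" by (metis abs_mult_self_eq abs_1 zmult_eq_1_iff abs_minus_cancel)
    have "val (a, b) * (of_int c - of_int d * s) = of_int (a * c - int p * (b * d)) + of_int (b * c - a * d) * s"
      by (simp add: val_def algebra_simps s_sq[symmetric])
    also have "\<dots> = of_int n * of_int A" unfolding An Bn \<open>B = 0\<close> by simp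
    also have "of_int n = val (c, d) * (of_int c - of_int d * s)"
      unfolding n(2)[symmetric] by (simp add: val_def algebra_simps s_sq[symmetric])
    finally have "(of_int c - of_int d * s) * (val (a, b) - val (c, d) * of_int A) = 0" by (simp add: algebra_simps)
    moreover have "of_int c - of_int d * s \<noteq> 0"
    proof
      assume "of_int c - of_int d * s = 0"
      then have "real_of_int n = 0" using \<open>of_int n = val (c, d) * (of_int c - of_int d * s)\<close> by simp
      then show False using n0 by simp
    qed
    ultimately have "val (a, b) = val (c, d) * of_int A" by simp
    then have "\<bar>val (a, b)\<bar> = \<bar>val (c, d)\<bar> * of_int \<bar>A\<bar>" by (simp add: abs_mult)
    then show False using A1 ab by simp
  qed
  then show ?thesis using AB by blast
qed

lemma norm_2_exists: "\<exists>x y :: nat. x * x = p * (y * y) + 2"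
proof -
  obtain a b :: int where ab: "a * a - int p * (b * b) = 1" "b \<noteq> 0" using pell_exists by blast
  have "int (nat \<bar>a\<bar> * nat \<bar>a\<bar>) = int (p * (nat \<bar>b\<bar> * nat \<bar>b\<bar>) + 1)" using ab by simp
  then have "nat \<bar>a\<bar> * nat \<bar>a\<bar> = p * (nat \<bar>b\<bar> * nat \<bar>b\<bar>) + 1" by (simp only: of_nat_eq_iff)
  then show ?thesis using norm_2_if_pell[of "nat \<bar>a\<bar>" "nat \<bar>b\<bar>"] ab by simp
qed

text \<open>The norm of a unit is 1 or -1, and \<open>not_norm_m1\<close> excludes -1.\<close>

lemma o_unit_norm:
  assumes u: "u \<in> k.B" "u' \<in> k.B" "u * u' = 1"
  shows "u * k.cj u = 1"
proof -
  obtain a b where ab: "u = of_int a + of_int b * s" using u(1) by (rule o_cases)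
  obtain c d where cd: "u' = of_int c + of_int d * s" using u(2) by (rule o_cases)
  define m where "m = a * a - int p * (b * b)"
  define n where "n = c * c - int p * (d * d)"
  have m: "u * k.cj u = of_int m" unfolding ab k_norm m_def ..
  have n: "u' * k.cj u' = of_int n" unfolding cd k_norm n_def ..
  have "(u * k.cj u) * (u' * k.cj u') = (u * u') * k.cj (u * u')"
    unfolding k.cj_mult[OF k.B_in_E[OF u(1)] k.B_in_E[OF u(2)]] by (simp only: mult_ac)
  then have "real_of_int (m * n) = of_int 1" unfolding m n u(3) by simp
  then have "m * n = 1" by (simp only: of_int_eq_iff)
  then have "m = 1 \<or> m = -1" by (auto simp: zmult_eq_1_iff)
  moreover have "m \<noteq> -1"
  proof
    assume "m = -1"
    then have "int (nat \<bar>a\<bar> * nat \<bar>a\<bar> + 1) = int (p * (nat \<bar>b\<bar> * nat \<bar>b\<bar>))" by (simp add: m_def)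
    then show False using not_norm_m1 by (simp only: of_nat_eq_iff) 
  qed
  ultimately show ?thesis using m by simp
qed

text \<open>\<open>pell_step\<close> read in the field: its two alternatives for the coordinates of
  \<open>u\<close> are \<open>w * w = 2 * u\<close> and \<open>w * w = u\<close>.\<close>

lemma o_unit_square:
  assumes u: "u \<in> k.B" "u' \<in> k.B" "u * u' = 1" "u > 0"
  shows "\<exists>w\<in>k.B. w * w = u \<or> w * w = 2 * u"
proof -
  obtain a b where ab: "u = of_int a + of_int b * s" using u(1) by (rule o_cases)
  have N: "u * k.cj u = 1" by (rule o_unit_norm[OF u(1-3)])
  have "real_of_int (a * a - int p * (b * b)) = of_int 1" using N unfolding ab k_norm by simp
  then have 1: "a * a - int p * (b * b) = 1" by (simp only: of_int_eq_iff)
  have "k.cj u > 0" using N u(4) by (metis zero_less_mult_pos zero_less_one)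
  moreover have "k.cj u = of_int a - of_int b * s" unfolding ab by (rule k.cj_rep) auto
  ultimately have "2 * real_of_int a > 0" using u(4) unfolding ab by linarith
  then have a: "a > 0" by simp
  \<comment> \<open>\<open>pell_step\<close> knows only \<open>\<bar>b\<bar>\<close>; the sign of
    \<open>b\<close> is put back into the second coordinate of \<open>w\<close>.\<close>
  define e where "e = (if b < 0 then - 1 else 1 :: int)"
  have e: "e * \<bar>b\<bar> = b" "e * e = 1" by (auto simp: e_def)
  have "int (nat a * nat a) = int (p * (nat \<bar>b\<bar> * nat \<bar>b\<bar>) + 1)" using a 1 by simp
  then have eq: "nat a * nat a = p * (nat \<bar>b\<bar> * nat \<bar>b\<bar>) + 1" by (simp only: of_nat_eq_iff)
  show ?thesis
  proof (cases "a = 1")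
    case True
    then have "b = 0" using 1 p_pos by simp
    then have "u = 1 * 1" using True ab by simp
    then show ?thesis using k.A_B[OF k.A_1] by blast
  next
    case False
    then have "nat a > 1" using a by simp
    from pell_step[OF eq this] show ?thesis
    proof
      assume "\<exists>x y. x * x = p * (y * y) + 2 \<and> x * y = nat \<bar>b\<bar> \<and> nat a + 1 = x * x"
      then obtain x y where xy: "x * x = p * (y * y) + 2" "x * y = nat \<bar>b\<bar>" "nat a + 1 = x * x" by blast
      define w where "w = of_int (int x) + of_int (e * int y) * s"
      have i: "int x * int x = int p * (int y * int y) + 2" "int x * int y = \<bar>b\<bar>" "a + 1 = int x * int x"
        using xy a by (metis of_nat_add of_nat_mult of_nat_numeral, metis of_nat_mult abs_ge_zero nat_0_le,
          metis of_nat_add of_nat_mult of_nat_1 less_imp_le nat_0_le)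
      have "w * w = of_int (int x * int x + int p * (e * e) * (int y * int y)) + of_int (2 * (e * (int x * int y))) * s"
        by (simp add: w_def algebra_simps s_sq[symmetric])
      also have "int x * int x + int p * (e * e) * (int y * int y) = 2 * a" using i e by simp
      also have "2 * (e * (int x * int y)) = 2 * b" using i e by simp
      finally have "w * w = 2 * u" by (simp add: ab)
      moreover have "w \<in> k.B" unfolding w_def by (rule o_I)
      ultimately show ?thesis by blast
    next
      assume "\<exists>x y. x * x = p * (y * y) + 1 \<and> 2 * x * y = nat \<bar>b\<bar> \<and> nat a + 1 = 2 * (x * x)"
      then obtain x y where xy: "x * x = p * (y * y) + 1" "2 * x * y = nat \<bar>b\<bar>" "nat a + 1 = 2 * (x * x)" by blast
      define w where "w = of_int (int x) + of_int (e * int y) * s"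
      have i: "int x * int x = int p * (int y * int y) + 1" "2 * int x * int y = \<bar>b\<bar>" "a + 1 = 2 * (int x * int x)"
        using xy a by (metis of_nat_add of_nat_mult of_nat_1, metis of_nat_mult of_nat_numeral abs_ge_zero nat_0_le,
          metis of_nat_add of_nat_mult of_nat_numeral of_nat_1 less_imp_le nat_0_le)
      have "w * w = of_int (int x * int x + int p * (e * e) * (int y * int y)) + of_int (e * (2 * int x * int y)) * s"
        by (simp add: w_def algebra_simps s_sq[symmetric])
      also have "int x * int x + int p * (e * e) * (int y * int y) = a" using i e by simp
      also have "e * (2 * int x * int y) = b" using i e by simp
      finally have "w * w = u" by (simp add: ab)
      moreover have "w \<in> k.B" unfolding w_def by (rule o_I)
      ultimately show ?thesis by blast
    qed
  qed
qed

end

section \<open>The prime ideal above 2\<close>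

lemma int_ideal_prime:
  assumes M: "is_ideal \<int> M" and q: "prime (q::int)" "of_int q \<in> M"
  shows "M = smul (of_int q) \<int> \<or> M = \<int>"
proof -
  obtain a :: int where a: "M = smul (of_int a) \<int>" using int_ideal_principal[OF M] by blast
  then obtain n :: int where "real_of_int q = of_int a * of_int n"
    using q by (auto simp: smul_def elim!: Ints_cases)
  then have n: "q = a * n" by (metis of_int_mult of_int_eq_iff)
  have unit: "smul (of_int e * c) \<int> = smul c \<int>" if "\<bar>e\<bar> = 1" for e :: int and c :: real
  proof -
    have "e * e = 1" using that by (metis abs_mult_self_eq mult_1)
    then have "real_of_int e * of_int e = 1" by (metis of_int_1 of_int_mult)
    then have "smul (of_int e) (smul c \<int>) = smul c \<int>"
      by (intro smul_unit[OF Ints_subring smul_module[OF subring_module[OF Ints_subring]]]) auto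
    then show ?thesis by (simp add: smul_smul)
  qed
  have "a dvd q" using n by simp
  then have "\<bar>a\<bar> = 1 \<or> \<bar>a\<bar> = q" using q(1) by (metis prime_int_iff abs_dvd_iff abs_ge_zero)
  then show ?thesis
  proof
    assume "\<bar>a\<bar> = 1"
    then show ?thesis using unit[of a 1] a by simp
  next
    assume "\<bar>a\<bar> = q"
    moreover have "\<bar>sgn a\<bar> = 1" using n q by (auto simp: abs_sgn_eq)
    moreover have "a = sgn a * \<bar>a\<bar>" by (simp add: sgn_mult_abs)
    ultimately show ?thesis using unit[of "sgn a" "of_int q"] a by (metis of_int_mult)
  qed
qed

context prime7
begin

lemma o_subring: "is_subring k.B" by (rule k.B_subring)

lemma R_subring: "is_subring K.B" by (rule K.B_subring)

lemma Ints_o: "x \<in> \<int> \<Longrightarrow> x \<in> k.B" by (rule k.A_B)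

end

sublocale prime7 \<subseteq> k: quad_genus \<int> \<rat> "real p" s "{1, 2}"
proof
  show "M = smul (real p) \<int> \<or> M = \<int>" if "is_ideal \<int> M" "real p \<in> M" for M
    using int_ideal_prime[of M "int p"] that int_prime by simp
  show "\<exists>f\<in>{1, 2}. M = smul f \<int>" if "is_ideal \<int> M" "2 \<in> M" for M
    using int_ideal_prime[of M 2] that by auto
  show "\<exists>c\<in>\<int>. M = smul c \<int>" if "is_ideal \<int> M" for M
    using int_ideal_principal[OF that] by auto
qed

context prime7
begin

definition pi2 :: "nat \<times> nat" where
  "pi2 = (SOME q. fst q * fst q = p * (snd q * snd q) + 2)"

definition \<pi> :: real where "\<pi> = of_int (int (fst pi2)) + of_int (int (snd pi2)) * s"

lemma pi2: "fst pi2 * fst pi2 = p * (snd pi2 * snd pi2) + 2"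
  using norm_2_exists unfolding pi2_def by (intro someI_ex[of "\<lambda>q. fst q * fst q = p * (snd q * snd q) + 2"]) auto

lemma pi2_odd: "odd (fst pi2)" "odd (snd pi2)"
  using norm_2_odd[OF pi2] by auto

lemma pi_o: "\<pi> \<in> k.B" unfolding \<pi>_def by (rule o_I)

lemma pi_norm: "\<pi> * k.cj \<pi> = 2"
proof -
  have "int (fst pi2) * int (fst pi2) = int p * (int (snd pi2) * int (snd pi2)) + 2"
    using pi2 by (metis of_nat_add of_nat_mult of_nat_numeral)
  then show ?thesis unfolding \<pi>_def k_norm by simp
qed

lemma pi_nz: "\<pi> \<noteq> 0" using pi_norm by auto

lemma cj_pi_o: "k.cj \<pi> \<in> k.B" by (rule k.cj_B[OF pi_o])

lemma pi_trace: "k.cj \<pi> = of_int (2 * int (fst pi2)) - \<pi>"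
proof -
  have "k.cj \<pi> = of_int (int (fst pi2)) - of_int (int (snd pi2)) * s" unfolding \<pi>_def by (rule k.cj_rep) auto
  then show ?thesis by (simp add: \<pi>_def)
qed

text \<open>2 ramifies in \<open>k\<close>: it divides \<open>\<pi> * \<pi>\<close> because both
  coordinates of \<open>\<pi>\<close> are odd, and the quotient has norm 1.\<close>

lemma two_unit: "\<exists>v\<in>k.B. \<exists>v'\<in>k.B. v * v' = 1 \<and> \<pi> * \<pi> = 2 * v"
proof -
  have "even (int (fst pi2) * int (fst pi2) + int p * (int (snd pi2) * int (snd pi2)))"
    using pi2_odd p_odd by simp
  then obtain m where m: "int (fst pi2) * int (fst pi2) + int p * (int (snd pi2) * int (snd pi2)) = 2 * m" by (rule evenE)
  define v where "v = of_int m + of_int (int (fst pi2) * int (snd pi2)) * s"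
  have "\<pi> * \<pi> = of_int (int (fst pi2) * int (fst pi2) + int p * (int (snd pi2) * int (snd pi2)))
      + 2 * of_int (int (fst pi2) * int (snd pi2)) * s"
    by (simp add: \<pi>_def algebra_simps s_sq[symmetric])
  then have v: "\<pi> * \<pi> = 2 * v" unfolding m v_def by simp
  have vo: "v \<in> k.B" unfolding v_def by (rule o_I)
  have "(\<pi> * k.cj \<pi>) * (\<pi> * k.cj \<pi>) = (\<pi> * \<pi>) * k.cj (\<pi> * \<pi>)"
    unfolding k.cj_mult[OF k.B_in_E[OF pi_o] k.B_in_E[OF pi_o]] by (simp only: mult_ac)
  also have "\<dots> = (2 * v) * (2 * k.cj v)"
    unfolding v using k.cj_mult[of 2 v] k.cj_F[of 2] k.F_E[of 2] k.B_in_E[OF vo] by simp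
  finally have "v * k.cj v = 1" unfolding pi_norm by simp
  then show ?thesis using v vo k.cj_B by blast
qed

lemma smul_two: "smul 2 k.B = smul (\<pi> * \<pi>) k.B"
proof -
  obtain v v' where v: "v \<in> k.B" "v' \<in> k.B" "v * v' = 1" "\<pi> * \<pi> = 2 * v" using two_unit by blast
  have "smul v k.B = k.B" using v by (intro smul_unit[OF o_subring subring_module[OF o_subring]])
  then show ?thesis unfolding v(4) by (metis smul_smul)
qed

text \<open>Modulo 4 all three numbers must be even, which allows descent by 2. Norms
  \<open>- n^2\<close> are thereby ruled out, so a generator of \<open>J^2\<close> in
  \<open>o_no_2_torsion\<close> has norm exactly \<open>n^2\<close>.\<close>

lemma norm_minus_square:
  fixes x n y :: nat
  assumes "x * x + n * n = p * (y * y)"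
  shows "n = 0"
  using assms
proof (induction n arbitrary: x y rule: less_induct)
  case (less n)
  show ?case
  proof (rule ccontr)
    assume n: "n \<noteq> 0"
    have x: "(\<exists>e. even x \<and> x * x = 4 * e) \<or> (\<exists>e. x * x = 8 * e + 1)" using nat_sq_mod8 nat_sq_even by blast
    have n': "(\<exists>e. even n \<and> n * n = 4 * e) \<or> (\<exists>e. n * n = 8 * e + 1)" using nat_sq_mod8 nat_sq_even by blast
    have y: "(\<exists>e. even y \<and> p * (y * y) = 4 * e) \<or> (\<exists>e. p * (y * y) = 8 * e + 7)" using p_nat_sq_odd p_nat_sq_even by blast
    have aux: "even X \<and> even N \<and> even Y"
      if "X = 4 * e \<or> X = 8 * e + 1" "N = 4 * f \<or> N = 8 * f + 1" "Y = 4 * g \<or> Y = 8 * g + 7" "X + N = Y"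
      for X N Y e f g :: nat
      using that by (elim disjE; simp; presburger)
    have "even (x * x) \<and> even (n * n) \<and> even (p * (y * y))"
      using aux[OF _ _ _ less.prems] x n' y by metis
    then have "even x \<and> even n \<and> even y" using p_odd by simp
    then obtain x' m y' where "x = 2 * x'" "n = 2 * m" "y = 2 * y'" by (auto elim!: evenE)
    then have "x' * x' + m * m = p * (y' * y')" "m < n" "m \<noteq> 0" using less.prems n by auto
    then show False using less.IH by blast
  qed
qed

text \<open>Genus theory of \<open>k\<close> over the rationals: \<open>J\<close> is equivalent to
  an ideal whose square is \<open>(x * x * g * f)\<close> with \<open>g\<close> in
  \<open>{1, p}\<close> and \<open>f\<close> in \<open>{1, 2}\<close>. Since
  \<open>p = s * s\<close> and 2 is \<open>\<pi> * \<pi>\<close> up to a unit, this is the square of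
  a principal ideal.\<close>

lemma o_no_2_torsion:
  assumes J: "is_ideal k.B J" "J \<noteq> {0}" and \<delta>: "\<delta> \<in> k.E" and JJ: "iprod J J = smul \<delta> k.B"
  shows "\<exists>c\<in>k.B. J = smul c k.B"
proof -
  have JE: "J \<subseteq> k.E" using J k.B_in_E by (auto simp: is_ideal_def)
  obtain N where N: "is_ideal \<int> N" "N \<noteq> {0}" "iprod J (k.cj ` J) = iprod N k.B"
    using k.norm_ideal[OF J] by blast
  obtain n :: int where n: "N = smul (of_int n) \<int>" using int_ideal_principal[OF N(1)] by blast
  have n0: "n \<noteq> 0" using N(2) unfolding n by (auto simp: smul_def)
  have JcJ: "iprod J (k.cj ` J) = smul (of_int n) k.B" unfolding N(3) n by (rule k.iprod_smul_A_B)
  have \<delta>B: "\<delta> \<in> k.B"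
    using smul_ring_iff[OF o_subring, of \<delta>] iprod_ideal[OF o_subring J(1) J(1)] JJ by (auto simp: is_ideal_def)
  obtain a b where ab: "\<delta> = of_int a + of_int b * s" using \<delta>B by (rule o_cases)
  define m where "m = a * a - int p * (b * b)"
  have m: "\<delta> * k.cj \<delta> = of_int m" unfolding ab k_norm m_def ..
  have "smul (of_int m) k.B = smul (of_int (n * n)) k.B"
  proof -
    have cJJ: "iprod (k.cj ` J) (k.cj ` J) = smul (k.cj \<delta>) k.B"
      using k.cj_iprod[OF JE JE] JJ k.cj_smul[OF \<delta> k.B_E_subset] k.cj_B_image by simp
    have "iprod (iprod J J) (iprod (k.cj ` J) (k.cj ` J)) = smul (of_int m) k.B"
      unfolding JJ cJJ m[symmetric] by (rule iprod_principal[OF o_subring])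
    moreover have "iprod (iprod J J) (iprod (k.cj ` J) (k.cj ` J)) = iprod (iprod J (k.cj ` J)) (iprod J (k.cj ` J))"
      by (simp add: iprod_ac)
    moreover have "\<dots> = smul (of_int (n * n)) k.B" unfolding JcJ by (simp add: iprod_principal[OF o_subring])
    ultimately show ?thesis by simp
  qed
  then obtain v v' where v: "v \<in> k.B" "v' \<in> k.B" "v * v' = 1" "of_int m = v * of_int (n * n)"
    using smul_eq_unit[OF o_subring] n0 by (metis mult_eq_0_iff of_int_eq_0_iff)
  have vQ: "v = of_int m / of_int (n * n)" using v n0 by simp
  have "v \<in> \<rat>" unfolding vQ by simp
  moreover have "v' = inverse v" using v(3) by (metis inverse_unique)
  ultimately have "v \<in> \<int>" "v' \<in> \<int>" using v k.B_Int_F by auto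
  then obtain e f :: int where ef: "v = of_int e" "v' = of_int f" by (auto elim!: Ints_cases)
  then have "real_of_int (e * f) = of_int 1" using v by simp
  then have "e * f = 1" by (simp only: of_int_eq_iff)
  then have "e = 1 \<or> e = -1" by (auto simp: zmult_eq_1_iff)
  moreover have me: "m = e * (n * n)"
  proof -
    have "real_of_int m = of_int (e * (n * n))" using v(4) ef by simp
    then show ?thesis by (simp only: of_int_eq_iff)
  qed
  moreover have "e \<noteq> -1"
  proof
    assume "e = -1"
    then have "int (nat \<bar>a\<bar> * nat \<bar>a\<bar> + nat \<bar>n\<bar> * nat \<bar>n\<bar>) = int (p * (nat \<bar>b\<bar> * nat \<bar>b\<bar>))"
      using me by (simp add: m_def)
    then have "nat \<bar>n\<bar> = 0" using norm_minus_square by (simp only: of_nat_eq_iff)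
    then show False using n0 by simp
  qed
  ultimately have mn: "m = n * n" by simp
  \<comment> \<open>Only \<open>c * c\<close> and the ideal \<open>(c)\<close> are prescribed; the
    sign is chosen to keep \<open>\<delta> + c\<close> nonzero.\<close>
  define c where "c = (if \<delta> + of_int n = 0 then - real_of_int n else of_int n)"
  have c: "\<delta> + c \<noteq> 0" using n0 by (auto simp: c_def)
  have cc: "\<delta> * k.cj \<delta> = c * c" unfolding m mn by (simp add: c_def)
  have cQ: "c \<in> \<rat>" by (simp add: c_def)
  have "smul (- real_of_int n) k.B = smul (of_int n) (smul (-1) k.B)" by (simp add: smul_smul)
  also have "smul (-1) k.B = k.B"
    by (rule smul_unit[OF o_subring subring_module[OF o_subring], of _ "-1"]) (auto intro: Ints_o)
  finally have cI: "iprod J (k.cj ` J) = smul c k.B" unfolding JcJ by (simp add: c_def)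
  define \<gamma> where "\<gamma> = k.cj \<delta> + c"
  obtain x g f v v' where g: "\<gamma> \<in> k.B" "\<gamma> \<noteq> 0" and x': "x \<in> \<int>" "g \<in> {1, real p}" "f \<in> {1, 2}"
    "v \<in> \<int>" "v' \<in> \<int>" "v * v' = 1" "x \<noteq> 0"
    "iprod (smul \<gamma> J) (smul \<gamma> J) = smul (x * x * g * f) k.B"
    "\<gamma> * \<gamma> * c * c = k.cj \<delta> * (v * (x * x) * g * f)"
    by (rule k.ambiguous_class[OF J \<delta> c cQ JJ cI cc, folded \<gamma>_def])
  note x = x'(1-3,7,8)
  define G where "G = (if g = 1 then 1 else s)"
  define H where "H = (if f = 1 then 1 else \<pi>)"
  have G: "g = G * G" "G \<in> k.B" "G \<noteq> 0" using x(2) s_sq s_pos k.r_B Ints_o[OF Ints_1] by (auto simp: G_def)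
  have H: "smul f k.B = smul (H * H) k.B" "H \<in> k.B" "H \<noteq> 0"
    using x(3) smul_two pi_o pi_nz Ints_o[OF Ints_1] by (auto simp: H_def)
  define y where "y = x * G * H"
  have yB: "y \<in> k.B" unfolding y_def by (intro k.B_mult Ints_o[OF x(1)] G H)
  have y0: "y \<noteq> 0" unfolding y_def using x(4) G H by simp
  have "smul (x * x * g * f) k.B = smul (x * x * g) (smul f k.B)" by (simp add: smul_smul)
  also have "\<dots> = smul (y * y) k.B"
  proof -
    have "x * x * (G * G) * (H * H) = y * y" by (simp add: y_def)
    then have "x * x * g * (H * H) = y * y" using G(1) by metis
    then show ?thesis using H(1) smul_smul by metis
  qed
  finally have "iprod (smul \<gamma> J) (smul \<gamma> J) = iprod (smul y k.B) (smul y k.B)"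
    using x(5) by (simp add: iprod_principal[OF o_subring])
  then have "smul \<gamma> J = smul y k.B"
    by (rule k.BE.square_root_unique[OF ideal_smul[OF o_subring g(1) J(1)] smul_nonzero[OF g(2) J(2)]
      ideal_smul[OF o_subring yB subring_ideal[OF o_subring]] smul_nonzero[OF y0 subring_nonzero[OF o_subring]]])
  then have "smul (1 / \<gamma>) (smul \<gamma> J) = smul (1 / \<gamma>) (smul y k.B)" by simp
  then have J': "J = smul (y / \<gamma>) k.B" using g by (simp add: smul_smul)
  then have "y / \<gamma> \<in> k.B" using smul_ring_iff[OF o_subring, of "y / \<gamma>"] J by (auto simp: is_ideal_def)
  then show ?thesis using J' by blast
qed

text \<open>\<open>\<kappa>\<close> is \<open>(1 + s) * k.cj \<pi> / 2\<close>, integral since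
  \<open>p\<close> and the coordinates of \<open>\<pi>\<close> are odd. Its norm
  \<open>(1 - p) / 2\<close> is odd, so \<open>\<pi>\<close> divides \<open>1 + s\<close> exactly
  once; this makes \<open>Q^2\<close> equal to \<open>(\<pi>)\<close>.\<close>

lemma one_plus_s: "\<exists>\<kappa>\<in>k.B. 1 + s = \<pi> * \<kappa> \<and> (\<exists>m::int. odd m \<and> \<kappa> * k.cj \<kappa> = of_int m)"
proof -
  have ev: "even (int (fst pi2) - int p * int (snd pi2))" "even (int (fst pi2) - int (snd pi2))"
    using pi2_odd p_odd by simp_all
  obtain a where a: "int (fst pi2) - int p * int (snd pi2) = 2 * a" using ev(1) by (rule evenE)
  obtain b where b: "int (fst pi2) - int (snd pi2) = 2 * b" using ev(2) by (rule evenE)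
  define \<kappa> where "\<kappa> = of_int a + of_int b * s"
  have \<kappa>: "\<kappa> \<in> k.B" unfolding \<kappa>_def by (rule o_I)
  have cjpi: "k.cj \<pi> = of_int (int (fst pi2)) - of_int (int (snd pi2)) * s" unfolding \<pi>_def by (rule k.cj_rep) auto
  have "2 * \<kappa> = of_int (2 * a) + of_int (2 * b) * s" by (simp add: \<kappa>_def)
  also have "\<dots> = (1 + s) * k.cj \<pi>"
    unfolding a[symmetric] b[symmetric] cjpi by (simp add: algebra_simps s_sq[symmetric])
  finally have "\<pi> * (2 * \<kappa>) = (1 + s) * (\<pi> * k.cj \<pi>)" by simp
  then have eq: "1 + s = \<pi> * \<kappa>" unfolding pi_norm by simp
  obtain q where q: "int p = 16 * q + 7" using p_int_form by blast
  define m where "m = a * a - int p * (b * b)"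
  have m: "\<kappa> * k.cj \<kappa> = of_int m" unfolding \<kappa>_def k_norm m_def ..
  have "(1 + s) * k.cj (1 + s) = of_int (1 - int p)" using k_norm[of 1 1] by simp
  also have "(1 + s) * k.cj (1 + s) = (\<pi> * k.cj \<pi>) * (\<kappa> * k.cj \<kappa>)"
    unfolding eq k.cj_mult[OF k.B_in_E[OF pi_o] k.B_in_E[OF \<kappa>]] by (simp only: mult_ac)
  also have "\<dots> = of_int (2 * m)" unfolding pi_norm m by simp
  finally have "2 * m = 1 - int p" by (simp only: of_int_eq_iff)
  then have "odd m" using q by presburger
  then show ?thesis using \<kappa> eq m by blast
qed

text \<open>Modulo \<open>s\<close> only the first coordinate modulo \<open>p\<close> survives: if
  it is prime to \<open>p\<close> for some element of \<open>M\<close>, Bezout puts 1 into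
  \<open>M\<close>.\<close>

lemma o_ideal_s:
  assumes M: "is_ideal k.B M" "s \<in> M"
  shows "M = smul s k.B \<or> M = k.B"
proof -
  have MB: "\<And>x. x \<in> M \<Longrightarrow> x \<in> k.B" and add: "\<And>x y. x \<in> M \<Longrightarrow> y \<in> M \<Longrightarrow> x + y \<in> M"
    and mul: "\<And>a x. a \<in> k.B \<Longrightarrow> x \<in> M \<Longrightarrow> a * x \<in> M" using M by (auto simp: is_ideal_def)
  show ?thesis
  proof (cases "\<exists>a b. of_int a + of_int b * s \<in> M \<and> \<not> int p dvd a")
    case True
    then obtain a b where ab: "of_int a + of_int b * s \<in> M" "\<not> int p dvd a" by blast
    have "coprime (int p) a" using ab int_prime by (simp add: prime_imp_coprime)
    then obtain u v where uv: "u * int p + v * a = 1" using bezout_int[of "int p" a] by (auto simp: coprime_iff_gcd_eq_1)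
    have "of_int (- b) * s \<in> M" using M(2) by (intro mul Ints_o) auto
    with ab(1) have "of_int a + of_int b * s + of_int (- b) * s \<in> M" by (rule add)
    then have "real_of_int a \<in> M" by simp
    then have "of_int v * of_int a \<in> M" by (intro mul Ints_o) auto
    moreover have "of_int u * (s * s) \<in> M" using mul[OF Ints_o mul[OF k.r_B M(2)]] by simp
    ultimately have "of_int u * (s * s) + of_int v * of_int a \<in> M" by (metis add)
    moreover have "of_int u * (s * s) + of_int v * of_int a = real_of_int (u * int p + v * a)" by (simp add: s_sq)
    ultimately have "1 \<in> M" unfolding uv by simp
    then have "x \<in> M" if "x \<in> k.B" for x using mul[OF that, of 1] by simp
    then show ?thesis using MB by blast
  next
    case False
    have "M \<subseteq> smul s k.B"
    proof
      fix z assume z: "z \<in> M"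
      obtain a b where ab: "z = of_int a + of_int b * s" using MB[OF z] by (rule o_cases)
      then obtain a' where "a = int p * a'" using False z by blast
      then have "z = s * (of_int b + of_int a' * s)" using ab by (simp add: algebra_simps s_sq[symmetric])
      then show "z \<in> smul s k.B" by (metis smul_memI o_I)
    qed
    moreover have "smul s k.B \<subseteq> M" using mul M by (auto simp: smul_def mult.commute[of s])
    ultimately show ?thesis by blast
  qed
qed

text \<open>Modulo 2 the ideals are told apart by the parities of coordinates: an element with
  \<open>a + b\<close> odd has a square congruent to 1, one with both coordinates odd is congruent
  to \<open>\<pi>\<close>, and if neither occurs \<open>M\<close> is \<open>(2)\<close>.\<close>

lemma o_ideal_2:
  assumes M: "is_ideal k.B M" "2 \<in> M"
  shows "\<exists>f\<in>{1, \<pi>, 2}. M = smul f k.B"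
proof -
  have MB: "\<And>x. x \<in> M \<Longrightarrow> x \<in> k.B" and add: "\<And>x y. x \<in> M \<Longrightarrow> y \<in> M \<Longrightarrow> x + y \<in> M"
    and mul: "\<And>a x. a \<in> k.B \<Longrightarrow> x \<in> M \<Longrightarrow> a * x \<in> M" using M by (auto simp: is_ideal_def)
  have diff: "x - y \<in> M" if "x \<in> M" "y \<in> M" for x y
    using module_diff[OF o_subring _ that] M by (simp add: is_ideal_iff)
  have two: "of_int (2 * a) + of_int (2 * b) * s \<in> M" for a b
    using mul[OF o_I[of a b] M(2)] by (simp add: algebra_simps)
  show ?thesis
  proof (cases "\<exists>a b. of_int a + of_int b * s \<in> M \<and> odd (a + b)")
    case True
    then obtain a b where ab: "of_int a + of_int b * s \<in> M" "odd (a + b)" by blast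
    have "odd (a * a + int p * (b * b) - 1 + 1)" using ab(2) p_odd by simp
    then have "even (a * a + int p * (b * b) - 1)" by simp
    then obtain m where m: "a * a + int p * (b * b) - 1 = 2 * m" by (rule evenE)
    have "(of_int a + of_int b * s) * (of_int a + of_int b * s) \<in> M" by (rule mul[OF o_I ab(1)])
    moreover have "(of_int a + of_int b * s) * (of_int a + of_int b * s)
        = of_int (a * a + int p * (b * b) - 1) + of_int (2 * (a * b)) * s + 1"
      by (simp add: algebra_simps s_sq[symmetric])
    ultimately have "(of_int (2 * m) + of_int (2 * (a * b)) * s + 1) - (of_int (2 * m) + of_int (2 * (a * b)) * s) \<in> M"
      unfolding m by (intro diff two) simp
    then have "1 \<in> M" by simp
    then have "x \<in> M" if "x \<in> k.B" for x using mul[OF that, of 1] by simp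
    then have "M = smul 1 k.B" using MB by auto
    then show ?thesis by blast
  next
    case F1: False
    show ?thesis
    proof (cases "\<exists>a b. of_int a + of_int b * s \<in> M \<and> odd a")
      case True
      then obtain a b where ab: "of_int a + of_int b * s \<in> M" "odd a" "odd b" using F1 by fastforce
      then obtain m n where mn: "a = int (fst pi2) + 2 * m" "b = int (snd pi2) + 2 * n"
      proof -
        have ev: "even (a - int (fst pi2))" "even (b - int (snd pi2))" using ab pi2_odd by simp_all
        obtain m where "a - int (fst pi2) = 2 * m" using ev(1) by (rule evenE)
        moreover obtain n where "b - int (snd pi2) = 2 * n" using ev(2) by (rule evenE)
        ultimately have "a = int (fst pi2) + 2 * m" "b = int (snd pi2) + 2 * n" by linarith+
        then show ?thesis using that by blast
      qed
      have "(of_int a + of_int b * s) - (of_int (2 * m) + of_int (2 * n) * s) \<in> M" by (intro diff two ab)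
      moreover have "(of_int a + of_int b * s) - (of_int (2 * m) + of_int (2 * n) * s) = \<pi>"
        unfolding mn \<pi>_def by (simp add: algebra_simps)
      ultimately have "\<pi> \<in> M" by simp
      then have 1: "smul \<pi> k.B \<subseteq> M" using mul by (auto simp: smul_def mult.commute[of \<pi>])
      obtain \<kappa> where \<kappa>: "\<kappa> \<in> k.B" "1 + s = \<pi> * \<kappa>" using one_plus_s by blast
      have "M \<subseteq> smul \<pi> k.B"
      proof
        fix z assume z: "z \<in> M"
        obtain c d where cd: "z = of_int c + of_int d * s" using MB[OF z] by (rule o_cases)
        then have "even (c - d)" using F1 z by auto
        then obtain e where e: "c - d = 2 * e" by (rule evenE)
        \<comment> \<open>Both summands are multiples of \<open>\<pi>\<close>: \<open>1 + s\<close>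
          by \<open>one_plus_s\<close>, and the even number \<open>c - d\<close> because
          \<open>\<pi>\<close> divides 2.\<close>
        have "z = (1 + s) * of_int d + of_int (c - d)" unfolding cd by (simp add: algebra_simps)
        also have "\<dots> = \<pi> * (\<kappa> * of_int d + k.cj \<pi> * of_int e)"
          unfolding e \<kappa>(2) using pi_norm by (simp add: algebra_simps)
        finally have "z = \<pi> * (\<kappa> * of_int d + k.cj \<pi> * of_int e)" .
        moreover have "\<kappa> * of_int d + k.cj \<pi> * of_int e \<in> k.B"
          by (intro k.B_add k.B_mult \<kappa> cj_pi_o Ints_o[OF Ints_of_int])
        ultimately show "z \<in> smul \<pi> k.B" by (metis smul_memI)
      qed
      then show ?thesis using 1 by blast
    next
      case F2: False
      have "M \<subseteq> smul 2 k.B"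
      proof
        fix z assume z: "z \<in> M"
        obtain c d where cd: "z = of_int c + of_int d * s" using MB[OF z] by (rule o_cases)
        then have "even c" "even d" using F1 F2 z by fastforce+
        then obtain c' d' where "c = 2 * c'" "d = 2 * d'" by (auto elim!: evenE)
        then have "z = 2 * (of_int c' + of_int d' * s)" using cd by simp
        then show "z \<in> smul 2 k.B" by (metis smul_memI o_I)
      qed
      moreover have "smul 2 k.B \<subseteq> M" using mul M by (auto simp: smul_def mult.commute[of 2])
      ultimately show ?thesis by blast
    qed
  qed
qed

end

sublocale prime7 \<subseteq> K: quad_genus k.B k.E s \<theta> "{1, \<pi>, 2}"
proof
  show "M = smul s k.B \<or> M = k.B" if "is_ideal k.B M" "s \<in> M" for M
    using that by (rule o_ideal_s)
  show "\<exists>f\<in>{1, \<pi>, 2}. M = smul f k.B" if "is_ideal k.B M" "2 \<in> M" for M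
    using that by (rule o_ideal_2)
  show "\<exists>c\<in>k.B. M = smul c k.B"
    if "is_ideal k.B M" "M \<noteq> {0}" "x \<in> k.E" "iprod M M = smul x k.B" for M x
    using that by (rule o_no_2_torsion)
qed

section \<open>The ideal \<open>Q\<close> and the class it represents\<close>

context prime7
begin

text \<open>\<open>1 + \<theta>\<close> is the natural second generator, since its square
  \<open>1 + s + 2 * \<theta>\<close> is a multiple of \<open>\<pi>\<close>.\<close>

definition Q :: "real set" where "Q = {\<pi> * a + (1 + \<theta>) * b | a b. a \<in> K.B \<and> b \<in> K.B}"

lemma o_R: "x \<in> k.B \<Longrightarrow> x \<in> K.B" by (rule K.A_B)

lemma int_R: "of_int n \<in> K.B" by (rule o_R[OF Ints_o]) simp

lemma one_R: "1 \<in> K.B" using int_R[of 1] by simp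

lemma zero_R: "0 \<in> K.B" using int_R[of 0] by simp

lemma Q_I: "a \<in> K.B \<Longrightarrow> b \<in> K.B \<Longrightarrow> \<pi> * a + (1 + \<theta>) * b \<in> Q"
  by (auto simp: Q_def)

lemma Q_ideal: "is_ideal K.B Q"
  unfolding is_ideal_def
proof (intro conjI ballI)
  show "Q \<subseteq> K.B" unfolding Q_def using o_R[OF pi_o] K.r_B one_R
    by (auto intro!: K.B_add[of "\<pi> * _"] K.B_mult K.B_add[of 1])
  show "0 \<in> Q" using Q_I[OF zero_R zero_R] by simp
  show "x + y \<in> Q" if xy: "x \<in> Q" "y \<in> Q" for x y
  proof -
    obtain a b c d where "a \<in> K.B" "b \<in> K.B" "c \<in> K.B" "d \<in> K.B" "x = \<pi> * a + (1 + \<theta>) * b" "y = \<pi> * c + (1 + \<theta>) * d"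
      using xy by (auto simp: Q_def)
    then show ?thesis using Q_I[of "a + c" "b + d"] K.B_add by (simp add: algebra_simps)
  qed
  show "r * x \<in> Q" if rx: "r \<in> K.B" "x \<in> Q" for r x
  proof -
    obtain a b where "a \<in> K.B" "b \<in> K.B" "x = \<pi> * a + (1 + \<theta>) * b" using rx by (auto simp: Q_def)
    then show ?thesis using Q_I[of "r * a" "r * b"] K.B_mult rx by (simp add: algebra_simps)
  qed
qed

lemma pi_Q: "\<pi> \<in> Q" using Q_I[OF one_R zero_R] by simp

lemma theta_Q: "1 + \<theta> \<in> Q" using Q_I[OF zero_R one_R] by simp

lemma Q_nonzero: "Q \<noteq> {0}" using pi_Q pi_nz by blast

text \<open>All products of generators are multiples of \<open>\<pi>\<close>. Conversely, the
  quotient \<open>W\<close> of \<open>Q^2\<close> by \<open>\<pi>\<close> contains 2 and an odd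
  integer, hence 1.\<close>

lemma Q_Q: "iprod Q Q = smul \<pi> K.B"
proof
  obtain \<kappa> m where \<kappa>: "\<kappa> \<in> k.B" "1 + s = \<pi> * \<kappa>" "odd m" "\<kappa> * k.cj \<kappa> = of_int m" using one_plus_s by blast
  have sq: "(1 + \<theta>) * (1 + \<theta>) = \<pi> * (\<kappa> + k.cj \<pi> * \<theta>)"
  proof -
    have "(1 + \<theta>) * (1 + \<theta>) = (1 + s) + 2 * \<theta>" by (simp add: algebra_simps \<theta>_sq[symmetric])
    then show ?thesis unfolding \<kappa>(2) pi_norm[symmetric] by (simp add: algebra_simps)
  qed
  have W: "\<kappa> + k.cj \<pi> * \<theta> \<in> K.B" using \<kappa> cj_pi_o by (intro K.B_I)
  have mod: "is_module K.B (smul \<pi> K.B)" by (rule smul_module[OF subring_module[OF R_subring]])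
  show "iprod Q Q \<subseteq> smul \<pi> K.B"
  proof (rule iprod_least)
    fix x y assume "x \<in> Q" "y \<in> Q"
    then obtain a b c d where *: "a \<in> K.B" "b \<in> K.B" "c \<in> K.B" "d \<in> K.B"
      "x = \<pi> * a + (1 + \<theta>) * b" "y = \<pi> * c + (1 + \<theta>) * d" by (auto simp: Q_def)
    have "x * y = \<pi> * (a * (\<pi> * c)) + \<pi> * ((1 + \<theta>) * (a * d)) + \<pi> * ((1 + \<theta>) * (b * c)) + ((1 + \<theta>) * (1 + \<theta>)) * (b * d)"
      unfolding *(5,6) by (simp add: algebra_simps)
    also have "\<dots> = \<pi> * (a * (\<pi> * c) + (1 + \<theta>) * (a * d) + (1 + \<theta>) * (b * c) + (\<kappa> + k.cj \<pi> * \<theta>) * (b * d))"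
      unfolding sq by (simp add: algebra_simps)
    also have "\<dots> \<in> smul \<pi> K.B"
      by (intro smul_memI K.B_add K.B_mult * o_R[OF pi_o] one_R K.r_B W o_R[OF \<kappa>(1)] o_R[OF cj_pi_o])
    finally show "x * y \<in> smul \<pi> K.B" .
  qed (use mod in \<open>auto simp: is_module_def\<close>)
  have QQid: "is_module K.B (iprod Q Q)" using Q_ideal by (intro iprod_module) (simp add: is_ideal_iff)
  define W where "W = {x. \<pi> * x \<in> iprod Q Q}"
  have Wadd: "x + y \<in> W" if "x \<in> W" "y \<in> W" for x y
    using that QQid unfolding W_def is_module_def by (simp add: distrib_left)
  have Wmul: "a * x \<in> W" if "a \<in> K.B" "x \<in> W" for a x
    using that QQid unfolding W_def is_module_def by (simp add: mult.left_commute)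
  have pW: "\<pi> \<in> W" using iprodI[OF pi_Q pi_Q] by (simp add: W_def)
  have kW: "\<kappa> + k.cj \<pi> * \<theta> \<in> W" using iprodI[OF theta_Q theta_Q] by (simp add: W_def sq)
  have "k.cj \<pi> * \<pi> \<in> W" using o_R[OF cj_pi_o] pW by (rule Wmul)
  then have twoW: "2 \<in> W" using pi_norm by (simp add: mult.commute)
  have cW: "k.cj \<pi> \<in> W"
  proof -
    have "of_int (int (fst pi2)) * 2 + of_int (-1) * \<pi> \<in> W" by (intro Wadd Wmul int_R twoW pW)
    then show ?thesis unfolding pi_trace by (simp add: mult.commute)
  qed
  \<comment> \<open>Removing the multiple of \<open>k.cj \<pi>\<close> leaves
    \<open>\<kappa>\<close>, whose odd norm \<open>m\<close> combines with 2 to give 1.\<close>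
  have "(\<kappa> + k.cj \<pi> * \<theta>) + (of_int (-1) * \<theta>) * k.cj \<pi> \<in> W" by (intro Wadd Wmul kW cW K.B_mult int_R K.r_B)
  then have "\<kappa> \<in> W" by (simp add: mult.commute)
  then have "k.cj \<kappa> * \<kappa> \<in> W" using o_R[OF k.cj_B[OF \<kappa>(1)]] by (intro Wmul)
  then have mW: "of_int m \<in> W" using \<kappa>(4) by (simp add: mult.commute)
  obtain n where n: "m = 2 * n + 1" using \<kappa>(3) by (rule oddE)
  have "of_int m + of_int (- n) * 2 \<in> W" by (intro Wadd Wmul mW int_R twoW)
  then have "1 \<in> W" unfolding n by simp
  then have "x \<in> W" if "x \<in> K.B" for x using Wmul[OF that, of 1] by simp
  then show "smul \<pi> K.B \<subseteq> iprod Q Q" by (auto simp: smul_def W_def)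
qed

text \<open>\<open>\<pi>\<close> is fixed, and \<open>1 - \<theta>\<close> differs from
  \<open>1 + \<theta>\<close> by \<open>2 * \<theta>\<close>, a multiple of
  \<open>\<pi>\<close>.\<close>

lemma cj_Q: "K.cj ` Q = Q"
proof -
  have sub: "K.cj ` Q \<subseteq> Q"
  proof
    fix z assume "z \<in> K.cj ` Q"
    then obtain a b where ab: "a \<in> K.B" "b \<in> K.B" "z = K.cj (\<pi> * a + (1 + \<theta>) * b)" by (auto simp: Q_def)
    have E: "a \<in> K.E" "b \<in> K.E" "\<pi> \<in> K.E" "1 + \<theta> \<in> K.E" "1 \<in> K.E" "\<theta> \<in> K.E"
      using ab K.B_in_E o_R[OF pi_o] one_R K.r_B K.B_add by auto
    have "K.cj \<pi> = \<pi>" by (rule K.cj_F[OF k.B_in_E[OF pi_o]])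
    moreover have "K.cj (1 + \<theta>) = 1 - \<theta>" using E K.cj_add K.cj_r K.cj_1 by simp
    ultimately have "z = \<pi> * K.cj a + (1 - \<theta>) * K.cj b"
      unfolding ab(3) using E by (simp add: K.cj_add K.cj_mult K.E_mult)
    also have "\<dots> = \<pi> * K.cj a + (1 + \<theta>) * K.cj b - 2 * (\<theta> * K.cj b)" by (simp add: algebra_simps)
    also have "\<dots> = \<pi> * (K.cj a + of_int (-1) * (k.cj \<pi> * (\<theta> * K.cj b))) + (1 + \<theta>) * K.cj b"
      unfolding pi_norm[symmetric] by (simp add: algebra_simps)
    also have "\<dots> \<in> Q"
      by (intro Q_I K.B_add K.B_mult int_R K.cj_B ab o_R[OF cj_pi_o] K.r_B)
    finally show "z \<in> Q" .
  qed
  moreover have "Q \<subseteq> K.cj ` Q"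
  proof
    fix z assume z: "z \<in> Q"
    then have "z \<in> K.E" using Q_ideal K.B_in_E by (auto simp: is_ideal_def)
    then have "z = K.cj (K.cj z)" by (simp add: K.cj_cj)
    then show "z \<in> K.cj ` Q" using sub z by blast
  qed
  ultimately show ?thesis by blast
qed

lemma pi_not_norm:
  assumes v: "v \<in> k.B" "v' \<in> k.B" "v * v' = 1" and \<zeta>: "\<zeta> \<in> K.E" and eq: "\<zeta> * K.cj \<zeta> = v * \<pi>"
  shows False
proof -
  define \<rho> where "\<rho> = v * \<pi>"
  have \<rho>o: "\<rho> \<in> k.B" unfolding \<rho>_def by (rule k.B_mult[OF v(1) pi_o])
  obtain x y where xy: "\<rho> = of_int x + of_int y * s" using \<rho>o by (rule o_cases)
  have "\<rho> * k.cj \<rho> = (v * k.cj v) * (\<pi> * k.cj \<pi>)"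
    unfolding \<rho>_def k.cj_mult[OF k.B_in_E[OF v(1)] k.B_in_E[OF pi_o]] by (simp only: mult_ac)
  then have N: "\<rho> * k.cj \<rho> = 2" unfolding o_unit_norm[OF v] pi_norm by simp
  then have "real_of_int (x * x - int p * (y * y)) = of_int 2" unfolding xy k_norm by simp
  then have xy2: "x * x - int p * (y * y) = 2" by (simp only: of_int_eq_iff)
  obtain A B where AB: "A \<in> k.E" "B \<in> k.E" "\<zeta> = A + B * \<theta>" using \<zeta> by (rule K.E_E)
  have "K.cj \<zeta> = A - B * \<theta>" using AB by (simp add: K.cj_rep)
  then have "\<rho> = (A + B * \<theta>) * (A - B * \<theta>)" using eq unfolding \<rho>_def AB(3) by simp
  then have \<rho>: "\<rho> = A * A - s * (B * B)" by (simp add: algebra_simps \<theta>_sq[symmetric])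
  have sE: "s \<in> k.E" by (rule k.r_E)
  \<comment> \<open>The conjugate of a relative norm is nonnegative, which makes \<open>x\<close>
    positive. The sign must be known: \<open>norm_2_nonresidue\<close> speaks of natural numbers,
    and -1 is itself a nonresidue.\<close>
  have "k.cj \<rho> = k.cj A * k.cj A + s * (k.cj B * k.cj B)"
    unfolding \<rho> using AB sE by (simp add: k.cj_diff k.cj_mult k.E_mult k.cj_r)
  also have "\<dots> \<ge> 0" using s_pos by simp
  finally have "k.cj \<rho> \<ge> 0" .
  then have cp: "k.cj \<rho> > 0" using N by (cases "k.cj \<rho> = 0") auto
  then have "\<rho> > 0" using N by (metis zero_less_mult_pos2 zero_less_numeral)
  moreover have "k.cj \<rho> = of_int x - of_int y * s" unfolding xy by (rule k.cj_rep) auto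
  ultimately have "2 * real_of_int x > 0" using cp unfolding xy by linarith
  then have x0: "x > 0" by simp
  obtain m1 m2 where m: "m1 \<in> \<int>" "m1 \<noteq> 0" "m1 * A \<in> k.B" "m2 \<in> \<int>" "m2 \<noteq> 0" "m2 * B \<in> k.B"
    using k.E_frac AB by meson
  then obtain n1 n2 :: int where n: "m1 = of_int n1" "m2 = of_int n2" by (auto elim!: Ints_cases)
  \<comment> \<open>A common denominator of \<open>A\<close> and \<open>B\<close>; its square is the
    factor \<open>z * z\<close> in \<open>relative_norm_residue\<close>.\<close>
  define z where "z = n1 * n2"
  have z0: "z \<noteq> 0" using m n by (auto simp: z_def)
  have "m2 * (m1 * A) \<in> k.B" by (rule k.B_mult[OF Ints_o[OF m(4)] m(3)])
  moreover have "m1 * (m2 * B) \<in> k.B" by (rule k.B_mult[OF Ints_o[OF m(1)] m(6)])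
  ultimately
  have zAB: "of_int z * A \<in> k.B" "of_int z * B \<in> k.B" by (simp_all add: z_def n mult_ac)
  obtain a0 a1 where a: "of_int z * A = of_int a0 + of_int a1 * s" using zAB(1) by (rule o_cases)
  obtain b0 b1 where b: "of_int z * B = of_int b0 + of_int b1 * s" using zAB(2) by (rule o_cases)
  have "of_int (z * z) * \<rho> = (of_int z * A) * (of_int z * A) - s * ((of_int z * B) * (of_int z * B))"
    unfolding \<rho> by (simp add: algebra_simps)
  then have "real_of_int (x * (z * z)) + of_int (y * (z * z)) * s =
      of_int (a0 * a0 + int p * (a1 * a1) - 2 * (int p * (b0 * b1))) + of_int (2 * (a0 * a1) - b0 * b0 - int p * (b1 * b1)) * s"
    unfolding a b xy by (simp add: algebra_simps s_sq[symmetric])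
  then have "x * (z * z) = a0 * a0 + int p * (a1 * a1) - 2 * (int p * (b0 * b1))"
    "y * (z * z) = 2 * (a0 * a1) - b0 * b0 - int p * (b1 * b1)" by (rule k_rep_of_int)+
  then have QR: "QuadRes (int p) x" using z0 by (rule relative_norm_residue)
  have "int (nat x * nat x) = int (p * (nat \<bar>y\<bar> * nat \<bar>y\<bar>) + 2)" using xy2 x0 by simp
  then have "nat x * nat x = p * (nat \<bar>y\<bar> * nat \<bar>y\<bar>) + 2" by (simp only: of_nat_eq_iff)
  then have "\<not> QuadRes (int p) (int (nat x))" by (rule norm_2_nonresidue)
  then show False using QR x0 by simp
qed

lemma Q_not_square:
  assumes J: "is_ideal K.B J" "J \<noteq> {0}" and \<alpha>: "\<alpha> \<in> K.B" "\<alpha> \<noteq> 0" and \<beta>: "\<beta> \<in> K.B" "\<beta> \<noteq> 0"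
    and eq: "smul \<alpha> Q = smul \<beta> (iprod J J)"
  shows False
proof -
  obtain j where j: "is_ideal k.B j" "j \<noteq> {0}" "iprod J (K.cj ` J) = iprod j K.B"
    using K.norm_ideal[OF J] by blast
  have JE: "J \<subseteq> K.E" using J K.B_in_E by (auto simp: is_ideal_def)
  have JJE: "iprod J J \<subseteq> K.E" using iprod_ideal[OF R_subring J(1) J(1)] K.B_in_E by (auto simp: is_ideal_def)
  have QE: "Q \<subseteq> K.E" using Q_ideal K.B_in_E by (auto simp: is_ideal_def)
  have \<alpha>E: "\<alpha> \<in> K.E" and \<beta>E: "\<beta> \<in> K.E" using \<alpha> \<beta> K.B_in_E by auto
  define a where "a = \<alpha> * K.cj \<alpha>"
  define b where "b = \<beta> * K.cj \<beta>"
  have aF: "a \<in> k.E" and bF: "b \<in> k.E" using K.norm_F \<alpha>E \<beta>E by (auto simp: a_def b_def)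
  have a0: "a \<noteq> 0" and b0: "b \<noteq> 0" using \<alpha> \<beta> \<alpha>E \<beta>E K.cj_nz by (auto simp: a_def b_def)
  \<comment> \<open>The relation is conjugated, using \<open>cj_Q\<close>, and multiplied by the
    original one, so that both sides become ideals extended from \<open>k\<close>.\<close>
  have "smul (K.cj \<alpha>) Q = K.cj ` smul \<alpha> Q" using K.cj_smul[OF \<alpha>E QE] cj_Q by simp
  also have "\<dots> = smul (K.cj \<beta>) (iprod (K.cj ` J) (K.cj ` J))"
    unfolding eq K.cj_smul[OF \<beta>E JJE] K.cj_iprod[OF JE JE] ..
  finally have eq2: "smul (K.cj \<alpha>) Q = smul (K.cj \<beta>) (iprod (K.cj ` J) (K.cj ` J))" .
  have "iprod (smul \<alpha> Q) (smul (K.cj \<alpha>) Q) = smul (a * \<pi>) K.B"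
    by (simp add: iprod_smul_left iprod_smul_right smul_smul Q_Q a_def mult_ac)
  moreover have "iprod (smul \<alpha> Q) (smul (K.cj \<alpha>) Q) = smul b (iprod (iprod J J) (iprod (K.cj ` J) (K.cj ` J)))"
    unfolding eq eq2 by (simp add: iprod_smul_left iprod_smul_right smul_smul b_def mult_ac)
  moreover have "iprod (iprod J J) (iprod (K.cj ` J) (K.cj ` J)) = iprod (iprod J (K.cj ` J)) (iprod J (K.cj ` J))"
    by (simp add: iprod_ac)
  moreover have "\<dots> = iprod (iprod j j) K.B" unfolding j(3) by (rule K.iprod_B_B)
  ultimately have "smul (a * \<pi>) K.B = smul b (iprod (iprod j j) K.B)" by simp
  then have eqB: "iprod (smul (a * \<pi>) k.B) K.B = iprod (smul b (iprod j j)) K.B"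
    using K.iprod_smul_A_B[of "a * \<pi>"] iprod_smul_left[of b "iprod j j" K.B] by simp
  have jj: "is_ideal k.B (iprod j j)" by (rule iprod_ideal[OF o_subring j(1) j(1)])
  have piE: "\<pi> \<in> k.E" by (rule k.B_in_E[OF pi_o])
  have "smul (a * \<pi>) k.B = smul b (iprod j j)"
  proof (rule K.iprod_B_inject[OF _ _ _ _ eqB])
    show "smul (a * \<pi>) k.B \<subseteq> k.E"
      using k.E_mult[OF k.E_mult[OF aF piE] k.B_in_E] by (auto simp: smul_def)
    show "smul b (iprod j j) \<subseteq> k.E"
      using k.E_mult[OF bF k.B_in_E] jj by (auto simp: smul_def is_ideal_def)
    show "is_module k.B (smul (a * \<pi>) k.B)" by (rule smul_module[OF subring_module[OF o_subring]])
    show "is_module k.B (smul b (iprod j j))" using jj by (intro smul_module) (simp add: is_ideal_iff)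
  qed
  then have "smul (1 / b) (smul (a * \<pi>) k.B) = smul (1 / b) (smul b (iprod j j))" by simp
  then have jj': "iprod j j = smul (a * \<pi> / b) k.B" using b0 by (simp add: smul_smul)
  have "a * \<pi> / b \<in> k.E" using aF bF k.B_in_E[OF pi_o] by (intro k.E_divide k.E_mult)
  then obtain c where c: "c \<in> k.B" "j = smul c k.B" using o_no_2_torsion[OF j(1,2) _ jj'] by blast
  have "smul (c * c) k.B = smul (a * \<pi> / b) k.B" using jj' unfolding c(2) iprod_principal[OF o_subring] .
  moreover have "a * \<pi> / b \<noteq> 0" using a0 b0 pi_nz by simp
  ultimately obtain v v' where v: "v \<in> k.B" "v' \<in> k.B" "v * v' = 1" "c * c = v * (a * \<pi> / b)"
    using smul_eq_unit[OF o_subring] by meson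
  \<comment> \<open>\<open>c * c\<close> is \<open>v * a * \<pi> / b\<close> with \<open>a\<close>
    and \<open>b\<close> the norms of \<open>\<alpha>\<close> and \<open>\<beta>\<close>, so this
    element has norm \<open>v * \<pi>\<close>.\<close>
  define \<zeta> where "\<zeta> = \<beta> * c / \<alpha>"
  have cE: "c \<in> K.E" by (rule K.F_E[OF k.B_in_E[OF c(1)]])
  have \<zeta>E: "\<zeta> \<in> K.E" unfolding \<zeta>_def using \<alpha>E \<beta>E cE by (intro K.E_divide K.E_mult)
  have "K.cj \<zeta> = K.cj \<beta> * c / K.cj \<alpha>"
    unfolding \<zeta>_def using \<alpha>E \<beta>E cE K.cj_F[OF k.B_in_E[OF c(1)]] by (simp add: K.cj_divide K.cj_mult K.E_mult)
  then have "\<zeta> * K.cj \<zeta> = b * (c * c) / a" by (simp add: \<zeta>_def a_def b_def)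
  also have "\<dots> = v * \<pi>" unfolding v(4) using a0 b0 by simp
  finally show False using pi_not_norm[OF v(1-3) \<zeta>E] by blast
qed

lemma Q_not_principal:
  assumes \<alpha>: "\<alpha> \<in> K.B" "\<alpha> \<noteq> 0" and \<beta>: "\<beta> \<in> K.B" "\<beta> \<noteq> 0"
  shows "smul \<alpha> Q \<noteq> smul \<beta> K.B"
  using Q_not_square[OF subring_ideal[OF R_subring] subring_nonzero[OF R_subring] \<alpha> \<beta>]
  unfolding iprod_ring_left[OF R_subring subring_module[OF R_subring]] by blast

end

section \<open>Units of the quartic field\<close>

context prime7
begin

text \<open>Conjugation in \<open>k\<close> changes the sign of \<open>s\<close>, so the conjugated
  norm is a sum of nonnegative terms. It reflects the complex place of \<open>K\<close>, where
  \<open>\<theta>\<close> goes to a square root of a negative number.\<close>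

lemma cj_norm_rep:
  assumes "A \<in> k.E" "B \<in> k.E"
  shows "(A + B * \<theta>) * K.cj (A + B * \<theta>) = A * A - s * (B * B)"
    "k.cj ((A + B * \<theta>) * K.cj (A + B * \<theta>)) = k.cj A * k.cj A + s * (k.cj B * k.cj B)"
proof -
  have "K.cj (A + B * \<theta>) = A - B * \<theta>" using assms by (rule K.cj_rep)
  then show 1: "(A + B * \<theta>) * K.cj (A + B * \<theta>) = A * A - s * (B * B)"
    by (simp only:) (simp add: algebra_simps \<theta>_sq[symmetric])
  show "k.cj ((A + B * \<theta>) * K.cj (A + B * \<theta>)) = k.cj A * k.cj A + s * (k.cj B * k.cj B)"
    unfolding 1 using assms k.r_E by (simp add: k.cj_diff k.cj_mult k.E_mult k.cj_r)
qed

lemma cj_norm_pos: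
  assumes "z \<in> K.E" "z \<noteq> 0"
  shows "k.cj (z * K.cj z) > 0"
proof -
  obtain A B where AB: "A \<in> k.E" "B \<in> k.E" "z = A + B * \<theta>" using assms(1) by (rule K.E_E)
  have "k.cj (z * K.cj z) \<ge> 0"
    unfolding AB(3) cj_norm_rep(2)[OF AB(1,2)] using s_pos by simp
  moreover have "k.cj (z * K.cj z) \<noteq> 0"
    using K.norm_F[OF assms(1)] K.cj_nz[OF assms] assms(2) k.cj_nz by simp
  ultimately show ?thesis by linarith
qed

definition nrm :: "real \<Rightarrow> real" where "nrm z = (z * K.cj z) * k.cj (z * K.cj z)"

lemma nrm_Ints: "z \<in> K.B \<Longrightarrow> nrm z \<in> \<int>"
  unfolding nrm_def by (rule k.norm_A[OF K.norm_A])

lemma nrm_nz: "z \<in> K.E \<Longrightarrow> z \<noteq> 0 \<Longrightarrow> nrm z \<noteq> 0"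
  using cj_norm_pos[of z] K.cj_nz[of z] by (simp add: nrm_def)

lemma nrm_dvd: "w \<in> K.B \<Longrightarrow> w \<noteq> 0 \<Longrightarrow> nrm w / w \<in> K.B"
proof -
  assume w: "w \<in> K.B" "w \<noteq> 0"
  have "nrm w / w = K.cj w * k.cj (w * K.cj w)" using w by (simp add: nrm_def)
  also have "\<dots> \<in> K.B" by (rule K.B_mult[OF K.cj_B[OF w(1)] o_R[OF k.cj_B[OF K.norm_A[OF w(1)]]]])
  finally show ?thesis .
qed

definition qval :: "int \<times> int \<times> int \<times> int \<Rightarrow> real" where
  "qval = (\<lambda>(a, b, c, d). (of_int a + of_int b * s) + (of_int c + of_int d * s) * \<theta>)"

lemma qval_R: "qval q \<in> K.B"
  by (cases q) (auto simp: qval_def intro!: K.B_I o_I)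

lemma qval_surj: "z \<in> K.B \<Longrightarrow> \<exists>q. z = qval q"
proof -
  assume "z \<in> K.B"
  then obtain A B where AB: "A \<in> k.B" "B \<in> k.B" "z = A + B * \<theta>" by (rule K.B_E)
  obtain a b where a: "A = of_int a + of_int b * s" using AB(1) by (rule o_cases)
  obtain c d where c: "B = of_int c + of_int d * s" using AB(2) by (rule o_cases)
  have "z = qval (a, b, c, d)" by (simp add: qval_def AB a c)
  then show ?thesis by blast
qed

lemma qval_inj: "qval q = qval q' \<Longrightarrow> q = q'"
proof -
  assume eq: "qval q = qval q'"
  obtain a b c d where q: "q = (a, b, c, d)" by (cases q)
  obtain a' b' c' d' where q': "q' = (a', b', c', d')" by (cases q')
  have "real_of_int a + of_int b * s = of_int a' + of_int b' * s"
    "real_of_int c + of_int d * s = of_int c' + of_int d' * s"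
    using K.rep_unique[of "of_int a + of_int b * s" "of_int c + of_int d * s" "of_int a' + of_int b' * s" "of_int c' + of_int d' * s"]
      eq k.B_in_E[OF o_I] by (auto simp: qval_def q q')
  then show ?thesis using k_rep_of_int unfolding q q' by blast
qed

lemma theta_ge_1: "1 \<le> \<theta>"
proof (rule ccontr)
  assume "\<not> 1 \<le> \<theta>"
  then have "\<theta> * \<theta> < 1 * 1" using \<theta>_pos by (intro mult_strict_mono) auto
  then show False using \<theta>_sq s_ge_1 by simp
qed

text \<open>The elements sought are small, have a relative conjugate of order at most
  \<open>M\<close>, and stay bounded at the complex place. Rounding takes care of the last
  condition; a pigeonhole over \<open>(M + 1)^2\<close> candidates makes the value itself
  small.\<close>

lemma small_elements:
  defines "C \<equiv> ((2 * s + 2) * (1 + \<theta>))\<^sup>2 * (1 + s)"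
  assumes "\<epsilon> > 0"
  shows "\<exists>q. qval q \<noteq> 0 \<and> \<bar>nrm (qval q)\<bar> \<le> C \<and> \<bar>qval q / K.cj (qval q)\<bar> < \<epsilon>"
proof -
  \<comment> \<open>The final estimates are \<open>\<bar>z\<bar> < D / M\<close>,
    \<open>\<bar>K.cj z\<bar> \<le> M * D\<close> and at most \<open>1 + s\<close> at the complex
    place, so the absolute norm is bounded by \<open>C = D * D * (1 + s)\<close> whatever
    \<open>M\<close> is.\<close>
  define D where "D = (2 * s + 2) * (1 + \<theta>)"
  have D0: "D > 0" using s_pos \<theta>_pos by (simp add: D_def)
  have CD: "C = D * D * (1 + s)" by (simp add: C_def D_def power2_eq_square)
  then have C0: "C > 0" using D0 s_pos by simp
  obtain M :: nat where M: "C / \<epsilon> < real M" using reals_Archimedean2 by blast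
  have M0: "M > 0" using M C0 assms(2) by (metis divide_pos_pos less_trans of_nat_0_less_iff)
  have ME: "C / real M < \<epsilon>" using M M0 assms(2) by (simp add: field_simps)
  \<comment> \<open>\<open>h c\<close> is the element \<open>\<lceil>c s\<rceil> + c s\<close> of
    \<open>k\<close>, whose conjugate \<open>\<lceil>c s\<rceil> - c s\<close> lies between 0 and
    1.\<close>
  define h where "h = (\<lambda>c::nat. of_int \<lceil>real c * s\<rceil> + real c * s)"
  have h: "0 \<le> h c" "h c \<le> 2 * real M * s + 1" if "c \<le> M" for c
  proof -
    have 0: "0 \<le> real c * s" using s_pos by simp
    have 1: "real c * s \<le> real M * s" using that s_pos by simp
    have 2: "real c * s \<le> of_int \<lceil>real c * s\<rceil>" by (rule le_of_int_ceiling)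
    have 3: "of_int \<lceil>real c * s\<rceil> < real c * s + 1" using ceiling_correct[of "real c * s"] by linarith
    show "0 \<le> h c" unfolding h_def using 0 2 by linarith
    show "h c \<le> 2 * real M * s + 1" unfolding h_def using 1 3 by linarith
  qed
  have ce: "0 \<le> of_int \<lceil>real c * s\<rceil> - real c * s" "of_int \<lceil>real c * s\<rceil> - real c * s < 1" for c
    using ceiling_correct[of "real c * s"] by linarith+
  define f where "f = (\<lambda>(c, d). h c + h d * \<theta>)"
  define I where "I = {0..M} \<times> {0..M}"
  define L where "L = (2 * real M * s + 2) * (1 + \<theta>)"
  have L0: "L > 0" unfolding L_def using s_pos \<theta>_pos by (intro mult_pos_pos add_nonneg_pos) auto
  have M1: "1 \<le> real M" using M0 by simp
  have LM: "(2 * real M * s + 2) * (1 + \<theta>) \<le> real M * D"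
  proof -
    have "2 * real M * s + 2 \<le> real M * (2 * s + 2)" using M1 by (simp add: algebra_simps)
    then have "(2 * real M * s + 2) * (1 + \<theta>) \<le> real M * (2 * s + 2) * (1 + \<theta>)" using \<theta>_pos by (intro mult_right_mono) auto
    then show ?thesis by (simp add: D_def mult_ac)
  qed
  have "\<exists>i\<in>I. \<exists>j\<in>I. i \<noteq> j \<and> \<bar>f i - f j\<bar> < L / real (M * M)"
  proof (rule box_pigeonhole[OF _ _ _ L0])
    show "finite I" by (simp add: I_def)
    show "0 < M * M" using M0 by simp
    show "M * M < card I" by (simp add: I_def)
    fix i assume "i \<in> I"
    then obtain c d where cd: "i = (c, d)" "c \<le> M" "d \<le> M" by (auto simp: I_def)
    have "h d * \<theta> \<le> (2 * real M * s + 1) * \<theta>" "0 \<le> h d * \<theta>" using h[OF cd(3)] \<theta>_pos by (auto intro: mult_right_mono)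
    moreover have "(2 * real M * s + 1) * \<theta> < (2 * real M * s + 2) * \<theta>" using \<theta>_pos by simp
    moreover have "L = (2 * real M * s + 2) + (2 * real M * s + 2) * \<theta>" by (simp add: L_def algebra_simps)
    moreover have "f i = h c + h d * \<theta>" by (simp add: f_def cd)
    ultimately show "0 \<le> f i \<and> f i < L" using h[OF cd(2)] by linarith
  qed
  then obtain c d c' d' where cd: "c \<le> M" "d \<le> M" "c' \<le> M" "d' \<le> M" "(c, d) \<noteq> (c', d')"
    "\<bar>f (c, d) - f (c', d')\<bar> < L / real (M * M)" by (auto simp: I_def)
  define q where "q = (\<lceil>real c * s\<rceil> - \<lceil>real c' * s\<rceil>, int c - int c', \<lceil>real d * s\<rceil> - \<lceil>real d' * s\<rceil>, int d - int d')"
  define z where "z = qval q"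
  define A where "A = real_of_int (\<lceil>real c * s\<rceil> - \<lceil>real c' * s\<rceil>) + of_int (int c - int c') * s"
  define B where "B = real_of_int (\<lceil>real d * s\<rceil> - \<lceil>real d' * s\<rceil>) + of_int (int d - int d') * s"
  have AE: "A \<in> k.E" "B \<in> k.E" unfolding A_def B_def by (rule k.B_in_E[OF o_I])+
  have zAB: "z = A + B * \<theta>" by (simp add: z_def q_def qval_def A_def B_def)
  have Ah: "A = h c - h c'" "B = h d - h d'" by (simp_all add: A_def B_def h_def algebra_simps)
  have zR: "z \<in> K.B" unfolding z_def by (rule qval_R)
  have z0: "z \<noteq> 0"
  proof
    assume "z = 0"
    moreover have "qval (0, 0, 0, 0) = 0" by (simp add: qval_def)
    ultimately have "qval q = qval (0, 0, 0, 0)" by (simp add: z_def)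
    then have "q = (0, 0, 0, 0)" by (rule qval_inj)
    then show False using cd(5) by (simp add: q_def)
  qed
  have "z = f (c, d) - f (c', d')" by (simp add: zAB Ah f_def algebra_simps)
  then have "\<bar>z\<bar> < L / (real M * real M)" using cd by simp
  also have "L / (real M * real M) \<le> (real M * D) / (real M * real M)"
    using LM M1 unfolding L_def by (intro divide_right_mono) auto
  also have "\<dots> = D / real M" using M0 by simp
  finally have zs: "\<bar>z\<bar> < D / real M" .
  have cjz: "K.cj z = A - B * \<theta>" unfolding zAB using AE by (rule K.cj_rep)
  have AB: "\<bar>A\<bar> \<le> 2 * real M * s + 1" "\<bar>B\<bar> \<le> 2 * real M * s + 1"
    using h[OF cd(1)] h[OF cd(2)] h[OF cd(3)] h[OF cd(4)] unfolding Ah by linarith+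
  have "\<bar>K.cj z\<bar> \<le> \<bar>A\<bar> + \<bar>B\<bar> * \<theta>" unfolding cjz using abs_triangle_ineq4[of A "B * \<theta>"] \<theta>_pos by (simp add: abs_mult)
  also have "\<dots> \<le> (2 * real M * s + 2) + (2 * real M * s + 2) * \<theta>"
    using AB \<theta>_pos by (intro add_mono mult_right_mono) auto
  also have "\<dots> \<le> real M * D" using LM by (simp add: algebra_simps)
  finally have cz: "\<bar>K.cj z\<bar> \<le> real M * D" .
  have cjA: "k.cj A = of_int (\<lceil>real c * s\<rceil> - \<lceil>real c' * s\<rceil>) - of_int (int c - int c') * s"
    "k.cj B = of_int (\<lceil>real d * s\<rceil> - \<lceil>real d' * s\<rceil>) - of_int (int d - int d') * s"
    unfolding A_def B_def by (rule k.cj_rep; simp)+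
  have "k.cj A = (of_int \<lceil>real c * s\<rceil> - real c * s) - (of_int \<lceil>real c' * s\<rceil> - real c' * s)"
    "k.cj B = (of_int \<lceil>real d * s\<rceil> - real d * s) - (of_int \<lceil>real d' * s\<rceil> - real d' * s)"
    unfolding cjA by (simp_all add: algebra_simps)
  then have "\<bar>k.cj A\<bar> \<le> 1" "\<bar>k.cj B\<bar> \<le> 1" using ce[of c] ce[of c'] ce[of d] ce[of d'] by linarith+
  then have "k.cj A * k.cj A \<le> 1" "k.cj B * k.cj B \<le> 1"
    by (simp_all add: abs_square_le_1[symmetric] power2_eq_square[symmetric])
  then have "k.cj A * k.cj A + s * (k.cj B * k.cj B) \<le> 1 + s * 1" using s_pos by (intro add_mono mult_left_mono) auto
  then have t1: "k.cj (z * K.cj z) \<le> 1 + s" unfolding zAB cj_norm_rep(2)[OF AE] by simp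
  have t0: "k.cj (z * K.cj z) > 0" by (rule cj_norm_pos[OF K.B_in_E[OF zR] z0])
  have nz: "\<bar>nrm z\<bar> = (\<bar>z\<bar> * \<bar>K.cj z\<bar>) * k.cj (z * K.cj z)" using t0 by (simp add: nrm_def abs_mult)
  have "\<bar>nrm z\<bar> \<le> ((D / real M) * (real M * D)) * (1 + s)"
    unfolding nz using zs cz t1 t0 D0 M0 by (intro mult_mono) auto
  also have "\<dots> = C" using M0 by (simp add: CD)
  finally have n1: "\<bar>nrm z\<bar> \<le> C" .
  obtain n :: int where n: "nrm z = of_int n" using nrm_Ints[OF zR] by (auto elim: Ints_cases)
  have "n \<noteq> 0" using n nrm_nz[OF K.B_in_E[OF zR] z0] by auto
  then have n1': "1 \<le> \<bar>nrm z\<bar>" unfolding n by (metis of_int_abs of_int_1_le_iff zero_less_abs_iff int_one_le_iff_zero_less)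
  have cz0: "K.cj z \<noteq> 0" by (rule K.cj_nz[OF K.B_in_E[OF zR] z0])
  \<comment> \<open>The norm is a nonzero integer, so \<open>\<bar>K.cj z\<bar>\<close> cannot be
    small as well, and the ratio is at most \<open>\<bar>z\<bar>^2 * (1 + s)\<close>.\<close>
  have "1 \<le> (\<bar>z\<bar> * \<bar>K.cj z\<bar>) * (1 + s)"
    using n1' t1 unfolding nz by (meson mult_left_mono order_trans abs_ge_zero mult_nonneg_nonneg)
  then have "\<bar>z\<bar> / \<bar>K.cj z\<bar> \<le> \<bar>z\<bar> * (\<bar>z\<bar> * (1 + s))"
  proof -
    assume "1 \<le> (\<bar>z\<bar> * \<bar>K.cj z\<bar>) * (1 + s)"
    then have "\<bar>z\<bar> * 1 \<le> \<bar>z\<bar> * ((\<bar>z\<bar> * \<bar>K.cj z\<bar>) * (1 + s))" by (rule mult_left_mono) simp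
    then have "\<bar>z\<bar> \<le> \<bar>z\<bar> * (\<bar>z\<bar> * (1 + s)) * \<bar>K.cj z\<bar>" by (simp only: mult_ac mult_1)
    then show ?thesis using cz0 by (simp only: pos_divide_le_eq zero_less_abs_iff simp_thms if_True)
  qed
  also have "\<dots> \<le> (D / real M) * ((D / real M) * (1 + s))"
    using zs s_pos D0 M0 by (intro mult_mono) auto
  also have "\<dots> = C / (real M * real M)" by (simp add: CD)
  also have "\<dots> \<le> C / real M" using C0 M1 by (simp add: field_simps)
  also have "\<dots> < \<epsilon>" by (rule ME)
  finally have "\<bar>z / K.cj z\<bar> < \<epsilon>" by (simp add: abs_divide)
  then show ?thesis using n1 z0 unfolding z_def by blast
qed

text \<open>Elements \<open>z\<close>, \<open>w\<close> with the same absolute norm \<open>m\<close>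
  and congruent modulo \<open>m\<close> differ by a unit \<open>w / z\<close>. Dividing this unit by
  its conjugate gives relative norm one, and comparing \<open>\<bar>z / K.cj z\<bar>\<close> rather
  than sizes keeps the result away from 1 and -1.\<close>

lemma norm_one_unit_exists: "\<exists>\<eta>\<in>K.B. \<eta> * K.cj \<eta> = 1 \<and> \<eta> > 1"
proof -
  define C where "C = ((2 * s + 2) * (1 + \<theta>))\<^sup>2 * (1 + s)"
  define S where "S = {q. qval q \<noteq> 0 \<and> \<bar>nrm (qval q)\<bar> \<le> C}"
  define \<mu> where "\<mu> = (\<lambda>q. \<bar>qval q / K.cj (qval q)\<bar>)"
  define n where "n = (\<lambda>q. \<lfloor>nrm (qval q)\<rfloor>)"
  define g where "g = (\<lambda>q. case q of (a, b, c, d) \<Rightarrow> (n q, a mod n q, b mod n q, c mod n q, d mod n q))"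
  have nn: "nrm (qval q) = of_int (n q)" for q
    using nrm_Ints[OF qval_R, of q] unfolding n_def by (auto elim: Ints_cases)
  have n0: "n q \<noteq> 0" if "q \<in> S" for q
    using nrm_nz[OF K.B_in_E[OF qval_R], of q] that nn[of q] by (auto simp: S_def)
  have "\<exists>z\<in>S. \<exists>w\<in>S. g z = g w \<and> 0 < \<mu> z \<and> \<mu> z < \<mu> w"
  proof (rule small_pigeonhole)
    fix \<epsilon> :: real assume "\<epsilon> > 0"
    then obtain q where q: "qval q \<noteq> 0" "\<bar>nrm (qval q)\<bar> \<le> C" "\<bar>qval q / K.cj (qval q)\<bar> < \<epsilon>"
      using small_elements unfolding C_def by blast
    moreover have "K.cj (qval q) \<noteq> 0" by (rule K.cj_nz[OF K.B_in_E[OF qval_R] q(1)])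
    ultimately show "\<exists>z\<in>S. 0 < \<mu> z \<and> \<mu> z < \<epsilon>" by (intro bexI[of _ q]) (auto simp: S_def \<mu>_def)
  next
    define T where "T = {-\<lceil>C\<rceil>..\<lceil>C\<rceil>}"
    have "g ` S \<subseteq> T \<times> T \<times> T \<times> T \<times> T"
    proof
      fix x assume "x \<in> g ` S"
      then obtain q where q: "q \<in> S" "x = g q" by auto
      obtain a b c d where abcd: "q = (a, b, c, d)" by (cases q)
      have "real_of_int \<bar>n q\<bar> \<le> C" using q nn[of q] by (simp add: S_def)
      also have "\<dots> \<le> of_int \<lceil>C\<rceil>" by (rule le_of_int_ceiling)
      finally have nC: "\<bar>n q\<bar> \<le> \<lceil>C\<rceil>" by (simp only: of_int_le_iff)
      have "y mod n q \<in> T" for y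
        using nC abs_mod_less[OF n0[OF q(1)], of y] unfolding T_def by auto
      moreover have "n q \<in> T" using nC unfolding T_def by auto
      ultimately show "x \<in> T \<times> T \<times> T \<times> T \<times> T" unfolding q(2) g_def abcd by simp
    qed
    then show "finite (g ` S)" by (rule finite_subset) (simp add: T_def)
  qed
  then obtain q q' where q: "q \<in> S" "q' \<in> S" "g q = g q'" "0 < \<mu> q" "\<mu> q < \<mu> q'" by blast
  obtain a b c d where q1: "q = (a, b, c, d)" by (cases q)
  obtain a' b' c' d' where q2: "q' = (a', b', c', d')" by (cases q')
  define m where "m = n q"
  have m: "n q' = m" "a mod m = a' mod m" "b mod m = b' mod m" "c mod m = c' mod m" "d mod m = d' mod m"
    using q(3) unfolding g_def q1 q2 m_def by auto
  then have "m dvd a - a'" "m dvd b - b'" "m dvd c - c'" "m dvd d - d'" by (simp_all add: mod_eq_dvd_iff)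
  then obtain e1 e2 e3 e4 where e: "a = a' + m * e1" "b = b' + m * e2" "c = c' + m * e3" "d = d' + m * e4"
    by (auto simp: dvd_def algebra_simps)
  define z where "z = qval q"
  define w where "w = qval q'"
  define \<rho> where "\<rho> = qval (e1, e2, e3, e4)"
  have R: "z \<in> K.B" "w \<in> K.B" "\<rho> \<in> K.B" unfolding z_def w_def \<rho>_def by (rule qval_R)+
  have nz: "z \<noteq> 0" "w \<noteq> 0" using q by (auto simp: S_def z_def w_def)
  have N: "nrm z = of_int m" "nrm w = of_int m" using nn[of q] nn[of q'] m by (auto simp: m_def z_def w_def)
  have zw: "z = w + of_int m * \<rho>"
    unfolding z_def w_def \<rho>_def q1 q2 qval_def using e by (simp add: algebra_simps)
  \<comment> \<open>\<open>m\<close> is the norm of \<open>w\<close>, so \<open>m / w\<close> is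
    integral by \<open>nrm_dvd\<close>, and \<open>z = w + m * \<rho>\<close> can be divided by
    \<open>w\<close>.\<close>
  have u1: "z / w \<in> K.B"
  proof -
    have "z / w = 1 + (nrm w / w) * \<rho>" using nz unfolding N zw by (simp add: field_simps)
    also have "\<dots> \<in> K.B" using R nz by (intro K.B_add K.B_mult nrm_dvd one_R)
    finally show ?thesis .
  qed
  have u2: "w / z \<in> K.B"
  proof -
    have "w / z = 1 - (nrm z / z) * \<rho>" using nz zw unfolding N by (simp add: field_simps)
    also have "\<dots> \<in> K.B" using R nz by (intro K.B_diff K.B_mult nrm_dvd one_R)
    finally show ?thesis .
  qed
  have E: "z \<in> K.E" "w \<in> K.E" using R K.B_in_E by auto
  define \<eta> where "\<eta> = (w / z) * K.cj (z / w)"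
  have \<eta>R: "\<eta> \<in> K.B" unfolding \<eta>_def using u1 u2 by (intro K.B_mult K.cj_B)
  have cz: "K.cj z \<noteq> 0" "K.cj w \<noteq> 0" using E nz K.cj_nz by auto
  have \<eta>1: "\<eta> = (w / z) * (K.cj z / K.cj w)" unfolding \<eta>_def using E by (simp add: K.cj_divide)
  have \<eta>2: "K.cj \<eta> = (K.cj w / K.cj z) * (z / w)"
    unfolding \<eta>1 K.cj_mult[OF K.E_divide[OF E(2,1)] K.E_divide[OF K.cj_E[OF E(1)] K.cj_E[OF E(2)]]]
      K.cj_divide[OF E(2,1)] K.cj_divide[OF K.cj_E[OF E(1)] K.cj_E[OF E(2)]] K.cj_cj[OF E(1)] K.cj_cj[OF E(2)] ..
  have \<eta>N: "\<eta> * K.cj \<eta> = 1" unfolding \<eta>2 unfolding \<eta>1 using nz cz by simp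
  have "\<bar>\<eta>\<bar> = \<mu> q' / \<mu> q" unfolding \<eta>1 \<mu>_def z_def w_def by (simp add: abs_mult abs_divide)
  then have \<eta>gt: "\<bar>\<eta>\<bar> > 1" using q by simp
  show ?thesis
  proof (cases "\<eta> > 0")
    case True
    then show ?thesis using \<eta>gt \<eta>R \<eta>N by auto
  next
    case False
    have "- \<eta> \<in> K.B" using K.B_diff[OF zero_R \<eta>R] by simp
    moreover have "(- \<eta>) * K.cj (- \<eta>) = 1" using \<eta>N K.cj_minus[OF K.B_in_E[OF \<eta>R]] by simp
    moreover have "- \<eta> > 1" using False \<eta>gt by simp
    ultimately show ?thesis by blast
  qed
qed

text \<open>\<open>\<eta>\<close> and its conjugate \<open>1 / \<eta>\<close> are bounded, and at
  the complex place the absolute value is 1; bounds at all places bound the four integer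
  coordinates.\<close>

lemma norm_one_units_finite: "finite {\<eta> \<in> K.B. \<eta> * K.cj \<eta> = 1 \<and> 1 < \<eta> \<and> \<eta> \<le> X}"
proof -
  define T where "T = {-\<lceil>X + 1\<rceil>..\<lceil>X + 1\<rceil>}"
  have "{\<eta> \<in> K.B. \<eta> * K.cj \<eta> = 1 \<and> 1 < \<eta> \<and> \<eta> \<le> X} \<subseteq> qval ` (T \<times> T \<times> T \<times> T)"
  proof
    fix \<eta> assume "\<eta> \<in> {\<eta> \<in> K.B. \<eta> * K.cj \<eta> = 1 \<and> 1 < \<eta> \<and> \<eta> \<le> X}"
    then have \<eta>: "\<eta> \<in> K.B" "\<eta> * K.cj \<eta> = 1" "1 < \<eta>" "\<eta> \<le> X" by auto
    obtain a b c d where q: "\<eta> = qval (a, b, c, d)" using qval_surj[OF \<eta>(1)] by auto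
    define A where "A = of_int a + of_int b * s"
    define B where "B = of_int c + of_int d * s"
    have AE: "A \<in> k.E" "B \<in> k.E" unfolding A_def B_def by (rule k.B_in_E[OF o_I])+
    have AB: "\<eta> = A + B * \<theta>" by (simp add: q qval_def A_def B_def)
    have cj: "K.cj \<eta> = A - B * \<theta>" unfolding AB using AE by (rule K.cj_rep)
    have cjpos: "K.cj \<eta> > 0" "K.cj \<eta> < 1"
    proof -
      have "K.cj \<eta> = 1 / \<eta>" using \<eta>(2,3) by (simp add: field_simps)
      then show "K.cj \<eta> > 0" "K.cj \<eta> < 1" using \<eta>(3) by simp_all
    qed
    have "\<bar>A\<bar> \<le> X" "\<bar>B * \<theta>\<bar> \<le> X" using cj AB cjpos \<eta> by linarith+
    moreover have "\<bar>B\<bar> \<le> \<bar>B * \<theta>\<bar>" using theta_ge_1 mult_left_mono[of 1 \<theta> "\<bar>B\<bar>"] by (simp add: abs_mult)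
    ultimately have ABX: "\<bar>A\<bar> \<le> X" "\<bar>B\<bar> \<le> X" by linarith+
    have "k.cj A * k.cj A + s * (k.cj B * k.cj B) = 1"
      using cj_norm_rep(2)[OF AE] \<eta>(2) k.cj_1 unfolding AB by simp
    moreover have "0 \<le> k.cj A * k.cj A" "0 \<le> k.cj B * k.cj B" "k.cj B * k.cj B \<le> s * (k.cj B * k.cj B)"
      using s_ge_1 mult_right_mono[of 1 s "k.cj B * k.cj B"] by auto
    ultimately have "k.cj A * k.cj A \<le> 1" "k.cj B * k.cj B \<le> 1" by linarith+
    then have cAB: "\<bar>k.cj A\<bar> \<le> 1" "\<bar>k.cj B\<bar> \<le> 1" by (simp_all add: abs_square_le_1 power2_eq_square[symmetric])
    have cjAB: "k.cj A = of_int a - of_int b * s" "k.cj B = of_int c - of_int d * s"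
      unfolding A_def B_def by (rule k.cj_rep; simp)+
    have coord: "\<bar>x\<bar> \<le> \<lceil>X + 1\<rceil>" "\<bar>y\<bar> \<le> \<lceil>X + 1\<rceil>"
      if xy: "\<bar>of_int x + of_int y * s\<bar> \<le> X" "\<bar>of_int x - of_int y * s\<bar> \<le> 1" for x y :: int
    proof -
      have 1: "\<bar>real_of_int x\<bar> \<le> X + 1" "\<bar>of_int y * s\<bar> \<le> X + 1" using xy \<eta> by linarith+
      moreover have "\<bar>real_of_int y\<bar> \<le> \<bar>of_int y * s\<bar>"
        using s_ge_1 mult_left_mono[of 1 s "\<bar>real_of_int y\<bar>"] by (simp add: abs_mult)
      ultimately have "real_of_int \<bar>x\<bar> \<le> X + 1" "real_of_int \<bar>y\<bar> \<le> X + 1" by auto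
      then show "\<bar>x\<bar> \<le> \<lceil>X + 1\<rceil>" "\<bar>y\<bar> \<le> \<lceil>X + 1\<rceil>" by linarith+
    qed
    have "\<bar>a\<bar> \<le> \<lceil>X + 1\<rceil>" "\<bar>b\<bar> \<le> \<lceil>X + 1\<rceil>" "\<bar>c\<bar> \<le> \<lceil>X + 1\<rceil>" "\<bar>d\<bar> \<le> \<lceil>X + 1\<rceil>"
      using coord[of a b] coord[of c d] ABX cAB unfolding cjAB unfolding A_def B_def by blast+
    then have "(a, b, c, d) \<in> T \<times> T \<times> T \<times> T" unfolding T_def by auto
    then show "\<eta> \<in> qval ` (T \<times> T \<times> T \<times> T)" using q by blast
  qed
  then show ?thesis by (rule finite_subset) (simp add: T_def)
qed

lemma minimal_norm_one_unit:
  "\<exists>\<eta>\<in>K.B. \<eta> * K.cj \<eta> = 1 \<and> \<eta> > 1 \<and> (\<forall>\<xi>\<in>K.B. \<xi> * K.cj \<xi> = 1 \<longrightarrow> \<xi> > 1 \<longrightarrow> \<eta> \<le> \<xi>)"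
proof -
  obtain \<eta>0 where \<eta>0: "\<eta>0 \<in> K.B" "\<eta>0 * K.cj \<eta>0 = 1" "\<eta>0 > 1" using norm_one_unit_exists by blast
  define U where "U = {\<eta> \<in> K.B. \<eta> * K.cj \<eta> = 1 \<and> 1 < \<eta> \<and> \<eta> \<le> \<eta>0}"
  have fin: "finite U" unfolding U_def by (rule norm_one_units_finite)
  have "\<eta>0 \<in> U" using \<eta>0 by (simp add: U_def)
  then have min: "Min U \<in> U" using fin by (intro Min_in) auto
  have "Min U \<le> \<xi>" if "\<xi> \<in> K.B" "\<xi> * K.cj \<xi> = 1" "\<xi> > 1" for \<xi>
  proof (cases "\<xi> \<le> \<eta>0")
    case True
    then show ?thesis using that fin by (intro Min_le) (auto simp: U_def)
  next
    case False
    then show ?thesis using min by (auto simp: U_def)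
  qed
  then show ?thesis using min unfolding U_def by blast
qed

text \<open>In \<open>K\<close> the factor \<open>s\<close> is the square of
  \<open>\<theta>\<close>, \<open>\<pi>\<close> generates \<open>Q^2\<close>, and 2 is
  \<open>\<pi> * \<pi>\<close> up to a unit, so the square root of the ideal can be written down. In
  the principal case the unit of \<open>k\<close> is recorded for the comparison of elements in
  \<open>unit_with_nonsquare_norm\<close>.\<close>

lemma square_root_cases:
  assumes M: "is_ideal K.B M" "M \<noteq> {0}" and x: "x \<in> k.B" "x \<noteq> 0" and g: "g \<in> {1, s}" and f: "f \<in> {1, \<pi>, 2}"
    and eq: "iprod M M = smul (x * x * g * f) K.B"
  shows "(\<exists>y\<in>K.B. y \<noteq> 0 \<and> M = smul y K.B \<and> (\<exists>v\<in>k.B. \<exists>v'\<in>k.B. v * v' = 1 \<and> x * x * g * f = v * (y * y)))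
    \<or> (\<exists>y\<in>K.B. y \<noteq> 0 \<and> M = smul y Q)"
proof -
  define G where "G = (if g = 1 then 1 else \<theta>)"
  have G: "g = G * G" "G \<in> K.B" "G \<noteq> 0" using g \<theta>_sq \<theta>_pos K.r_B one_R by (auto simp: G_def)
  have xG: "x * G \<in> K.B" "x * G \<noteq> 0" using x G o_R K.B_mult by auto
  have R_ideal: "is_ideal K.B (smul y K.B)" "smul y K.B \<noteq> {0}" if "y \<in> K.B" "y \<noteq> 0" for y
    using ideal_smul[OF R_subring that(1) subring_ideal[OF R_subring]] smul_nonzero[OF that(2) subring_nonzero[OF R_subring]] by auto
  have square: "M = smul y K.B" if "y \<in> K.B" "y \<noteq> 0" "iprod M M = smul (y * y) K.B" for y
    by (rule K.BE.square_root_unique[OF M R_ideal[OF that(1,2)]]) (simp add: that(3) iprod_principal[OF R_subring])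
  have unit: "smul v K.B = K.B" if "v \<in> k.B" "v' \<in> k.B" "v * v' = 1" for v v'
    by (rule smul_unit[OF R_subring subring_module[OF R_subring] o_R[OF that(1)] o_R[OF that(2)] that(3)])
  consider "f = 1" | "f = \<pi>" | "f = 2" using f by blast
  then show ?thesis
  proof cases
    case 1
    then have eq': "x * x * g * f = (x * G) * (x * G)" using G by simp
    then have "M = smul (x * G) K.B" using eq eq' by (intro square xG) metis
    moreover have "x * x * g * f = 1 * ((x * G) * (x * G))" using eq' by simp
    moreover have "(1::real) \<in> k.B" by (rule Ints_o) simp
    ultimately show ?thesis using xG by (metis mult.right_neutral)
  next
    case 2
    have "iprod M M = iprod (smul (x * G) Q) (smul (x * G) Q)"
      using eq unfolding 2 G(1) by (simp add: iprod_smul_left iprod_smul_right Q_Q smul_smul mult_ac)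
    then have "M = smul (x * G) Q"
      by (rule K.BE.square_root_unique[OF M ideal_smul[OF R_subring xG(1) Q_ideal] smul_nonzero[OF xG(2) Q_nonzero]])
    then show ?thesis using xG by blast
  next
    case 3
    obtain v v' where v: "v \<in> k.B" "v' \<in> k.B" "v * v' = 1" "\<pi> * \<pi> = 2 * v" using two_unit by blast
    define y where "y = x * G * \<pi>"
    have y: "y \<in> K.B" "y \<noteq> 0" using xG o_R[OF pi_o] pi_nz K.B_mult by (auto simp: y_def)
    have "v' * (y * y) = (x * G) * (x * G) * (v' * (\<pi> * \<pi>))" by (simp add: y_def)
    also have "\<dots> = (x * G) * (x * G) * (2 * (v * v'))" unfolding v(4) by simp
    also have "\<dots> = x * x * g * f" unfolding 3 v(3) G(1) by simp
    finally have e: "x * x * g * f = v' * (y * y)" by simp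
    have "iprod M M = smul (y * y) (smul v' K.B)" unfolding eq e by (simp add: smul_smul mult.commute)
    also have "smul v' K.B = K.B" using unit[of v' v] v by (simp add: mult.commute)
    finally have "M = smul y K.B" by (rule square[OF y])
    then show ?thesis using e y v by (metis mult.commute)
  qed
qed

text \<open>The conjugate of a nonzero relative norm is positive, hence so is \<open>k.cj v\<close>,
  and \<open>v * k.cj v = 1\<close>.\<close>

lemma norm_unit_pos:
  assumes z: "z \<in> K.E" "z \<noteq> 0" and v: "v \<in> k.B" "v' \<in> k.B" "v * v' = 1" and c: "c \<in> k.E"
    and eq: "z * K.cj z = v * (c * c)"
  shows "v > 0"
proof -
  have vE: "v \<in> k.E" by (rule k.B_in_E[OF v(1)])
  have "k.cj (z * K.cj z) = k.cj v * (k.cj c * k.cj c)"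
    unfolding eq using vE c by (simp add: k.cj_mult k.E_mult)
  then have "0 < k.cj v * (k.cj c * k.cj c)" using cj_norm_pos[OF z] by simp
  moreover have "0 \<le> k.cj c * k.cj c" by simp
  ultimately have "k.cj v > 0" by (metis linorder_not_less mult_nonpos_nonneg)
  then show ?thesis using o_unit_norm[OF v] by (metis zero_less_mult_pos2 zero_less_one)
qed

lemma relative_unit_norm:
  assumes "\<kappa> \<in> K.B" "\<kappa>' \<in> K.B" "\<kappa> * \<kappa>' = 1"
  shows "\<kappa> * K.cj \<kappa> \<in> k.B" "\<kappa>' * K.cj \<kappa>' \<in> k.B" "(\<kappa> * K.cj \<kappa>) * (\<kappa>' * K.cj \<kappa>') = 1" "\<kappa> * K.cj \<kappa> > 0"
proof -
  show 1: "\<kappa> * K.cj \<kappa> \<in> k.B" "\<kappa>' * K.cj \<kappa>' \<in> k.B" using assms K.norm_A by auto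
  have "(\<kappa> * K.cj \<kappa>) * (\<kappa>' * K.cj \<kappa>') = (\<kappa> * \<kappa>') * K.cj (\<kappa> * \<kappa>')"
    unfolding K.cj_mult[OF K.B_in_E[OF assms(1)] K.B_in_E[OF assms(2)]] by (simp only: mult_ac)
  then show 2: "(\<kappa> * K.cj \<kappa>) * (\<kappa>' * K.cj \<kappa>') = 1" using assms by simp
  have "\<kappa> \<noteq> 0" using assms by auto
  then show "\<kappa> * K.cj \<kappa> > 0"
    using norm_unit_pos[of \<kappa> "\<kappa> * K.cj \<kappa>" _ 1] 1 2 K.B_in_E[OF assms(1)] k.F_E[of 1] by auto
qed

text \<open>If all units had square norms, then \<open>1 + \<eta>\<close>, with \<open>\<eta>\<close> minimal of norm one, would show that \<open>\<eta>\<close> is a square.\<close>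

lemma unit_with_nonsquare_norm:
  "\<exists>\<eta>\<in>K.B. \<exists>\<eta>'\<in>K.B. \<eta> * \<eta>' = 1 \<and> (\<exists>w\<in>k.B. w * w = 2 * (\<eta> * K.cj \<eta>))"
proof (rule ccontr)
  assume neg: "\<not> ?thesis"
  obtain \<eta> where \<eta>: "\<eta> \<in> K.B" "\<eta> * K.cj \<eta> = 1" "\<eta> > 1"
    and min: "\<And>\<xi>. \<xi> \<in> K.B \<Longrightarrow> \<xi> * K.cj \<xi> = 1 \<Longrightarrow> \<xi> > 1 \<Longrightarrow> \<eta> \<le> \<xi>"
    using minimal_norm_one_unit by blast
  have \<eta>E: "\<eta> \<in> K.E" by (rule K.B_in_E[OF \<eta>(1)])
  have RR: "iprod K.B K.B = K.B" by (rule iprod_ring_left[OF R_subring subring_module[OF R_subring]])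
  have "smul \<eta> K.B = K.B"
    by (rule smul_unit[OF R_subring subring_module[OF R_subring] \<eta>(1) K.cj_B[OF \<eta>(1)] \<eta>(2)])
  \<comment> \<open>The instance is the unit ideal with \<open>\<delta> = \<eta>\<close> and
    \<open>c = 1\<close>, legitimate since \<open>\<eta>\<close> is a unit of norm one.\<close>
  then have II: "iprod K.B K.B = smul \<eta> K.B" using RR by simp
  have IcI: "iprod K.B (K.cj ` K.B) = smul 1 K.B" unfolding K.cj_B_image RR by simp
  have nz: "\<eta> + 1 \<noteq> 0" using \<eta> by simp
  have one: "1 \<in> k.E" by (rule k.F_E) simp
  define \<gamma> where "\<gamma> = K.cj \<eta> + 1"
  obtain x g f v v' where g: "\<gamma> \<in> K.B" "\<gamma> \<noteq> 0" and x: "x \<in> k.B" "g \<in> {1, s}" "f \<in> {1, \<pi>, 2}"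
    "v \<in> k.B" "v' \<in> k.B" "v * v' = 1" "x \<noteq> 0"
    "iprod (smul \<gamma> K.B) (smul \<gamma> K.B) = smul (x * x * g * f) K.B"
    "\<gamma> * \<gamma> * 1 * 1 = K.cj \<eta> * (v * (x * x) * g * f)"
    by (rule K.ambiguous_class[OF subring_ideal[OF R_subring] subring_nonzero[OF R_subring] \<eta>E nz one II IcI, folded \<gamma>_def])
      (use \<eta> in simp)
  have gi: "is_ideal K.B (smul \<gamma> K.B)" "smul \<gamma> K.B \<noteq> {0}"
    using ideal_smul[OF R_subring g(1) subring_ideal[OF R_subring]] smul_nonzero[OF g(2) subring_nonzero[OF R_subring]] by auto
  \<comment> \<open>This alternative of \<open>square_root_cases\<close> would make \<open>Q\<close>
    principal.\<close>
  have "\<not> (\<exists>y\<in>K.B. y \<noteq> 0 \<and> smul \<gamma> K.B = smul y Q)" using Q_not_principal g by metis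
  then obtain y u u' where y: "y \<in> K.B" "y \<noteq> 0" and u: "u \<in> k.B" "u' \<in> k.B" "u * u' = 1" "x * x * g * f = u * (y * y)"
    using square_root_cases[OF gi x(1,7,2,3,8)] by blast
  define e where "e = v * u"
  have e: "e \<in> k.B" "v' * u' \<in> k.B" "e * (v' * u') = 1"
  proof -
    show "e \<in> k.B" "v' * u' \<in> k.B" unfolding e_def using x u k.B_mult by auto
    have "e * (v' * u') = (v * v') * (u * u')" by (simp add: e_def)
    then show "e * (v' * u') = 1" using x u by simp
  qed
  define \<kappa> where "\<kappa> = \<gamma> / y"
  have "\<gamma> * \<gamma> = K.cj \<eta> * (v * (x * x * g * f))" using x(9) by (simp add: mult_ac)
  then have "\<gamma> * \<gamma> = K.cj \<eta> * e * (y * y)" unfolding u(4) by (simp add: e_def mult_ac)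
  \<comment> \<open>So \<open>K.cj \<eta>\<close>, the inverse of \<open>\<eta>\<close>, is a square
    up to the unit \<open>e\<close> of \<open>k\<close>; it remains to see that \<open>e\<close> is
    a square in \<open>k\<close>.\<close>
  then have kk: "\<kappa> * \<kappa> = K.cj \<eta> * e" using y by (simp add: \<kappa>_def field_simps)
  have \<kappa>E: "\<kappa> \<in> K.E" unfolding \<kappa>_def using g y K.B_in_E by (intro K.E_divide)
  have \<kappa>: "\<kappa> \<in> K.B"
    by (rule K.BE.sq_closed[OF \<kappa>E]) (unfold kk, intro K.B_mult K.cj_B \<eta> o_R e)
  define \<kappa>' where "\<kappa>' = \<kappa> * \<eta> * (v' * u')"
  have \<kappa>': "\<kappa>' \<in> K.B" unfolding \<kappa>'_def by (intro K.B_mult \<kappa> \<eta>(1) o_R[OF e(2)])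
  have "\<kappa> * \<kappa>' = (\<kappa> * \<kappa>) * (\<eta> * (v' * u'))" by (simp add: \<kappa>'_def)
  also have "\<dots> = (\<eta> * K.cj \<eta>) * (e * (v' * u'))" unfolding kk by (simp only: mult_ac)
  also have "\<dots> = 1" using \<eta> e by simp
  finally have \<kappa>\<kappa>: "\<kappa> * \<kappa>' = 1" .
  note Nk = relative_unit_norm[OF \<kappa> \<kappa>' \<kappa>\<kappa>]
  \<comment> \<open>The positive unit \<open>\<kappa> * K.cj \<kappa>\<close> is a square or half a
    square; the second is what the assumption to be refuted forbids.\<close>
  obtain w where w: "w \<in> k.B" "w * w = \<kappa> * K.cj \<kappa>"
    using o_unit_square[OF Nk] neg \<kappa> \<kappa>' \<kappa>\<kappa> by metis
  define w' where "w' = w * (\<kappa>' * K.cj \<kappa>')"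
  have w': "w' \<in> k.B" unfolding w'_def by (rule k.B_mult[OF w(1) Nk(2)])
  have "w * w' = (w * w) * (\<kappa>' * K.cj \<kappa>')" by (simp add: w'_def)
  then have ww: "w * w' = 1" unfolding w(2) using Nk(3) by simp
  \<comment> \<open>Taking norms in \<open>\<kappa> * \<kappa> = K.cj \<eta> * e\<close> gives
    \<open>w^4 = e^2\<close>, hence \<open>e\<close> up to sign; the sign is settled because
    \<open>\<xi> * \<xi>\<close> is not negative while \<open>K.cj \<eta>\<close> is
    positive.\<close>
  have "(w * w) * (w * w) = (\<kappa> * \<kappa>) * K.cj (\<kappa> * \<kappa>)"
    unfolding w(2) K.cj_mult[OF \<kappa>E \<kappa>E] by (simp only: mult_ac)
  also have "\<dots> = (K.cj \<eta> * \<eta>) * (e * e)"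
    unfolding kk using \<eta>E e K.cj_F[OF k.B_in_E[OF e(1)]] K.F_E[OF k.B_in_E[OF e(1)]]
    by (simp add: K.cj_mult K.cj_E K.cj_cj)
  finally have "(w * w - e) * (w * w + e) = 0" using \<eta>(2) by (simp add: algebra_simps)
  then have we: "e = w * w \<or> e = - (w * w)" by auto
  define \<xi> where "\<xi> = \<kappa> * w'"
  have \<xi>: "\<xi> \<in> K.B" unfolding \<xi>_def by (intro K.B_mult \<kappa> o_R[OF w'])
  have "\<xi> * \<xi> = (\<kappa> * \<kappa>) * (w' * w')" by (simp add: \<xi>_def)
  then have ll: "\<xi> * \<xi> = K.cj \<eta> * (e * (w' * w'))" unfolding kk by simp
  have w2: "(w * w) * (w' * w') = 1" using ww by (metis mult.assoc mult.left_commute mult.right_neutral)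
  have cjeta: "K.cj \<eta> > 0" using \<eta> by (metis zero_less_mult_pos zero_less_one less_trans)
  have lsq: "\<xi> * \<xi> = K.cj \<eta>"
    using we
  proof
    assume "e = w * w"
    then show ?thesis using ll w2 by simp
  next
    assume "e = - (w * w)"
    then have "\<xi> * \<xi> = - K.cj \<eta>" using ll w2 by simp
    then have "0 \<le> - K.cj \<eta>" by (metis zero_le_square)
    then show ?thesis using cjeta by linarith
  qed
  have w'E: "w' \<in> k.E" by (rule k.B_in_E[OF w'])
  have "\<xi> * K.cj \<xi> = (\<kappa> * K.cj \<kappa>) * (w' * w')"
    unfolding \<xi>_def using \<kappa>E K.F_E[OF w'E] K.cj_F[OF w'E] by (simp add: K.cj_mult)
  then have lN: "\<xi> * K.cj \<xi> = 1" using w2 unfolding w(2)[symmetric] by simp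
  have lE: "\<xi> \<in> K.E" by (rule K.B_in_E[OF \<xi>])
  have clsq: "K.cj \<xi> * K.cj \<xi> = \<eta>" using lsq K.cj_mult[OF lE lE] K.cj_cj[OF \<eta>E] by simp
  \<comment> \<open>\<open>\<tau>\<close> is a square root of \<open>\<eta>\<close> of norm one, so
    it lies strictly between 1 and \<open>\<eta>\<close>, against minimality.\<close>
  define \<tau> where "\<tau> = \<bar>K.cj \<xi>\<bar>"
  have \<tau>: "\<tau> * \<tau> = \<eta>" "\<tau> \<ge> 0" using clsq by (auto simp: \<tau>_def)
  have "\<tau> > 1"
  proof (rule ccontr)
    assume "\<not> \<tau> > 1"
    then have "\<tau> * \<tau> \<le> 1 * 1" using \<tau>(2) by (intro mult_mono) auto
    then show False using \<tau> \<eta> by simp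
  qed
  then have "1 * \<tau> < \<tau> * \<tau>" by (intro mult_strict_right_mono) auto
  then have "\<tau> < \<eta>" using \<tau> by simp
  moreover have "\<tau> \<in> K.B" unfolding \<tau>_def using K.cj_B[OF \<xi>] K.B_diff[OF zero_R K.cj_B[OF \<xi>]] by (simp add: abs_if)
  moreover have "\<tau> * K.cj \<tau> = 1"
    unfolding \<tau>_def using lN K.cj_cj[OF lE] K.cj_minus[OF K.cj_E[OF lE]] by (simp add: abs_if mult.commute)
  ultimately show False using min[of \<tau>] \<open>\<tau> > 1\<close> by linarith
qed

lemma ambiguous_ideal_class:
  assumes I: "is_ideal K.B I" "I \<noteq> {0}" and \<alpha>: "\<alpha> \<in> K.B" "\<alpha> \<noteq> 0" and \<beta>: "\<beta> \<in> K.B" "\<beta> \<noteq> 0"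
    and eq: "smul \<alpha> (iprod I I) = smul \<beta> K.B"
  shows "\<exists>a\<in>K.B. \<exists>b\<in>K.B. a \<noteq> 0 \<and> b \<noteq> 0 \<and> (smul a I = smul b K.B \<or> smul a I = smul b Q)"
proof -
  define \<delta>0 where "\<delta>0 = \<beta> / \<alpha>"
  have \<delta>0E: "\<delta>0 \<in> K.E" unfolding \<delta>0_def using \<alpha> \<beta> K.B_in_E by (intro K.E_divide)
  have \<delta>00: "\<delta>0 \<noteq> 0" using \<alpha> \<beta> by (simp add: \<delta>0_def)
  have "smul (1 / \<alpha>) (smul \<alpha> (iprod I I)) = smul (1 / \<alpha>) (smul \<beta> K.B)" using eq by simp
  then have II: "iprod I I = smul \<delta>0 K.B" using \<alpha> by (simp add: smul_smul \<delta>0_def)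
  have IE: "I \<subseteq> K.E" using I K.B_in_E by (auto simp: is_ideal_def)
  obtain j where j: "is_ideal k.B j" "j \<noteq> {0}" "iprod I (K.cj ` I) = iprod j K.B"
    using K.norm_ideal[OF I] by blast
  define N where "N = \<delta>0 * K.cj \<delta>0"
  have NF: "N \<in> k.E" unfolding N_def by (rule K.norm_F[OF \<delta>0E])
  have cII: "iprod (K.cj ` I) (K.cj ` I) = smul (K.cj \<delta>0) K.B"
    using K.cj_iprod[OF IE IE] II K.cj_smul[OF \<delta>0E K.B_E_subset] K.cj_B_image by simp
  have "iprod (iprod I I) (iprod (K.cj ` I) (K.cj ` I)) = smul N K.B"
    unfolding II cII N_def by (rule iprod_principal[OF R_subring])
  moreover have "iprod (iprod I I) (iprod (K.cj ` I) (K.cj ` I)) = iprod (iprod I (K.cj ` I)) (iprod I (K.cj ` I))"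
    by (simp add: iprod_ac)
  moreover have "\<dots> = iprod (iprod j j) K.B" unfolding j(3) by (rule K.iprod_B_B)
  ultimately have eqB: "iprod (iprod j j) K.B = iprod (smul N k.B) K.B"
    using K.iprod_smul_A_B[of N] by simp
  have jj: "is_ideal k.B (iprod j j)" by (rule iprod_ideal[OF o_subring j(1) j(1)])
  \<comment> \<open>Injectivity of extension brings the equation down to \<open>k\<close>, where
    \<open>o_no_2_torsion\<close> makes \<open>j\<close> principal.\<close>
  have jjN: "iprod j j = smul N k.B"
  proof (rule K.iprod_B_inject[OF _ _ _ _ eqB])
    show "iprod j j \<subseteq> k.E" using jj k.B_in_E by (auto simp: is_ideal_def)
    show "smul N k.B \<subseteq> k.E" using k.E_mult[OF NF k.B_in_E] by (auto simp: smul_def)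
    show "is_module k.B (iprod j j)" using jj by (simp add: is_ideal_iff)
    show "is_module k.B (smul N k.B)" by (rule smul_module[OF subring_module[OF o_subring]])
  qed
  obtain c where c: "c \<in> k.B" "j = smul c k.B" using o_no_2_torsion[OF j(1,2) NF jjN] by blast
  have c0: "c \<noteq> 0" using j(2) c k.A_B[of 0] by (auto simp: smul_def)
  have IcI: "iprod I (K.cj ` I) = smul c K.B" unfolding j(3) c(2) by (rule K.iprod_smul_A_B)
  have "smul N k.B = smul (c * c) k.B" using jjN unfolding c(2) iprod_principal[OF o_subring] by simp
  then obtain v v' where v: "v \<in> k.B" "v' \<in> k.B" "v * v' = 1" "N = v * (c * c)"
    using smul_eq_unit[OF o_subring, of N "c * c"] c0 by auto
  have cE: "c \<in> k.E" by (rule k.B_in_E[OF c(1)])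
  have "v > 0" by (rule norm_unit_pos[OF \<delta>0E \<delta>00 v(1-3) cE]) (use v(4) in \<open>simp add: N_def\<close>)
  \<comment> \<open>The norm of a unit \<open>e\<close> has to turn \<open>v\<close> into a square.
    If \<open>v\<close> is only half a square, \<open>unit_with_nonsquare_norm\<close> supplies the
    missing factor.\<close>
  have "\<exists>e\<in>K.B. \<exists>e'\<in>K.B. e * e' = 1 \<and> (\<exists>w\<in>k.B. w * w = v * (e * K.cj e))"
  proof -
    obtain w where w: "w \<in> k.B" "w * w = v \<or> w * w = 2 * v"
      using o_unit_square[OF v(1-3) \<open>v > 0\<close>] by blast
    from w(2) show ?thesis
    proof
      assume "w * w = v"
      then show ?thesis using w one_R by (intro bexI[of _ 1] conjI bexI[of _ w]) auto
    next
      assume wv: "w * w = 2 * v"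
      obtain \<eta> \<eta>' w1 where \<eta>: "\<eta> \<in> K.B" "\<eta>' \<in> K.B" "\<eta> * \<eta>' = 1" "w1 \<in> k.B" "w1 * w1 = 2 * (\<eta> * K.cj \<eta>)"
        using unit_with_nonsquare_norm by blast
      \<comment> \<open>The two factors 2 combine to a square; \<open>w2\<close> is integral because
        its square is.\<close>
      define w2 where "w2 = w * w1 / 2"
      have "w2 * w2 = (w * w) * (w1 * w1) / 4" by (simp add: w2_def)
      then have w2: "w2 * w2 = v * (\<eta> * K.cj \<eta>)" unfolding wv \<eta>(5) by simp
      have "w2 \<in> k.E" unfolding w2_def using w \<eta> k.B_in_E k.F_E[of 2] by (intro k.E_divide k.E_mult) auto
      moreover have "w2 * w2 \<in> k.B" unfolding w2 by (intro k.B_mult v(1) K.norm_A[OF \<eta>(1)])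
      ultimately have "w2 \<in> k.B" by (rule k.BE.sq_closed)
      then show ?thesis using \<eta> w2 by blast
    qed
  qed
  then obtain e e' w where e: "e \<in> K.B" "e' \<in> K.B" "e * e' = 1" and w: "w \<in> k.B" "w * w = v * (e * K.cj e)" by blast
  note Ne = relative_unit_norm[OF e]
  have wunit: "w * (w * (v' * (e' * K.cj e'))) = 1"
  proof -
    have "w * (w * (v' * (e' * K.cj e'))) = (w * w) * (v' * (e' * K.cj e'))" by simp
    also have "\<dots> = (v * v') * ((e * K.cj e) * (e' * K.cj e'))" unfolding w(2) by (simp only: mult_ac)
    finally show ?thesis using v(3) Ne(3) by simp
  qed
  have w'o: "w * (v' * (e' * K.cj e')) \<in> k.B" by (rule k.B_mult[OF w(1) k.B_mult[OF v(2) Ne(2)]])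
  define \<delta> where "\<delta> = \<delta>0 * e"
  have eE: "e \<in> K.E" by (rule K.B_in_E[OF e(1)])
  have \<delta>E: "\<delta> \<in> K.E" unfolding \<delta>_def by (rule K.E_mult[OF \<delta>0E eE])
  have "smul \<delta> K.B = smul \<delta>0 (smul e K.B)" by (simp add: \<delta>_def smul_smul)
  also have "smul e K.B = K.B" by (rule smul_unit[OF R_subring subring_module[OF R_subring] e])
  finally have II': "iprod I I = smul \<delta> K.B" using II by simp
  have scw: "smul (h * w) K.B = smul h K.B" for h
  proof -
    have "smul w K.B = K.B"
      by (rule smul_unit[OF R_subring subring_module[OF R_subring] o_R[OF w(1)] o_R[OF w'o] wunit])
    then show ?thesis by (metis smul_smul)
  qed
  have "smul (- 1) K.B = K.B"
    by (rule smul_unit[OF R_subring subring_module[OF R_subring], of _ "-1"]) (use int_R[of "-1"] in auto)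
  then have scm: "smul (- h) K.B = smul h K.B" for h by (metis smul_smul mult_minus1_right)
  \<comment> \<open>Again the sign keeps \<open>\<delta> + c'\<close> nonzero.\<close>
  define c' where "c' = (if \<delta> + c * w = 0 then - (c * w) else c * w)"
  have w0: "w \<noteq> 0" using wunit by auto
  have c'0: "\<delta> + c' \<noteq> 0" using c0 w0 by (auto simp: c'_def)
  have wE: "w \<in> k.E" by (rule k.B_in_E[OF w(1)])
  have c'E: "c' \<in> k.E" unfolding c'_def using cE wE k.E_mult k.E_minus by auto
  have IcI': "iprod I (K.cj ` I) = smul c' K.B" unfolding IcI c'_def using scw scm by simp
  have "\<delta> * K.cj \<delta> = N * (e * K.cj e)" unfolding \<delta>_def N_def K.cj_mult[OF \<delta>0E eE] by (simp only: mult_ac)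
  also have "\<dots> = (c * w) * (c * w)"
  proof -
    have "v * (c * c) * (e * K.cj e) = (c * c) * (v * (e * K.cj e))" by (simp only: mult_ac)
    then show ?thesis unfolding v(4) w(2)[symmetric] by (simp add: mult_ac)
  qed
  also have "\<dots> = c' * c'" by (simp add: c'_def)
  finally have N': "\<delta> * K.cj \<delta> = c' * c'" .
  define \<gamma> where "\<gamma> = K.cj \<delta> + c'"
  obtain x g f u u' where g: "\<gamma> \<in> K.B" "\<gamma> \<noteq> 0" and x: "x \<in> k.B" "g \<in> {1, s}" "f \<in> {1, \<pi>, 2}"
    "u \<in> k.B" "u' \<in> k.B" "u * u' = 1" "x \<noteq> 0"
    "iprod (smul \<gamma> I) (smul \<gamma> I) = smul (x * x * g * f) K.B"
    "\<gamma> * \<gamma> * c' * c' = K.cj \<delta> * (u * (x * x) * g * f)"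
    by (rule K.ambiguous_class[OF I \<delta>E c'0 c'E II' IcI' N', folded \<gamma>_def])
  have "is_ideal K.B (smul \<gamma> I)" "smul \<gamma> I \<noteq> {0}"
    using ideal_smul[OF R_subring g(1) I(1)] smul_nonzero[OF g(2) I(2)] by auto
  then show ?thesis using square_root_cases[OF _ _ x(1,7,2,3,8)] g by blast
qed

end

section \<open>The class group\<close>

lemma even_card_involution:
  assumes "finite A" "\<And>x. x \<in> A \<Longrightarrow> f x \<in> A" "\<And>x. x \<in> A \<Longrightarrow> f (f x) = x" "\<And>x. x \<in> A \<Longrightarrow> f x \<noteq> x"
  shows "even (card A)"
  using assms
proof (induction A rule: finite_psubset_induct)
  case (psubset A)
  show ?case
  proof (cases "A = {}")
    case False
    then obtain x where x: "x \<in> A" by blast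
    have fx: "f x \<in> A" "f x \<noteq> x" "f (f x) = x" using psubset.prems x by auto
    have "even (card (A - {x, f x}))"
    proof (rule psubset.IH)
      show "A - {x, f x} \<subset> A" using x by blast
      show "f y \<in> A - {x, f x}" if "y \<in> A - {x, f x}" for y
        using that psubset.prems x fx by (metis DiffD1 DiffD2 DiffI insert_iff singletonD)
    qed (use psubset.prems in auto)
    moreover have "card A = card (A - {x, f x}) + 2"
    proof -
      have "card (A - {x, f x}) = card A - card {x, f x}" using x fx by (intro card_Diff_subset) auto
      moreover have "card {x, f x} = 2" using fx by simp
      moreover have "card {x, f x} \<le> card A" using x fx psubset.hyps by (intro card_mono) auto
      ultimately show ?thesis by linarith
    qed
    ultimately show ?thesis by simp
  qed simp
qed

text \<open>The squaring map is two-to-one, and its image contains no element of order two.\<close>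

lemma (in comm_group) order_mod_4:
  assumes fin: "finite (carrier G)" and q: "q \<in> carrier G" "q \<otimes> q = \<one>"
    and roots: "\<And>x. x \<in> carrier G \<Longrightarrow> x \<otimes> x = \<one> \<Longrightarrow> x = \<one> \<or> x = q"
    and nonsquare: "\<And>x. x \<in> carrier G \<Longrightarrow> x \<otimes> x \<noteq> q"
  shows "card (carrier G) mod 4 = 2"
proof -
  define H where "H = (\<lambda>x. x \<otimes> x) ` carrier G"
  have q1: "q \<noteq> \<one>" using nonsquare[of \<one>] by auto
  have finH: "finite H" using fin by (simp add: H_def)
  have HG: "H \<subseteq> carrier G" by (auto simp: H_def)
  have fib: "card {x \<in> carrier G. x \<otimes> x = h} = 2" if h: "h \<in> H" for h
  proof -
    obtain y where y: "y \<in> carrier G" "h = y \<otimes> y" using h by (auto simp: H_def)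
    have "{x \<in> carrier G. x \<otimes> x = h} = {y, q \<otimes> y}"
    proof
      show "{y, q \<otimes> y} \<subseteq> {x \<in> carrier G. x \<otimes> x = h}"
      proof -
        have "(q \<otimes> y) \<otimes> (q \<otimes> y) = (q \<otimes> q) \<otimes> (y \<otimes> y)" using q(1) y(1) by (simp add: m_ac)
        then show ?thesis using q y by simp
      qed
      show "{x \<in> carrier G. x \<otimes> x = h} \<subseteq> {y, q \<otimes> y}"
      proof
        fix x assume "x \<in> {x \<in> carrier G. x \<otimes> x = h}"
        then have x: "x \<in> carrier G" "x \<otimes> x = y \<otimes> y" using y by auto
        define z where "z = x \<otimes> inv y"
        have z: "z \<in> carrier G" "x = z \<otimes> y" using x y by (simp_all add: z_def m_assoc)
        have "z \<otimes> z = (x \<otimes> x) \<otimes> (inv y \<otimes> inv y)" using x(1) y(1) by (simp add: z_def m_ac)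
        also have "\<dots> = (y \<otimes> inv y) \<otimes> (y \<otimes> inv y)" unfolding x(2) using y(1) inv_closed[OF y(1)] by (simp only: m_ac m_closed)
        also have "\<dots> = \<one>" using y(1) by simp
        finally have "z = \<one> \<or> z = q" using roots z by blast
        then show "x \<in> {y, q \<otimes> y}" using z y by auto
      qed
    qed
    moreover have "y \<noteq> q \<otimes> y" using q1 q(1) y(1) by (metis l_one one_closed right_cancel)
    ultimately show ?thesis by simp
  qed
  have "card (carrier G) = card (\<Union>h\<in>H. {x \<in> carrier G. x \<otimes> x = h})"
    by (rule arg_cong[of _ _ card]) (auto simp: H_def)
  also have "\<dots> = (\<Sum>h\<in>H. card {x \<in> carrier G. x \<otimes> x = h})"
    by (rule card_UN_disjoint) (use fin finH in auto)
  also have "\<dots> = 2 * card H" using fib by simp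
  finally have card: "card (carrier G) = 2 * card H" .
  \<comment> \<open>Inversion pairs off the squares other than the identity, since a fixed one would
    be \<open>q\<close>; hence \<open>H\<close> has odd order.\<close>
  have "even (card (H - {\<one>}))"
  proof (rule even_card_involution[where f = "m_inv G"])
    show "finite (H - {\<one>})" using finH by simp
    fix x assume x: "x \<in> H - {\<one>}"
    then have xG: "x \<in> carrier G" using HG by blast
    obtain y where y: "y \<in> carrier G" "x = y \<otimes> y" using x by (auto simp: H_def)
    have "inv x = inv y \<otimes> inv y" using y by (simp add: inv_mult)
    then have "inv x \<in> H" using y by (auto simp: H_def)
    moreover have "inv x \<noteq> \<one>" using x xG by (metis DiffD2 inv_inv inv_one singletonI)
    ultimately show "inv x \<in> H - {\<one>}" by blast
    show "inv (inv x) = x" using xG by simp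
    show "inv x \<noteq> x"
    proof
      assume "inv x = x"
      then have "x \<otimes> x = \<one>" using xG by (metis r_inv)
      then have "x = q" using roots xG x by blast
      then show False using nonsquare y by metis
    qed
  qed
  moreover have "\<one> \<in> H" unfolding H_def by (rule image_eqI[of _ _ \<one>]) auto
  then have "card H = Suc (card (H - {\<one>}))" using finH by (metis card_Suc_Diff1)
  ultimately have "odd (card H)" by simp
  then show ?thesis unfolding card by presburger
qed

section \<open>The field and the ring of integers of the statement\<close>

context prime7
begin

lemma gen_field_eq: "gen_field \<theta> = K.E"
proof
  show "gen_field \<theta> \<subseteq> K.E"
    unfolding gen_field_def using K.E_subfield K.r_E by blast
  show "K.E \<subseteq> gen_field \<theta>"
    unfolding gen_field_def
  proof (intro subsetI InterI)
    fix z F assume z: "z \<in> K.E" and "F \<in> {F. is_subfield F \<and> \<theta> \<in> F}"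
    then have F: "is_subfield F" and t: "\<theta> \<in> F" by auto
    have F01: "0 \<in> F" "1 \<in> F" and add: "\<And>x y. x \<in> F \<Longrightarrow> y \<in> F \<Longrightarrow> x + y \<in> F"
      and diff: "\<And>x y. x \<in> F \<Longrightarrow> y \<in> F \<Longrightarrow> x - y \<in> F"
      and mul: "\<And>x y. x \<in> F \<Longrightarrow> y \<in> F \<Longrightarrow> x * y \<in> F"
      using F unfolding is_subfield_def by blast+
    have invF: "inverse x \<in> F" if "x \<in> F" for x
      using F F01(1) that by (cases "x = 0") (auto simp: is_subfield_def)
    have nat: "real n \<in> F" for n by (induction n) (use F01 add in auto)
    have int: "of_int n \<in> F" for n
    proof (cases "n \<ge> 0")
      case True
      then show ?thesis using nat[of "nat n"] by simp
    next
      case False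
      then have "of_int n = 0 - real (nat (- n))" by simp
      then show ?thesis using diff[OF F01(1) nat] by metis
    qed
    have rat: "x \<in> F" if x: "x \<in> \<rat>" for x
    proof -
      obtain a b :: int where "x = of_int a / of_int b" using x by (metis Rats_cases')
      then show ?thesis using mul[OF int invF[OF int]] by (simp add: divide_inverse)
    qed
    have s: "s \<in> F" using mul[OF t t] by (simp add: \<theta>_sq)
    have kF: "x \<in> F" if "x \<in> k.E" for x
      using that by (elim k.E_E) (simp add: add[OF rat mul[OF rat s]])
    show "z \<in> F" using z by (elim K.E_E) (simp add: add[OF kF mul[OF kF t]])
  qed
qed

text \<open>The polynomial is the norm from \<open>k\<close> of \<open>X^2 - t X + n\<close>, with
  \<open>t\<close> and \<open>n\<close> the relative trace and norm of \<open>z\<close>; it equals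
  \<open>(X^2 - t0 X + n0)^2 - p (t1 X - n1)^2\<close>.\<close>

lemma alg_int_R:
  assumes z: "z \<in> K.B"
  shows "alg_int z"
proof -
  obtain t0 t1 where t: "z + K.cj z = of_int t0 + of_int t1 * s" using K.trace_A[OF z] by (rule o_cases)
  obtain n0 n1 where n: "z * K.cj z = of_int n0 + of_int n1 * s" using K.norm_A[OF z] by (rule o_cases)
  define q :: "int poly" where "q = [: n0 * n0 - int p * (n1 * n1), 2 * (int p * (t1 * n1)) - 2 * (t0 * n0),
     t0 * t0 + 2 * n0 - int p * (t1 * t1), - 2 * t0, 1 :]"
  have "z * z = (z + K.cj z) * z - z * K.cj z" by (simp add: algebra_simps)
  then have e: "z * z - of_int t0 * z + of_int n0 = s * (of_int t1 * z - of_int n1)"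
    unfolding t n by (simp add: algebra_simps)
  have "poly (map_poly of_int q) z = (z * z - of_int t0 * z + of_int n0) * (z * z - of_int t0 * z + of_int n0)
      - (s * s) * ((of_int t1 * z - of_int n1) * (of_int t1 * z - of_int n1))"
    unfolding s_sq by (simp add: q_def map_poly_pCons algebra_simps)
  also have "\<dots> = 0" unfolding e by (simp add: algebra_simps)
  finally have "poly (map_poly of_int q) z = 0" .
  moreover have "lead_coeff q = 1" by (simp add: q_def)
  ultimately show ?thesis unfolding alg_int_def by blast
qed

text \<open>If \<open>a\<close> clears the denominator of \<open>z\<close>, then
  \<open>a ^ n\<close> clears those of all powers: directly below the degree \<open>n\<close>, and
  by the monic equation from \<open>n\<close> on. Complete closedness does the rest.\<close>

lemma R_if_alg_int:
  assumes z: "z \<in> K.E" and alg: "alg_int z"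
  shows "z \<in> K.B"
proof -
  obtain q :: "int poly" where q: "lead_coeff q = 1" "poly (map_poly of_int q) z = 0"
    using alg unfolding alg_int_def by blast
  define n where "n = Polynomial.degree q"
  have deg: "Polynomial.degree (map_poly real_of_int q) = n"
    unfolding n_def by (rule degree_map_poly) simp
  have "(\<Sum>i\<le>n. of_int (Polynomial.coeff q i) * z ^ i) = 0"
    using q(2) unfolding poly_altdef deg by (simp add: coeff_map_poly)
  then have "(\<Sum>i<n. of_int (Polynomial.coeff q i) * z ^ i) + z ^ n = 0"
    using q(1) by (simp add: lessThan_Suc_atMost[symmetric] n_def)
  then have zn: "z ^ n = - (\<Sum>i<n. of_int (Polynomial.coeff q i) * z ^ i)" by linarith
  obtain a where a: "a \<in> k.B" "a \<noteq> 0" "a * z \<in> K.B" using K.E_frac[OF z] by blast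
  have pow: "x ^ i \<in> K.B" if "x \<in> K.B" for x and i :: nat
    using that by (induction i) (auto simp: one_R K.B_mult)
  have "a ^ n * z ^ i \<in> K.B" for i
  proof (induction i rule: less_induct)
    case (less i)
    show ?case
    proof (cases "i < n")
      case True
      then have "a ^ n * z ^ i = a ^ (n - i) * (a * z) ^ i"
        by (simp add: power_mult_distrib mult.assoc[symmetric] power_add[symmetric])
      also have "\<dots> \<in> K.B" by (intro K.B_mult pow o_R a)
      finally show ?thesis .
    next
      case False
      then have "a ^ n * z ^ i = a ^ n * (z ^ n * z ^ (i - n))" by (simp add: power_add[symmetric])
      also have "\<dots> = - (\<Sum>j<n. of_int (Polynomial.coeff q j) * (a ^ n * z ^ (j + (i - n))))"
        unfolding zn by (simp add: sum_distrib_left sum_distrib_right power_add mult_ac)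
      also have "\<dots> \<in> K.B"
      proof -
        have "of_int (Polynomial.coeff q j) * (a ^ n * z ^ (j + (i - n))) \<in> K.B" if "j < n" for j
          using that False by (intro K.B_mult int_R less.IH) auto
        then have "(\<Sum>j<m. of_int (Polynomial.coeff q j) * (a ^ n * z ^ (j + (i - n)))) \<in> K.B" if "m \<le> n" for m
          using that by (induction m) (auto simp: zero_R intro!: K.B_add)
        then have "(\<Sum>j<n. of_int (Polynomial.coeff q j) * (a ^ n * z ^ (j + (i - n)))) \<in> K.B" by blast
        then show ?thesis using K.B_diff[OF zero_R] by fastforce
      qed
      finally show ?thesis .
    qed
  qed
  moreover have "a ^ n \<in> K.B" "a ^ n \<noteq> 0" using pow[OF o_R[OF a(1)]] a by auto
  ultimately show ?thesis using K_completely_closed z unfolding completely_closed_def by blast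
qed

lemma ring_of_integers_eq: "ring_of_integers K.E = K.B"
  unfolding ring_of_integers_def using alg_int_R R_if_alg_int K.B_in_E by blast

section \<open>Finiteness of the class group\<close>

lemma nrm_mult: "z \<in> K.E \<Longrightarrow> w \<in> K.E \<Longrightarrow> nrm (z * w) = nrm z * nrm w"
proof -
  assume E: "z \<in> K.E" "w \<in> K.E"
  have "(z * w) * K.cj (z * w) = (z * K.cj z) * (w * K.cj w)"
    unfolding K.cj_mult[OF E] by (simp only: mult_ac)
  then show ?thesis
    unfolding nrm_def by (simp only: k.cj_mult[OF K.norm_F[OF E(1)] K.norm_F[OF E(2)]]) (simp only: mult_ac)
qed

text \<open>With \<open>T = \<mu> * (1 + s)\<close>, the two real places contribute
  \<open>T * (1 + \<theta>)\<close> each and the complex one \<open>T * T * (1 + s)\<close>; this is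
  the origin of the exponent 5.\<close>

lemma nrm_bound:
  assumes r: "a \<in> \<rat>" "b \<in> \<rat>" "c \<in> \<rat>" "d \<in> \<rat>"
    and m: "\<bar>a\<bar> \<le> \<mu>" "\<bar>b\<bar> \<le> \<mu>" "\<bar>c\<bar> \<le> \<mu>" "\<bar>d\<bar> \<le> \<mu>"
  shows "\<bar>nrm ((a + b * s) + (c + d * s) * \<theta>)\<bar> \<le> (\<mu> * \<mu>) * (\<mu> * \<mu>) * ((1 + s) ^ 5 * (1 + \<theta>)\<^sup>2)"
proof -
  define A where "A = a + b * s"
  define B where "B = c + d * s"
  have AE: "A \<in> k.E" "B \<in> k.E" unfolding A_def B_def using r by (auto intro: k.E_I)
  have cjA: "k.cj A = a - b * s" "k.cj B = c - d * s" unfolding A_def B_def using r by (auto intro: k.cj_rep)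
  have mu: "0 \<le> \<mu>" using m(1) by linarith
  define T where "T = \<mu> * (1 + s)"
  have T0: "0 \<le> T" using mu s_pos by (simp add: T_def)
  have lin: "\<bar>x + y * s\<bar> \<le> T" "\<bar>x - y * s\<bar> \<le> T" if "\<bar>x\<bar> \<le> \<mu>" "\<bar>y\<bar> \<le> \<mu>" for x y
  proof -
    have "\<bar>y * s\<bar> \<le> \<mu> * s" using that s_pos by (simp add: abs_mult)
    then show "\<bar>x + y * s\<bar> \<le> T" "\<bar>x - y * s\<bar> \<le> T" using that(1) unfolding T_def distrib_left by linarith+
  qed
  have AT: "\<bar>A\<bar> \<le> T" "\<bar>B\<bar> \<le> T" "\<bar>k.cj A\<bar> \<le> T" "\<bar>k.cj B\<bar> \<le> T"
    unfolding cjA unfolding A_def B_def using lin m by auto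
  have "\<bar>B * \<theta>\<bar> \<le> T * \<theta>" using AT \<theta>_pos by (simp add: abs_mult)
  then have zT: "\<bar>A + B * \<theta>\<bar> \<le> T * (1 + \<theta>)" "\<bar>A - B * \<theta>\<bar> \<le> T * (1 + \<theta>)"
    using AT(1) unfolding distrib_left by linarith+
  have sq: "x * x \<le> T * T" if "\<bar>x\<bar> \<le> T" for x :: real
    using mult_mono[OF that that T0 abs_ge_zero] by simp
  have n: "\<bar>k.cj A * k.cj A + s * (k.cj B * k.cj B)\<bar> \<le> T * T * (1 + s)"
  proof -
    have "s * (k.cj B * k.cj B) \<le> s * (T * T)" using sq[OF AT(4)] s_pos by simp
    moreover have "0 \<le> s * (k.cj B * k.cj B)" "0 \<le> k.cj A * k.cj A" using s_pos by auto
    ultimately show ?thesis using sq[OF AT(3)] unfolding distrib_left by (simp add: mult.commute)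
  qed
  have "nrm (A + B * \<theta>) = ((A + B * \<theta>) * (A - B * \<theta>)) * (k.cj A * k.cj A + s * (k.cj B * k.cj B))"
    unfolding nrm_def cj_norm_rep(2)[OF AE] unfolding K.cj_rep[OF AE] ..
  then have "\<bar>nrm (A + B * \<theta>)\<bar> \<le> ((T * (1 + \<theta>)) * (T * (1 + \<theta>))) * (T * T * (1 + s))"
    unfolding abs_mult by (simp only: abs_mult) (intro mult_mono zT n[unfolded abs_mult] mult_nonneg_nonneg T0; use \<theta>_pos T0 in simp)
  also have "\<dots> = (\<mu> * \<mu>) * (\<mu> * \<mu>) * ((1 + s) ^ 5 * (1 + \<theta>)\<^sup>2)"
    by (simp add: T_def power2_eq_square eval_nat_numeral mult_ac)
  finally show ?thesis by (simp add: A_def B_def)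
qed

text \<open>Hurwitz's substitute for division with remainder: of \<open>m ^ 4 + 1\<close> multiples
  of \<open>\<alpha> / \<beta>\<close>, two have their fractional coordinates in the same of
  \<open>m ^ 4\<close> boxes, so for the difference \<open>t\<close> of the two multipliers the
  multiple is within \<open>1 / m\<close> of an integral element in each coordinate.\<close>

lemma euclid_bound:
  "\<exists>M::nat. \<forall>\<alpha>\<in>K.B. \<forall>\<beta>\<in>K.B. \<beta> \<noteq> 0 \<longrightarrow>
     (\<exists>t::nat. 1 \<le> t \<and> t \<le> M \<and> (\<exists>\<omega>\<in>K.B. \<bar>nrm (real t * \<alpha> - \<omega> * \<beta>)\<bar> < \<bar>nrm \<beta>\<bar>))"
proof -
  define C where "C = (1 + s) ^ 5 * (1 + \<theta>)\<^sup>2"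
  \<comment> \<open>The remainder divided by \<open>\<beta>\<close> has norm at most
    \<open>C / m ^ 4\<close>, below 1 once \<open>m\<close> exceeds \<open>C\<close>.\<close>
  obtain m :: nat where m: "C < real m" using reals_Archimedean2 by blast
  have C0: "C > 0" unfolding C_def using s_pos \<theta>_pos by simp
  have m0: "m > 0" using m C0 by (metis less_trans of_nat_0_less_iff)
  have main: "\<exists>t::nat. 1 \<le> t \<and> t \<le> m ^ 4 \<and> (\<exists>\<omega>\<in>K.B. \<bar>nrm (real t * \<alpha> - \<omega> * \<beta>)\<bar> < \<bar>nrm \<beta>\<bar>)"
    if \<alpha>: "\<alpha> \<in> K.B" and \<beta>: "\<beta> \<in> K.B" "\<beta> \<noteq> 0" for \<alpha> \<beta>
  proof -
    have E: "\<alpha> \<in> K.E" "\<beta> \<in> K.E" using \<alpha> \<beta> K.B_in_E by auto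
    have "\<alpha> / \<beta> \<in> K.E" using E by (rule K.E_divide)
    then obtain A B where AB: "A \<in> k.E" "B \<in> k.E" "\<alpha> / \<beta> = A + B * \<theta>" by (rule K.E_E)
    obtain a b where a: "a \<in> \<rat>" "b \<in> \<rat>" "A = a + b * s" using AB(1) by (rule k.E_E)
    obtain c d where c: "c \<in> \<rat>" "d \<in> \<rat>" "B = c + d * s" using AB(2) by (rule k.E_E)
    define h where "h = (\<lambda>x (t::nat). nat \<lfloor>frac (real t * x) * real m\<rfloor>)"
    define H where "H = (\<lambda>t. (h a t, h b t, h c t, h d t))"
    have h: "h x t \<in> {..<m}" for x t
    proof -
      have "frac (real t * x) * real m < real m" using frac_lt_1[of "real t * x"] m0 by simp
      moreover have "0 \<le> frac (real t * x) * real m" by (simp add: frac_ge_0)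
      ultimately show ?thesis unfolding h_def by (simp add: nat_less_iff floor_less_iff)
    qed
    have "H ` {0..m ^ 4} \<subseteq> {..<m} \<times> {..<m} \<times> {..<m} \<times> {..<m}" using h by (auto simp: H_def)
    then have "card (H ` {0..m ^ 4}) \<le> card ({..<m} \<times> {..<m} \<times> {..<m} \<times> {..<m})"
      by (intro card_mono) auto
    also have "\<dots> = m ^ 4" by (simp add: card_cartesian_product eval_nat_numeral)
    also have "\<dots> < card {0..m ^ 4}" by simp
    finally have "\<not> inj_on H {0..m ^ 4}" using pigeonhole by blast
    then obtain i j where ij: "i \<le> m ^ 4" "j \<le> m ^ 4" "i < j" "H i = H j"
      unfolding inj_on_def by (metis atLeastAtMost_iff linorder_neqE_nat)
    have close: "\<bar>frac (real j * x) - frac (real i * x)\<bar> \<le> 1 / real m" if "h x i = h x j" for x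
    proof -
      have "0 \<le> \<lfloor>frac (real i * x) * real m\<rfloor>" "0 \<le> \<lfloor>frac (real j * x) * real m\<rfloor>"
        by (simp_all add: frac_ge_0)
      then have "\<lfloor>frac (real i * x) * real m\<rfloor> = \<lfloor>frac (real j * x) * real m\<rfloor>"
        using that unfolding h_def by (simp add: nat_eq_iff)
      then have "\<bar>frac (real j * x) * real m - frac (real i * x) * real m\<bar> \<le> 1" by linarith
      moreover have "\<bar>frac (real j * x) * real m - frac (real i * x) * real m\<bar> = \<bar>frac (real j * x) - frac (real i * x)\<bar> * real m"
        by (simp add: left_diff_distrib[symmetric] abs_mult)
      ultimately show ?thesis using m0 by (simp add: field_simps)
    qed
    define t where "t = j - i"
    have t: "1 \<le> t" "t \<le> m ^ 4" "real t = real j - real i" using ij by (auto simp: t_def of_nat_diff)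
    define fl where "fl = (\<lambda>x. \<lfloor>real j * x\<rfloor> - \<lfloor>real i * x\<rfloor>)"
    define D where "D = (\<lambda>x. frac (real j * x) - frac (real i * x))"
    have D: "real t * x = of_int (fl x) + D x" for x
      unfolding t(3) fl_def D_def frac_def by (simp add: algebra_simps)
    have DQ: "D x \<in> \<rat>" if "x \<in> \<rat>" for x
    proof -
      have "D x = real t * x - of_int (fl x)" using D[of x] by simp
      also have "\<dots> \<in> \<rat>" using that by simp
      finally show ?thesis .
    qed
    define \<omega> where "\<omega> = qval (fl a, fl b, fl c, fl d)"
    have \<omega>: "\<omega> \<in> K.B" unfolding \<omega>_def by (rule qval_R)
    define \<zeta> where "\<zeta> = (D a + D b * s) + (D c + D d * s) * \<theta>"
    have "real t * (\<alpha> / \<beta>) = (real t * a + real t * b * s) + (real t * c + real t * d * s) * \<theta>"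
      unfolding AB(3) a(3) c(3) by (simp add: algebra_simps)
    also have "\<dots> = \<omega> + \<zeta>" unfolding D by (simp add: \<omega>_def \<zeta>_def qval_def algebra_simps)
    finally have z: "real t * (\<alpha> / \<beta>) = \<omega> + \<zeta>" .
    have \<zeta>E: "\<zeta> \<in> K.E" unfolding \<zeta>_def using DQ a c by (auto intro!: K.E_I k.E_I)
    have "real t * \<alpha> - \<omega> * \<beta> = (real t * (\<alpha> / \<beta>) - \<omega>) * \<beta>" using \<beta> by (simp add: left_diff_distrib)
    also have "\<dots> = \<zeta> * \<beta>" unfolding z by simp
    finally have "nrm (real t * \<alpha> - \<omega> * \<beta>) = nrm \<zeta> * nrm \<beta>" using nrm_mult[OF \<zeta>E E(2)] by simp
    moreover have "\<bar>nrm \<zeta>\<bar> < 1"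
    proof -
      have ab: "\<bar>D a\<bar> \<le> 1 / real m" "\<bar>D b\<bar> \<le> 1 / real m" "\<bar>D c\<bar> \<le> 1 / real m" "\<bar>D d\<bar> \<le> 1 / real m"
        unfolding D_def using ij(4) by (auto simp: H_def intro!: close)
      have "\<bar>nrm \<zeta>\<bar> \<le> ((1 / real m) * (1 / real m)) * ((1 / real m) * (1 / real m)) * C"
        unfolding \<zeta>_def C_def by (intro nrm_bound DQ a c ab)
      also have "\<dots> = C / (real m * (real m * real m * real m))" by simp
      also have "\<dots> < 1"
      proof -
        have "1 * 1 * 1 \<le> real m * real m * real m" using m0 by (intro mult_mono) auto
        then have "real m * 1 \<le> real m * (real m * real m * real m)" by (intro mult_left_mono) auto
        then have "C < real m * (real m * real m * real m)" using m by linarith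
        then show ?thesis using m0 by (simp add: divide_less_eq)
      qed
      finally show ?thesis .
    qed
    moreover have "\<bar>nrm \<beta>\<bar> > 0" using nrm_nz[OF E(2) \<beta>(2)] by simp
    ultimately have "\<bar>nrm (real t * \<alpha> - \<omega> * \<beta>)\<bar> < \<bar>nrm \<beta>\<bar>" by (simp add: abs_mult)
    then show ?thesis using t \<omega> by blast
  qed
  show ?thesis by (rule exI[of _ "m ^ 4"]) (use main in blast)
qed

text \<open>For \<open>\<beta>\<close> of least norm in \<open>I\<close>, the remainder
  \<open>t \<alpha> - \<omega> \<beta>\<close> from \<open>euclid_bound\<close> must vanish, so
  \<open>t \<alpha>\<close> is a multiple of \<open>\<beta>\<close>. All possible \<open>t\<close>
  divide the factorial of the bound, which therefore serves as \<open>N\<close>.\<close>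

lemma class_representative:
  "\<exists>N::nat. N > 0 \<and> (\<forall>I. is_ideal K.B I \<longrightarrow> I \<noteq> {0} \<longrightarrow>
     (\<exists>J a b. is_ideal K.B J \<and> real N \<in> J \<and> a \<in> K.B \<and> a \<noteq> 0 \<and> b \<in> K.B \<and> b \<noteq> 0 \<and> smul a I = smul b J))"
proof -
  obtain M :: nat where M: "\<And>\<alpha> \<beta>. \<alpha> \<in> K.B \<Longrightarrow> \<beta> \<in> K.B \<Longrightarrow> \<beta> \<noteq> 0 \<Longrightarrow>
     \<exists>t::nat. 1 \<le> t \<and> t \<le> M \<and> (\<exists>\<omega>\<in>K.B. \<bar>nrm (real t * \<alpha> - \<omega> * \<beta>)\<bar> < \<bar>nrm \<beta>\<bar>)"
    using euclid_bound by blast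
  define N :: nat where "N = fact M"
  have "\<exists>J a b. is_ideal K.B J \<and> real N \<in> J \<and> a \<in> K.B \<and> a \<noteq> 0 \<and> b \<in> K.B \<and> b \<noteq> 0 \<and> smul a I = smul b J"
    if I: "is_ideal K.B I" "I \<noteq> {0}" for I
  proof -
    have IB: "\<And>x. x \<in> I \<Longrightarrow> x \<in> K.B" and mul: "\<And>a x. a \<in> K.B \<Longrightarrow> x \<in> I \<Longrightarrow> a * x \<in> I"
      using I by (auto simp: is_ideal_def)
    have diff: "x - y \<in> I" if "x \<in> I" "y \<in> I" for x y
      using module_diff[OF R_subring _ that] I by (simp add: is_ideal_iff)
    define nn where "nn = (\<lambda>z. nat \<bar>\<lfloor>nrm z\<rfloor>\<bar>)"
    have nn: "real (nn z) = \<bar>nrm z\<bar>" if "z \<in> I" for z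
      using nrm_Ints[OF IB[OF that]] unfolding nn_def by (auto elim!: Ints_cases)
    obtain z0 where "z0 \<in> I" "z0 \<noteq> 0" using module_nonzero I by (metis is_ideal_iff)
    then obtain \<beta> where \<beta>: "\<beta> \<in> I" "\<beta> \<noteq> 0" and min: "\<And>z. z \<in> I \<Longrightarrow> z \<noteq> 0 \<Longrightarrow> nn \<beta> \<le> nn z"
      using ex_has_least_nat[of "\<lambda>z. z \<in> I \<and> z \<noteq> 0" z0 nn] by blast
    have key: "real N * \<alpha> / \<beta> \<in> K.B" if \<alpha>: "\<alpha> \<in> I" for \<alpha>
    proof -
      obtain t \<omega> where t: "1 \<le> t" "t \<le> M" "\<omega> \<in> K.B" "\<bar>nrm (real t * \<alpha> - \<omega> * \<beta>)\<bar> < \<bar>nrm \<beta>\<bar>"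
        using M[OF IB[OF \<alpha>] IB[OF \<beta>(1)] \<beta>(2)] by blast
      have zI: "real t * \<alpha> - \<omega> * \<beta> \<in> I" using int_R[of "int t"] t \<alpha> \<beta> by (intro diff mul) auto
      have "real t * \<alpha> - \<omega> * \<beta> = 0"
      proof (rule ccontr)
        assume "real t * \<alpha> - \<omega> * \<beta> \<noteq> 0"
        then have "real (nn \<beta>) \<le> real (nn (real t * \<alpha> - \<omega> * \<beta>))" using min[OF zI] by simp
        then show False using t(4) nn[OF \<beta>(1)] nn[OF zI] by linarith
      qed
      then have ta: "real t * \<alpha> / \<beta> = \<omega>" using \<beta> by (simp add: field_simps)
      have "t dvd N" unfolding N_def using t by (intro dvd_fact)
      then obtain e where "N = t * e" by blast
      then have "real N * \<alpha> / \<beta> = of_int (int e) * (real t * \<alpha> / \<beta>)" by simp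
      also have "\<dots> \<in> K.B" unfolding ta by (intro K.B_mult int_R t)
      finally show ?thesis .
    qed
    define J where "J = smul (real N / \<beta>) I"
    have JB: "J \<subseteq> K.B" using key by (auto simp: J_def smul_def)
    have "is_module K.B J" unfolding J_def using I by (intro smul_module) (simp add: is_ideal_iff)
    then have "is_ideal K.B J" using JB by (simp add: is_ideal_iff)
    moreover have "real N \<in> J" using smul_memI[OF \<beta>(1), of "real N / \<beta>"] \<beta> by (simp add: J_def)
    moreover have "smul (real N) I = smul \<beta> J" using \<beta> by (simp add: J_def smul_smul)
    moreover have "real N \<in> K.B" "real N \<noteq> 0" using int_R[of "int N"] by (auto simp: N_def)
    ultimately show ?thesis using \<beta> IB by blast
  qed
  then show ?thesis by (intro exI[of _ N]) (auto simp: N_def)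
qed

text \<open>Every integral element is congruent modulo \<open>N\<close> to one with coordinates in
  \<open>0..<N\<close>, so an ideal containing \<open>N\<close> is determined by its elements in
  this finite box.\<close>

lemma finite_ideals_containing:
  assumes N: "N > (0::nat)"
  shows "finite {J. is_ideal K.B J \<and> real N \<in> J}"
proof -
  define T where "T = {0..<int N}"
  define box where "box = qval ` (T \<times> T \<times> T \<times> T)"
  have fin: "finite box" by (simp add: box_def T_def)
  have sub: "J \<subseteq> J'" if J: "is_ideal K.B J" "real N \<in> J" and J': "is_ideal K.B J'" "real N \<in> J'" and eq: "J \<inter> box = J' \<inter> box" for J J'
  proof
    fix z assume z: "z \<in> J"
    then have "z \<in> K.B" using J by (auto simp: is_ideal_def)
    then obtain a b c d where q: "z = qval (a, b, c, d)" using qval_surj by (metis prod_cases4)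
    define n where "n = int N"
    define w where "w = qval (a mod n, b mod n, c mod n, d mod n)"
    define e where "e = qval (a div n, b div n, c div n, d div n)"
    have dm: "real_of_int x = of_int (x mod n) + of_int (x div n) * real N" for x
    proof -
      have "x = x mod n + (x div n) * n" by simp
      then have "real_of_int x = of_int (x mod n) + of_int (x div n) * of_int n" by (metis of_int_add of_int_mult)
      then show ?thesis unfolding n_def of_int_of_nat_eq .
    qed
    have zw: "z = w + e * real N"
      unfolding q w_def e_def qval_def using dm[of a] dm[of b] dm[of c] dm[of d] by (simp add: algebra_simps)
    have "w \<in> box" unfolding w_def box_def using N by (intro imageI) (simp add: T_def n_def)
    have eR: "e \<in> K.B" unfolding e_def by (rule qval_R)
    have "e * real N \<in> J" "e * real N \<in> J'" using J J' eR by (auto simp: is_ideal_def)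
    then have "z - e * real N \<in> J" using module_diff[OF R_subring _ z] J by (simp add: is_ideal_iff)
    then have "w \<in> J" using zw by simp
    then have "w \<in> J'" using \<open>w \<in> box\<close> eq by blast
    then show "z \<in> J'" unfolding zw using \<open>e * real N \<in> J'\<close> J' by (simp add: is_ideal_def)
  qed
  have "inj_on (\<lambda>J. J \<inter> box) {J. is_ideal K.B J \<and> real N \<in> J}"
    by (rule inj_onI) (use sub in blast)
  moreover have "(\<lambda>J. J \<inter> box) ` {J. is_ideal K.B J \<and> real N \<in> J} \<subseteq> Pow box" by auto
  then have "finite ((\<lambda>J. J \<inter> box) ` {J. is_ideal K.B J \<and> real N \<in> J})" using fin by (meson finite_Pow_iff finite_subset)
  ultimately show ?thesis by (rule finite_imageD[rotated])
qed

section \<open>The class group and its order\<close>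

definition idR :: "real set set" where "idR = nonzero_ideals K.B"

definition eqR :: "(real set \<times> real set) set" where "eqR = ideal_equiv K.B"

definition cls :: "real set \<Rightarrow> real set set" where "cls I = eqR `` {I}"

text \<open>Collecting everything equivalent to a product of members avoids a choice of
  representatives; \<open>cls_mult\<close> shows that the result is again a class.\<close>

definition class_mult :: "real set set \<Rightarrow> real set set \<Rightarrow> real set set" where
  "class_mult X Y = {L. \<exists>I\<in>X. \<exists>J\<in>Y. (iprod I J, L) \<in> eqR}"

lemma idR_iff: "I \<in> idR \<longleftrightarrow> is_ideal K.B I \<and> I \<noteq> {0}"
  by (auto simp: idR_def nonzero_ideals_def)

lemma eqR_iff: "(I, J) \<in> eqR \<longleftrightarrow> I \<in> idR \<and> J \<in> idR \<and> (\<exists>\<alpha>\<in>K.B - {0}. \<exists>\<beta>\<in>K.B - {0}. smul \<alpha> I = smul \<beta> J)"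
  by (simp add: eqR_def ideal_equiv_def idR_def smul_def)

lemma R_mult_nz: "a \<in> K.B - {0} \<Longrightarrow> b \<in> K.B - {0} \<Longrightarrow> a * b \<in> K.B - {0}"
  using K.B_mult by auto

lemma R_one_nz: "1 \<in> K.B - {0}"
  using one_R by auto

lemma equiv_eqR: "equiv idR eqR"
proof (rule equivI)
  show "eqR \<subseteq> idR \<times> idR" by (auto simp: eqR_iff)
  show "refl_on idR eqR" unfolding refl_on_def eqR_iff using R_one_nz by blast
  show "sym eqR" by (rule symI) (auto simp: eqR_iff)
  show "trans eqR"
  proof (rule transI)
    fix I J L assume "(I, J) \<in> eqR" "(J, L) \<in> eqR"
    then obtain a b c d where *: "a \<in> K.B - {0}" "b \<in> K.B - {0}" "smul a I = smul b J"
      "c \<in> K.B - {0}" "d \<in> K.B - {0}" "smul c J = smul d L" "I \<in> idR" "L \<in> idR" by (auto simp: eqR_iff)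
    have "smul (c * a) I = smul c (smul b J)" by (metis *(3) smul_smul)
    also have "\<dots> = smul b (smul d L)" by (metis *(6) smul_smul mult.commute)
    finally have "smul (c * a) I = smul (b * d) L" by (simp add: smul_smul)
    then show "(I, L) \<in> eqR" unfolding eqR_iff using * R_mult_nz by meson
  qed
qed

lemma idR_iprod: "I \<in> idR \<Longrightarrow> J \<in> idR \<Longrightarrow> iprod I J \<in> idR"
  unfolding idR_iff using iprod_ideal[OF R_subring] iprod_nonzero[of K.B] by (simp add: is_ideal_iff)

lemma eqR_iprod: "(I, I') \<in> eqR \<Longrightarrow> (J, J') \<in> eqR \<Longrightarrow> (iprod I J, iprod I' J') \<in> eqR"
proof -
  assume "(I, I') \<in> eqR" "(J, J') \<in> eqR"
  then obtain a b c d where *: "a \<in> K.B - {0}" "b \<in> K.B - {0}" "smul a I = smul b I'"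
      "c \<in> K.B - {0}" "d \<in> K.B - {0}" "smul c J = smul d J'" "I \<in> idR" "I' \<in> idR" "J \<in> idR" "J' \<in> idR" by (auto simp: eqR_iff)
  have "smul (a * c) (iprod I J) = iprod (smul a I) (smul c J)"
    by (simp add: iprod_smul_left iprod_smul_right smul_smul mult.commute)
  also have "\<dots> = smul (b * d) (iprod I' J')"
    unfolding *(3,6) by (simp add: iprod_smul_left iprod_smul_right smul_smul mult.commute)
  finally show ?thesis unfolding eqR_iff using * R_mult_nz idR_iprod by meson
qed

lemma cls_eq_iff: "I \<in> idR \<Longrightarrow> J \<in> idR \<Longrightarrow> cls I = cls J \<longleftrightarrow> (I, J) \<in> eqR"
  unfolding cls_def using eq_equiv_class_iff[OF equiv_eqR] by blast

lemma cls_mult: "I \<in> idR \<Longrightarrow> J \<in> idR \<Longrightarrow> class_mult (cls I) (cls J) = cls (iprod I J)"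
proof -
  assume I: "I \<in> idR" and J: "J \<in> idR"
  have r: "(I, I) \<in> eqR" "(J, J) \<in> eqR" using I J equiv_eqR by (auto simp: equiv_def refl_on_def)
  have tr: "(X, Y) \<in> eqR \<Longrightarrow> (Y, Z) \<in> eqR \<Longrightarrow> (X, Z) \<in> eqR" for X Y Z
    using equiv_eqR by (auto simp: equiv_def dest: transD)
  show ?thesis unfolding class_mult_def cls_def
  proof (intro Set.set_eqI iffI)
    fix L assume "L \<in> {L. \<exists>I'\<in>eqR `` {I}. \<exists>J'\<in>eqR `` {J}. (iprod I' J', L) \<in> eqR}"
    then show "L \<in> eqR `` {iprod I J}" using eqR_iprod tr by blast
  next
    fix L assume "L \<in> eqR `` {iprod I J}"
    then show "L \<in> {L. \<exists>I'\<in>eqR `` {I}. \<exists>J'\<in>eqR `` {J}. (iprod I' J', L) \<in> eqR}" using r by blast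
  qed
qed

definition class_group :: "real set set monoid" where
  "class_group = \<lparr>carrier = cls ` idR, monoid.mult = class_mult, one = cls K.B\<rparr>"

lemma R_idR: "K.B \<in> idR"
  unfolding idR_iff using subring_ideal[OF R_subring] subring_nonzero[OF R_subring] by blast

lemma Q_idR: "Q \<in> idR"
  unfolding idR_iff using Q_ideal Q_nonzero by blast

lemma class_group_comm_group: "comm_group class_group"
proof (rule comm_groupI)
  fix x y assume "x \<in> carrier class_group" "y \<in> carrier class_group"
  then obtain I J where IJ: "I \<in> idR" "J \<in> idR" "x = cls I" "y = cls J" by (auto simp: class_group_def)
  then show "x \<otimes>\<^bsub>class_group\<^esub> y \<in> carrier class_group"
    using idR_iprod by (auto simp: class_group_def cls_mult)
  show "x \<otimes>\<^bsub>class_group\<^esub> y = y \<otimes>\<^bsub>class_group\<^esub> x"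
    using IJ by (simp add: class_group_def cls_mult iprod_commute)
  fix z assume "z \<in> carrier class_group"
  then obtain L where "L \<in> idR" "z = cls L" by (auto simp: class_group_def)
  then show "x \<otimes>\<^bsub>class_group\<^esub> y \<otimes>\<^bsub>class_group\<^esub> z = x \<otimes>\<^bsub>class_group\<^esub> (y \<otimes>\<^bsub>class_group\<^esub> z)"
    using IJ idR_iprod by (simp add: class_group_def cls_mult iprod_assoc)
next
  show "\<one>\<^bsub>class_group\<^esub> \<in> carrier class_group" using R_idR by (simp add: class_group_def)
next
  fix x assume "x \<in> carrier class_group"
  then obtain I where I: "I \<in> idR" "x = cls I" by (auto simp: class_group_def)
  have "iprod K.B I = I" using I(1) by (simp add: idR_iff is_ideal_iff iprod_ring_left R_subring)
  then show "\<one>\<^bsub>class_group\<^esub> \<otimes>\<^bsub>class_group\<^esub> x = x"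
    using I R_idR by (simp add: class_group_def cls_mult)
  obtain I' m where I': "is_ideal K.B I'" "I' \<noteq> {0}" "m \<in> K.B" "m \<noteq> 0" "iprod I I' = smul m K.B"
    using K.BE.inv I(1) unfolding idR_iff by blast
  have I'R: "I' \<in> idR" using I' by (simp add: idR_iff)
  have "smul 1 (iprod I' I) = smul m K.B" using I'(5) by (simp add: iprod_commute)
  then have "(iprod I' I, K.B) \<in> eqR"
    unfolding eqR_iff using idR_iprod[OF I'R I(1)] R_idR R_one_nz I' by blast
  then have "cls (iprod I' I) = cls K.B" using cls_eq_iff idR_iprod[OF I'R I(1)] R_idR by blast
  then show "\<exists>y\<in>carrier class_group. y \<otimes>\<^bsub>class_group\<^esub> x = \<one>\<^bsub>class_group\<^esub>"
    using I I'R by (auto simp: class_group_def cls_mult intro!: bexI[of _ "cls I'"])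
qed

lemma ideal_classes_eq: "ideal_classes K.E = carrier class_group"
  unfolding ideal_classes_def ring_of_integers_eq class_group_def quotient_def
  by (auto simp: cls_def idR_def eqR_def)

lemma class_group_finite: "finite (carrier class_group)"
proof -
  obtain N :: nat where N: "N > 0" and rep: "\<And>I. is_ideal K.B I \<Longrightarrow> I \<noteq> {0} \<Longrightarrow>
     \<exists>J a b. is_ideal K.B J \<and> real N \<in> J \<and> a \<in> K.B \<and> a \<noteq> 0 \<and> b \<in> K.B \<and> b \<noteq> 0 \<and> smul a I = smul b J"
    using class_representative by blast
  have "carrier class_group \<subseteq> cls ` {J. is_ideal K.B J \<and> real N \<in> J}"
  proof
    fix x assume "x \<in> carrier class_group"
    then obtain I where I: "I \<in> idR" "x = cls I" by (auto simp: class_group_def)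
    obtain J a b where J: "is_ideal K.B J" "real N \<in> J" "a \<in> K.B" "a \<noteq> 0" "b \<in> K.B" "b \<noteq> 0" "smul a I = smul b J"
      using rep I(1) unfolding idR_iff by blast
    have "J \<noteq> {0}" using J(2) N by auto
    then have JR: "J \<in> idR" using J by (simp add: idR_iff)
    then have "(I, J) \<in> eqR" unfolding eqR_iff using I J by blast
    then have "x = cls J" using cls_eq_iff I JR by blast
    then show "x \<in> cls ` {J. is_ideal K.B J \<and> real N \<in> J}" using J by blast
  qed
  then show ?thesis using finite_ideals_containing[OF N] by (meson finite_imageI finite_subset)
qed

lemma class_number_mod_4: "class_number (gen_field \<theta>) mod 4 = 2"
proof -
  interpret G: comm_group class_group by (rule class_group_comm_group)
  have mult: "cls I \<otimes>\<^bsub>class_group\<^esub> cls J = cls (iprod I J)" if "I \<in> idR" "J \<in> idR" for I J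
    using that by (simp add: class_group_def cls_mult)
  have one: "\<one>\<^bsub>class_group\<^esub> = cls K.B" by (simp add: class_group_def)
  have "card (carrier class_group) mod 4 = 2"
  proof (rule G.order_mod_4[OF class_group_finite])
    show "cls Q \<in> carrier class_group" using Q_idR by (simp add: class_group_def)
    have "smul 1 (iprod Q Q) = smul \<pi> K.B" by (simp add: Q_Q)
    then have "(iprod Q Q, K.B) \<in> eqR"
      unfolding eqR_iff using idR_iprod[OF Q_idR Q_idR] R_idR R_one_nz o_R[OF pi_o] pi_nz by blast
    then show "cls Q \<otimes>\<^bsub>class_group\<^esub> cls Q = \<one>\<^bsub>class_group\<^esub>"
      using mult[OF Q_idR Q_idR] one cls_eq_iff idR_iprod[OF Q_idR Q_idR] R_idR by simp
  next
    fix x assume "x \<in> carrier class_group" and sq: "x \<otimes>\<^bsub>class_group\<^esub> x = \<one>\<^bsub>class_group\<^esub>"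
    then obtain I where I: "I \<in> idR" "x = cls I" by (auto simp: class_group_def)
    have "cls (iprod I I) = cls K.B" using sq mult[OF I(1) I(1)] one I(2) by simp
    then have "(iprod I I, K.B) \<in> eqR" using cls_eq_iff idR_iprod[OF I(1) I(1)] R_idR by blast
    then obtain \<alpha> \<beta> where ab: "\<alpha> \<in> K.B" "\<alpha> \<noteq> 0" "\<beta> \<in> K.B" "\<beta> \<noteq> 0" "smul \<alpha> (iprod I I) = smul \<beta> K.B"
      unfolding eqR_iff by blast
    have "is_ideal K.B I" "I \<noteq> {0}" using I(1) by (auto simp: idR_iff)
    from ambiguous_ideal_class[OF this ab] have "(I, K.B) \<in> eqR \<or> (I, Q) \<in> eqR"
      unfolding eqR_iff using I(1) R_idR Q_idR by blast
    then show "x = \<one>\<^bsub>class_group\<^esub> \<or> x = cls Q"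
      using cls_eq_iff I R_idR Q_idR one by blast
  next
    fix x assume "x \<in> carrier class_group"
    then obtain I where I: "I \<in> idR" "x = cls I" by (auto simp: class_group_def)
    show "x \<otimes>\<^bsub>class_group\<^esub> x \<noteq> cls Q"
    proof
      assume "x \<otimes>\<^bsub>class_group\<^esub> x = cls Q"
      then have "cls Q = cls (iprod I I)" using mult[OF I(1) I(1)] I(2) by simp
      then have "(Q, iprod I I) \<in> eqR" using cls_eq_iff idR_iprod[OF I(1) I(1)] Q_idR by blast
      then obtain \<alpha> \<beta> where "\<alpha> \<in> K.B" "\<alpha> \<noteq> 0" "\<beta> \<in> K.B" "\<beta> \<noteq> 0" "smul \<alpha> Q = smul \<beta> (iprod I I)"
        unfolding eqR_iff by blast
      then show False using Q_not_square I(1) unfolding idR_iff by blast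
    qed
  qed
  then show ?thesis by (simp add: class_number_def gen_field_eq ideal_classes_eq)
qed

end

theorem theorem1:
  fixes p :: nat
  assumes "prime p" and "p mod 16 = 7"
  shows "class_number (gen_field (root 4 (real p))) mod 4 = 2"
proof -
  interpret prime7 p using assms by unfold_locales
  show ?thesis using class_number_mod_4 unfolding \<theta>_def .
qed

end
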